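(* Let $\theta>0$, $N\in\mathbb{N}$, $k\in\{1,\dots,N\}$, $M\in\mathbb{Z}_{\geq 0}$, let $w_N$ be a positive function on $[-N\theta,M-\theta]$, and let $\mathbb{P}^{\theta,M}_{N,k}$ be the probability measure on $\mathfrak{X}^{\theta,M}_{N,k}$ defined in the context. Assume that there are an open set $\mathcal{M}\subseteq\mathbb{C}$ with $[-N\theta,M+1-\theta]\subseteq\mathcal{M}$ and holomorphic functions $\Phi^+_N,\Phi^-_N$ on $\mathcal{M}$ such that $$\frac{w_N(x)}{w_N(x-1)}=\frac{\Phi^+_N(x)}{\Phi^-_N(x)}\quad\text{whenever } x\in[-N\theta+1,M-\theta].$$ Fix $L\in(0,\infty)$ and $m_j\in\mathbb{Z}_{\geq 0}$ for $j\in\{k,\dots,N\}$, and complex numbers $v^j_i$ ($j\in\{k,\dots,N\}$, $i\in\{1,\dots,m_j\}$) such that $L\,v^j_i\in\mathcal{M}\setminus[-N\theta,M-\theta]$. Let $\Gamma$ be a positively oriented simple contour contained in $L^{-1}\cdot\mathcal{M}$ that encloses $[-\theta N/L,(M-\theta)/L]$, and assume that $\Gamma$ excludes the points $v^j_i,\ v^j_i+L^{-1}$ for $j\in\{k,\dots,N\}$, $i\in\{1,\dots,m_j\}$. Let $v\in\mathbb{C}$ be outside of $\Gamma$ and $$S_v(Lz)=\frac{L(z-v)}{(Lz+N\theta)(Lz-M-1+\theta)}.$$ Then $$0=\sum_{\substack{F_r\subseteq\{1,\dots,m_r\}\\ r=k,\dots,N}}\Bigg\{\prod_{i=k}^N\mathbf{1}\{F_i=\{1,\dots,m_i\}\}\oint_\Gamma\frac{dz\,\Phi^-_N(Lz)}{2\pi\mathrm{i}\,S_v(Lz)}\,M\left(\prod_{p=1}^N\frac{Lz-\ell^N_p-\theta}{Lz-\ell^N_p};F_k,\dots,F_N\right)$$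 $$+\oint_\Gamma\frac{dz\,\Phi^+_N(Lz)}{2\pi\mathrm{i}\,S_v(Lz)}\prod_{i=k}^N\prod_{f\in F_i^c}\frac{1}{L(v^i_f-z)(v^i_f-z+L^{-1})}\,M\left(\prod_{p=1}^k\frac{Lz-\ell^k_p+\theta-1}{Lz-\ell^k_p-1};F_k,\dots,F_N\right)$$ $$+\sum_{j=k+1}^N\prod_{i=k}^{j-1}\mathbf{1}\{F_i=\{1,\dots,m_i\}\}\oint_\Gamma\frac{dz\,\Phi^+_N(Lz)}{2\pi\mathrm{i}\,S_v(Lz)}\prod_{i=j}^N\prod_{f\in F_i^c}\frac{1}{L(v^i_f-z)(v^i_f-z+L^{-1})}\,M\left(\Pi^{\theta,j}_1(Lz);F_k,\dots,F_N\right)\Bigg\},$$ where $$\Pi^{\theta,j}_1(z)=\frac{\theta}{1-\theta}\prod_{i=1}^j\frac{z-\ell^j_i-\theta}{z-\ell^j_i-1}\prod_{i=1}^{j-1}\frac{z-\ell^{j-1}_i+\theta-1}{z-\ell^{j-1}_i}\ \text{ if }\theta\neq 1,\qquad \Pi^{1,j}_1(z)=\sum_{i=1}^j\frac{1}{z-\ell^j_i-1}-\sum_{i=1}^{j-1}\frac{1}{z-\ell^{j-1}_i}\ \text{ if }\theta=1.$$ Here the outer sum is over $(N-k+1)$-tuples of subsets $F_r\subseteq\{1,\dots,m_r\}$, $F_i^c=\{1,\dots,m_i\}\setminus F_i$, and $M(\xi;F_k,\dots,F_N)$ denotes the joint cumulant with respect to $\mathbb{P}^{\theta,M}_{N,k}$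 of $\xi$ and the random variables $G^j_L(v^j_i)$, $j\in\{k,\dots,N\}$, $i\in F_j$, where $G^j_L(z)=\sum_{i=1}^j\frac{1}{z-\ell^j_i/L}$.
   Context: State space. For $n\in\mathbb{N}$ let $\Lambda^M_n = \{(\lambda_1,\dots,\lambda_n)\in\mathbb{Z}^n : M \geq \lambda_1\geq\cdots\geq\lambda_n\geq 0\}$ and $\mathbb{W}^{\theta,M}_n = \{(\ell_1,\dots,\ell_n) : \ell_i = \lambda_i - i\theta,\ (\lambda_1,\dots,\lambda_n)\in\Lambda^M_n\}$. For $\ell\in\mathbb{W}^{\theta,M}_{n}$ and $m\in\mathbb{W}^{\theta,M}_{n-1}$ with $\ell_i=\lambda_i-i\theta$, $m_i=\mu_i-i\theta$, write $\ell\succeq m$ if $\lambda_1\geq\mu_1\geq\lambda_2\geq\mu_2\geq\cdots\geq\mu_{n-1}\geq\lambda_n$. Set $$\mathfrak{X}^{\theta,M}_{N,k} = \{(\ell^N,\ell^{N-1},\dots,\ell^k)\in\mathbb{W}^{\theta,M}_N\times\cdots\times\mathbb{W}^{\theta,M}_k : \ell^N\succeq\ell^{N-1}\succeq\cdots\succeq\ell^k\}.$$ Measure. With $\Gamma(\cdot)$ the Euler gamma function (not to be confused with the contour $\Gamma$), $$\mathbb{P}^{\theta,M}_{N,k}(\ell^N,\dots,\ell^k) = Z^{-1}\, H^t(\ell^N)\, H^b(\ell^k) \prod_{j=k}^{N-1} I(\ell^{j+1},\ell^j),$$ where $Z$ is the normalization constant (making the total mass $1$) and $$I(\ell^{j+1},\ell^j)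 = \prod_{1\leq p<q\leq j+1}\frac{\Gamma(\ell^{j+1}_p-\ell^{j+1}_q+1-\theta)}{\Gamma(\ell^{j+1}_p-\ell^{j+1}_q)} \prod_{1\leq p<q\leq j}\frac{\Gamma(\ell^j_p-\ell^j_q+1)}{\Gamma(\ell^j_p-\ell^j_q+\theta)} \prod_{1\leq p<q\leq j+1}\frac{\Gamma(\ell^j_p-\ell^{j+1}_q)}{\Gamma(\ell^j_p-\ell^{j+1}_q+1-\theta)} \prod_{1\leq p\leq q\leq j}\frac{\Gamma(\ell^{j+1}_p-\ell^j_q+\theta)}{\Gamma(\ell^{j+1}_p-\ell^j_q+1)},$$ $$H^t(\ell^N) = \prod_{1\leq p<q\leq N}\frac{\Gamma(\ell^N_p-\ell^N_q+1)}{\Gamma(\ell^N_p-\ell^N_q+1-\theta)}\prod_{p=1}^N w_N(\ell^N_p), \qquad H^b(\ell^k) = \prod_{1\leq p<q\leq k}\frac{\Gamma(\ell^k_p-\ell^k_q+\theta)}{\Gamma(\ell^k_p-\ell^k_q)}.$$ Joint cumulants. For bounded complex random variables $X_1,\dots,X_n$ the joint cumulant is $$M(X_1,\dots,X_n)=\frac{\partial^n}{\partial z_1\cdots\partial z_n}\log\mathbb{E}\Big[\exp\Big(\sum_{i=1}^n z_iX_i\Big)\Big]\Big|_{z_1=\cdots=z_n=0};$$ it is symmetric in its arguments, and $M(X_1)=\mathbb{E}[X_1]$. (The letter $M$ also denotes the integer parameter; the meaning is clear from context.) Conventions. Empty products are $1$, empty sums are $0$. Since $w_N>0$, the functions $\Phi_N^{\pm}$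 in the ratio identity are necessarily non-vanishing on the indicated interval.
   Formalization: The contour Γ together with its interior is required to lie in L^{-1}·𝓜, not Γ alone; if Γ encircles a hole of 𝓜 the identity can fail (N=k=1, M=0, L=1, no v's, Φ^+=0, Φ^-=1/(z-c), c≠0 enclosed by Γ, off [-θ,1-θ]). *)

theory Defs
  imports "HOL-Complex_Analysis.Complex_Analysis"
begin

text \<open>
  A vector of length \<open>n\<close> is a function that is extensional on the index set \<open>{1..n}\<close>, and a
  sequence \<open>(l\<^sup>N, \<dots>, l\<^sup>k)\<close> is a function that is extensional on \<open>{k..N}\<close>, with \<open>l j\<close> the vector
  on level \<open>j\<close> and \<open>l j i\<close> its \<open>i\<close>-th entry.  Hence all the sets below are finite.
\<close>

definition Lambda_set :: "nat \<Rightarrow> nat \<Rightarrow> (nat \<Rightarrow> int) set" where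
  "Lambda_set M n = {lam \<in> {1..n} \<rightarrow>\<^sub>E {0..int M}. \<forall>i j. 1 \<le> i \<and> i \<le> j \<and> j \<le> n \<longrightarrow> lam j \<le> lam i}"

definition W_set :: "real \<Rightarrow> nat \<Rightarrow> nat \<Rightarrow> (nat \<Rightarrow> real) set" where
  "W_set \<theta> M n = (\<lambda>lam. \<lambda>i\<in>{1..n}. real_of_int (lam i) - real i * \<theta>) ` Lambda_set M n"

text \<open>\<open>x \<succeq> y\<close> for \<open>x\<close> of length \<open>n\<close> and \<open>y\<close> of length \<open>n - 1\<close>, in terms of
  \<open>\<lambda>\<^sub>i = x\<^sub>i + i\<theta>\<close> and \<open>\<mu>\<^sub>i = y\<^sub>i + i\<theta>\<close>.\<close>

definition interlaces :: "real \<Rightarrow> nat \<Rightarrow> (nat \<Rightarrow> real) \<Rightarrow> (nat \<Rightarrow> real) \<Rightarrow> bool" where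
  "interlaces \<theta> n x y \<longleftrightarrow>
     (\<forall>i\<in>{1..<n}. x i + real i * \<theta> \<ge> y i + real i * \<theta> \<and>
                  y i + real i * \<theta> \<ge> x (Suc i) + real (Suc i) * \<theta>)"

definition X_set :: "real \<Rightarrow> nat \<Rightarrow> nat \<Rightarrow> nat \<Rightarrow> (nat \<Rightarrow> nat \<Rightarrow> real) set" where
  "X_set \<theta> M N k =
     {l \<in> (\<Pi>\<^sub>E j\<in>{k..N}. W_set \<theta> M j). \<forall>j\<in>{k..<N}. interlaces \<theta> (Suc j) (l (Suc j)) (l j)}"

definition lt_pairs :: "nat \<Rightarrow> (nat \<times> nat) set" where
  "lt_pairs n = {(p, q). 1 \<le> p \<and> p < q \<and> q \<le> n}"

definition le_pairs :: "nat \<Rightarrow> (nat \<times> nat) set" where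
  "le_pairs n = {(p, q). 1 \<le> p \<and> p \<le> q \<and> q \<le> n}"

text \<open>\<open>I_weight \<theta> j x y\<close> is \<open>I(x, y)\<close> for \<open>x\<close> on level \<open>j + 1\<close> and \<open>y\<close> on level \<open>j\<close>.\<close>

definition I_weight :: "real \<Rightarrow> nat \<Rightarrow> (nat \<Rightarrow> real) \<Rightarrow> (nat \<Rightarrow> real) \<Rightarrow> real" where
  "I_weight \<theta> j x y =
     (\<Prod>(p, q)\<in>lt_pairs (j + 1). Gamma (x p - x q + 1 - \<theta>) / Gamma (x p - x q)) *
     (\<Prod>(p, q)\<in>lt_pairs j. Gamma (y p - y q + 1) / Gamma (y p - y q + \<theta>)) *
     (\<Prod>(p, q)\<in>lt_pairs (j + 1). Gamma (y p - x q) / Gamma (y p - x q + 1 - \<theta>)) *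
     (\<Prod>(p, q)\<in>le_pairs j. Gamma (x p - y q + \<theta>) / Gamma (x p - y q + 1))"

definition H_top :: "real \<Rightarrow> (real \<Rightarrow> real) \<Rightarrow> nat \<Rightarrow> (nat \<Rightarrow> real) \<Rightarrow> real" where
  "H_top \<theta> w N x =
     (\<Prod>(p, q)\<in>lt_pairs N. Gamma (x p - x q + 1) / Gamma (x p - x q + 1 - \<theta>)) *
     (\<Prod>p = 1..N. w (x p))"

definition H_bot :: "real \<Rightarrow> nat \<Rightarrow> (nat \<Rightarrow> real) \<Rightarrow> real" where
  "H_bot \<theta> k x = (\<Prod>(p, q)\<in>lt_pairs k. Gamma (x p - x q + \<theta>) / Gamma (x p - x q))"

definition weight ::
    "real \<Rightarrow> (real \<Rightarrow> real) \<Rightarrow> nat \<Rightarrow> nat \<Rightarrow> (nat \<Rightarrow> nat \<Rightarrow> real) \<Rightarrow> real" where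
  "weight \<theta> w N k l =
     H_top \<theta> w N (l N) * H_bot \<theta> k (l k) * (\<Prod>j = k..<N. I_weight \<theta> j (l (Suc j)) (l j))"

definition P_measure ::
    "real \<Rightarrow> (real \<Rightarrow> real) \<Rightarrow> nat \<Rightarrow> nat \<Rightarrow> nat \<Rightarrow> (nat \<Rightarrow> nat \<Rightarrow> real) measure" where
  "P_measure \<theta> w M N k =
     point_measure (X_set \<theta> M N k)
       (\<lambda>l. ennreal (weight \<theta> w N k l / (\<Sum>l'\<in>X_set \<theta> M N k. weight \<theta> w N k l')))"

text \<open>\<open>\<partial>\<^sup>n f / \<partial>z\<^sub>0 \<dots> \<partial>z\<^bsub>n-1\<^esub>\<close>, evaluated at \<open>z\<close>.\<close>

fun mixed_partial :: "nat \<Rightarrow> ((nat \<Rightarrow> complex) \<Rightarrow> complex) \<Rightarrow> (nat \<Rightarrow> complex) \<Rightarrow> complex" where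
  "mixed_partial 0 f z = f z"
| "mixed_partial (Suc n) f z = deriv (\<lambda>u. mixed_partial n f (z(n := u))) (z n)"

text \<open>Near \<open>z = 0\<close> the expectation is close to \<open>1\<close>, so the principal branch \<open>Ln\<close> is the branch
  of the logarithm that is holomorphic there and vanishes at \<open>z = 0\<close>.\<close>

definition joint_cumulant :: "'a measure \<Rightarrow> ('a \<Rightarrow> complex) list \<Rightarrow> complex" where
  "joint_cumulant P Xs =
     mixed_partial (length Xs)
       (\<lambda>z. Ln (integral\<^sup>L P (\<lambda>\<omega>. exp (\<Sum>i<length Xs. z i * (Xs ! i) \<omega>)))) (\<lambda>_. 0)"

definition G_obs :: "real \<Rightarrow> nat \<Rightarrow> complex \<Rightarrow> (nat \<Rightarrow> nat \<Rightarrow> real) \<Rightarrow> complex" where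
  "G_obs L j z l = (\<Sum>i = 1..j. 1 / (z - of_real (l j i / L)))"

text \<open>\<open>cumulant_G \<theta> w M N k L v \<xi> F\<close> is \<open>M(\<xi>; F\<^sub>k, \<dots>, F\<^sub>N)\<close>, the joint cumulant of \<open>\<xi>\<close> and of the
  \<open>G_obs L j (v j i)\<close> with \<open>j \<in> {k..N}\<close> and \<open>i \<in> F j\<close>; it does not depend on the order in which
  the latter are listed.\<close>

definition cumulant_G ::
    "real \<Rightarrow> (real \<Rightarrow> real) \<Rightarrow> nat \<Rightarrow> nat \<Rightarrow> nat \<Rightarrow> real \<Rightarrow> (nat \<Rightarrow> nat \<Rightarrow> complex) \<Rightarrow>
     ((nat \<Rightarrow> nat \<Rightarrow> real) \<Rightarrow> complex) \<Rightarrow> (nat \<Rightarrow> nat set) \<Rightarrow> complex" where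
  "cumulant_G \<theta> w M N k L v \<xi> F =
     joint_cumulant (P_measure \<theta> w M N k)
       (\<xi> # concat (map (\<lambda>j. map (\<lambda>i. G_obs L j (v j i)) (sorted_list_of_set (F j))) [k..<Suc N]))"

definition Pi_obs :: "real \<Rightarrow> nat \<Rightarrow> complex \<Rightarrow> (nat \<Rightarrow> nat \<Rightarrow> real) \<Rightarrow> complex" where
  "Pi_obs \<theta> j z l =
     (if \<theta> = 1 then
        (\<Sum>i = 1..j. 1 / (z - of_real (l j i) - 1)) -
        (\<Sum>i = 1..j - 1. 1 / (z - of_real (l (j - 1) i)))
      else
        of_real (\<theta> / (1 - \<theta>)) *
        (\<Prod>i = 1..j. (z - of_real (l j i) - of_real \<theta>) / (z - of_real (l j i) - 1)) *
        (\<Prod>i = 1..j - 1. (z - of_real (l (j - 1) i) + of_real \<theta> - 1) / (z - of_real (l (j - 1) i))))"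

text \<open>The value \<open>S\<^sub>v(Lz)\<close>, as a function of the unscaled variable \<open>z\<close>.\<close>

definition S_scaled :: "real \<Rightarrow> nat \<Rightarrow> nat \<Rightarrow> real \<Rightarrow> complex \<Rightarrow> complex \<Rightarrow> complex" where
  "S_scaled \<theta> M N L v z =
     of_real L * (z - v) /
     ((of_real L * z + of_nat N * of_real \<theta>) * (of_real L * z - of_nat M - 1 + of_real \<theta>))"

text \<open>The bounded component of the complement of a simple closed curve is \<open>inside\<close>, the unbounded
  one is \<open>outside\<close>; the orientation is expressed by the winding number, which is \<open>1\<close> or \<open>-1\<close> on
  the whole inside.\<close>

definition pos_simple_contour :: "(real \<Rightarrow> complex) \<Rightarrow> bool" where
  "pos_simple_contour \<gamma> \<longleftrightarrow>
     valid_path \<gamma> \<and> simple_path \<gamma> \<and> pathfinish \<gamma> = pathstart \<gamma> \<and>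
     (\<forall>z\<in>inside (path_image \<gamma>). winding_number \<gamma> z = 1)"

end

(* The cumulants kappa(F) of xi and (X_f)_{f in F} are determined by the relations
   sum_{A subset F} kappa(A) E[prod_{F - A} X] = E[xi prod_F X].  They are linear in xi, and
   replacing X_f by X_f + e_f on the right-hand side replaces kappa(F) by
   sum_{A subset F} (prod_{F - A} e) kappa(A).  So the sum over the F_r is the cumulant that belongs
   to the family of moments in which X_f is replaced by X_f + 1 / (L (v_f - z) (v_f - z + 1 / L)) on
   all levels from the level of the observable upwards, and it is enough that the integral of these
   moments vanishes.  At Lz = s the added term turns an entry s - 1 of a level into the entry s.

   The integrand extends holomorphically to the inside of the contour because its residues cancel in
   pairs.  The observable of level j + 1 (the Phi^- term if j = N) has a pole at an entry l^j_a = s.  Let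
   i be the lowest level with l^i_a = ... = l^j_a = s, and let l' arise from l by lowering this string of
   entries by 1.  Then the observable of level i has at l' a pole at l'^i_a + 1 = s, and the two
   residues, weighted with the probabilities of l and l', are opposite.  The residue vanishes when the
   string cannot be lowered, or raised, except at s = - N theta and s = M + 1 - theta, where 1 / S_v
   vanishes.  No point of the contour is a genuine pole, so all integrals exist separately. *)
theory Submission
  imports Defs
begin

text \<open>Exchanging the sums with the contour integral requires every single integrand to be
  integrable, while the contour need only surround
  \<open>[- N * \<theta> / L, (M - \<theta>) / L]\<close>. A formal pole at an entry plus one can
  lie to the right of this interval, hence on the contour. Its residue is zero there: otherwise the
  entry could be raised, to a configuration with an entry out of range. Only
  \<open>M + 1 - \<theta>\<close> escapes this argument. Such points are removable, but with
  \<open>x / 0 = 0\<close> the integrands take stray values at them, so integrals are compared up to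
  finitely many points. The two exceptional values stem from the bounds 0 and \<open>M\<close> of
  the integer coordinates. When a neighbouring entry blocks a move of the string, it also produces a
  zero factor of the residue. No such neighbour exists only for entry \<open>N\<close> of level
  \<open>N\<close> when lowering, and for entry 1 when raising. The poles that one observable
  inherits from its two levels can coincide, which forces \<open>\<theta>\<close> to be the
  reciprocal of a positive integer. Interlacing then forces further equalities between entries, and
  these cancel the pole.\<close>

section \<open>Cumulants from moments\<close>


text \<open>\<open>cumul a b\<close> is the solution \<open>c\<close> of \<open>(\<Sum>A\<in>Pow F. c A * a (F - A)) = b F\<close>.  If \<open>a A\<close> and
  \<open>b A\<close> are the expectations of \<open>\<Prod>i\<in>A. Y i\<close> and of \<open>\<xi> * (\<Prod>i\<in>A. Y i)\<close>, it is the joint cumulant of \<open>\<xi>\<close>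
  and the \<open>Y i\<close>.\<close>

function cumul :: "('i set \<Rightarrow> 'c::field) \<Rightarrow> ('i set \<Rightarrow> 'c) \<Rightarrow> 'i set \<Rightarrow> 'c" where
  "cumul a b F = (if finite F then (b F - (\<Sum>A\<in>Pow F - {F}. cumul a b A * a (F - A))) / a {} else 0)"
  by auto
termination
  by (relation "Wellfounded.measure (\<lambda>(a, b, F). card F)") (auto intro: psubset_card_mono)

declare cumul.simps [simp del]

lemma cumul_rec:
  assumes "finite F" "a {} \<noteq> 0"
  shows "(\<Sum>A\<in>Pow F. cumul a b A * a (F - A)) = b F"
proof -
  have "(\<Sum>A\<in>Pow F. cumul a b A * a (F - A)) =
      cumul a b F * a {} + (\<Sum>A\<in>Pow F - {F}. cumul a b A * a (F - A))"
    using assms(1) by (subst sum.remove[of _ F]) auto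
  also have "cumul a b F * a {} = b F - (\<Sum>A\<in>Pow F - {F}. cumul a b A * a (F - A))"
    using assms by (subst cumul.simps) simp
  finally show ?thesis by simp
qed

text \<open>The system is triangular: the term \<open>A = F\<close> has the nonzero coefficient
  \<open>a {}\<close>, so the values on proper subsets fix the value on \<open>F\<close>. Linearity,
  relabelling and shifting are proved by checking the recursion for the proposed solution.\<close>

lemma cumul_unique:
  assumes "finite S" "a {} \<noteq> 0"
    and "\<And>F. F \<subseteq> S \<Longrightarrow> (\<Sum>A\<in>Pow F. c A * a (F - A)) = b F"
  shows "c S = cumul a b S"
proof -
  have "c F = cumul a b F" if "F \<subseteq> S" for F
    using finite_subset[OF that assms(1)] that
  proof (induction F rule: finite_psubset_induct)
    case (psubset F)
    have "(\<Sum>A\<in>Pow F. c A * a (F - A)) = c F * a {} + (\<Sum>A\<in>Pow F - {F}. c A * a (F - A))"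
      using psubset.hyps by (subst sum.remove[of _ F]) auto
    also have "(\<Sum>A\<in>Pow F - {F}. c A * a (F - A)) = (\<Sum>A\<in>Pow F - {F}. cumul a b A * a (F - A))"
      using psubset.IH psubset.prems by (intro sum.cong) auto
    finally have "c F * a {} = b F - (\<Sum>A\<in>Pow F - {F}. cumul a b A * a (F - A))"
      using assms(3)[OF psubset.prems] by (simp add: algebra_simps)
    then show ?case
      using assms(2) psubset.hyps by (subst cumul.simps) (simp add: field_simps)
  qed
  then show ?thesis by simp
qed

lemma cumul_sum:
  assumes "finite S" "a {} \<noteq> 0"
  shows "cumul a (\<lambda>F. \<Sum>x\<in>X. r x * b x F) S = (\<Sum>x\<in>X. r x * cumul a (b x) S)"
proof (rule sym, rule cumul_unique[where a=a, OF assms])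
  fix F assume "F \<subseteq> S"
  then have F: "finite F" using assms(1) finite_subset by auto
  have "(\<Sum>A\<in>Pow F. (\<Sum>x\<in>X. r x * cumul a (b x) A) * a (F - A)) =
      (\<Sum>x\<in>X. \<Sum>A\<in>Pow F. r x * cumul a (b x) A * a (F - A))"
    by (simp add: sum_distrib_right sum.swap[of _ X])
  also have "\<dots> = (\<Sum>x\<in>X. r x * b x F)"
    by (intro sum.cong refl)
      (simp add: cumul_rec[where a=a, OF F assms(2), symmetric] sum_distrib_left mult.assoc)
  finally show "(\<Sum>A\<in>Pow F. (\<Sum>x\<in>X. r x * cumul a (b x) A) * a (F - A)) = (\<Sum>x\<in>X. r x * b x F)" .
qed

lemma cumul_zero: "finite S \<Longrightarrow> a {} \<noteq> 0 \<Longrightarrow> cumul a (\<lambda>_. 0) S = 0"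
  by (rule cumul_unique[of S a "\<lambda>_. 0", symmetric]) auto

lemma cumul_cong:
  assumes "\<And>F. F \<subseteq> S \<Longrightarrow> b F = b' F" "\<And>F. F \<subseteq> S \<Longrightarrow> a F = a' F"
  shows "cumul a b S = cumul a' b' S"
proof (cases "finite S")
  case True
  then show ?thesis using assms
  proof (induction S rule: finite_psubset_induct)
    case (psubset S)
    have "(\<Sum>A\<in>Pow S - {S}. cumul a b A * a (S - A)) = (\<Sum>A\<in>Pow S - {S}. cumul a' b' A * a' (S - A))"
    proof (intro sum.cong refl)
      fix A assume "A \<in> Pow S - {S}"
      then have A: "A \<subset> S" by auto
      have "cumul a b A = cumul a' b' A"
        by (rule psubset.IH[OF A]) (use A psubset.prems in auto)
      moreover have "a (S - A) = a' (S - A)" using psubset.prems(2)[of "S - A"] by blast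
      ultimately show "cumul a b A * a (S - A) = cumul a' b' A * a' (S - A)" by simp
    qed
    then show ?case
      by (subst (1 2) cumul.simps) (simp add: psubset.prems)
  qed
next
  case False
  then show ?thesis by (subst (1 2) cumul.simps) simp
qed

text \<open>Passes from list positions, by which \<open>joint_cumulant\<close> indexes its
  variables, to the indices of the variables themselves.\<close>

lemma cumul_image:
  assumes "finite S" "a {} \<noteq> 0" "inj_on h S"
  shows "cumul (\<lambda>A. a (h ` A)) (\<lambda>A. b (h ` A)) S = cumul a b (h ` S)"
proof (rule sym, rule cumul_unique)
  show "finite S" by fact
  show "a (h ` {}) \<noteq> 0" using assms(2) by simp
  fix F assume F: "F \<subseteq> S"
  then have fin: "finite F" using assms(1) finite_subset by auto
  have inj: "inj_on h F" using assms(3) F inj_on_subset by blast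
  have "(\<Sum>A\<in>Pow F. cumul a b (h ` A) * a (h ` (F - A))) =
      (\<Sum>A\<in>Pow F. cumul a b (h ` A) * a (h ` F - h ` A))"
    by (intro sum.cong refl) (simp add: inj_on_image_set_diff[OF inj])
  also have "\<dots> = (\<Sum>B\<in>Pow (h ` F). cumul a b B * a (h ` F - B))"
    by (intro sum.reindex_bij_betw[OF bij_betw_Pow[OF inj_on_imp_bij_betw[OF inj]],
          of "\<lambda>B. cumul a b B * a (h ` F - B)"])
  also have "\<dots> = b (h ` F)" using cumul_rec[of "h ` F" a b] fin assms(2) by simp
  finally show "(\<Sum>A\<in>Pow F. cumul a b (h ` A) * a (h ` (F - A))) = b (h ` F)" .
qed

text \<open>The defining relation is a convolution over the splittings of a set into two disjoint
  parts. Expanding the product of \<open>X f + e f\<close> convolves the right-hand side with the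
  products of \<open>e\<close>, and associativity lets the same convolution act on the solution
  instead.\<close>

lemma cumul_shift:
  fixes a :: "'i set \<Rightarrow> 'c::field"
  assumes "finite S" "a {} \<noteq> 0"
  shows "cumul a (\<lambda>F. p * (\<Prod>f\<in>F. X f + e f)) S =
    (\<Sum>F\<in>Pow S. (\<Prod>f\<in>S - F. e f) * cumul a (\<lambda>F. p * (\<Prod>f\<in>F. X f)) F)"
proof (rule sym, rule cumul_unique[where a=a, OF assms])
  let ?b = "\<lambda>F. p * (\<Prod>f\<in>F. X f)"
  fix F assume "F \<subseteq> S"
  then have F: "finite F" using assms(1) finite_subset by auto
  have "(\<Sum>A\<in>Pow F. (\<Sum>B\<in>Pow A. (\<Prod>f\<in>A - B. e f) * cumul a ?b B) * a (F - A)) =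
      (\<Sum>(A, B)\<in>(SIGMA A:Pow F. Pow A). (\<Prod>f\<in>A - B. e f) * cumul a ?b B * a (F - A))"
    using F by (subst sum.Sigma[symmetric]) (auto simp: sum_distrib_right intro: finite_subset)
  also have "\<dots> = (\<Sum>(R, B)\<in>(SIGMA R:Pow F. Pow (F - R)). (\<Prod>f\<in>R. e f) * cumul a ?b B * a (F - R - B))"
    by (rule sum.reindex_bij_witness[of _ "\<lambda>(R, B). (R \<union> B, B)" "\<lambda>(A, B). (A - B, B)"])
      (auto intro!: arg_cong[of _ _ a])
  also have "\<dots> = (\<Sum>R\<in>Pow F. (\<Prod>f\<in>R. e f) * (\<Sum>B\<in>Pow (F - R). cumul a ?b B * a (F - R - B)))"
    using F by (subst sum.Sigma[symmetric]) (auto simp: sum_distrib_left mult.assoc)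
  also have "\<dots> = (\<Sum>R\<in>Pow F. (\<Prod>f\<in>R. e f) * ?b (F - R))"
    by (rule sum.cong[OF refl], subst cumul_rec) (use F assms(2) in auto)
  also have "\<dots> = p * (\<Prod>f\<in>F. e f + X f)"
    by (subst prod_add[OF F]) (simp add: sum_distrib_left mult.left_commute mult.commute)
  finally show "(\<Sum>A\<in>Pow F. (\<Sum>B\<in>Pow A. (\<Prod>f\<in>A - B. e f) * cumul a ?b B) * a (F - A)) =
      p * (\<Prod>f\<in>F. X f + e f)"
    by (simp add: add.commute)
qed

lemma Pow_insert_disjoint_sum:
  fixes g :: "'i set \<Rightarrow> 'c::comm_monoid_add"
  assumes "finite F" "j \<notin> F"
  shows "(\<Sum>A\<in>Pow (insert j F). g A) = (\<Sum>A\<in>Pow F. g A) + (\<Sum>A\<in>Pow F. g (insert j A))"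
proof -
  have inj: "inj_on (insert j) (Pow F)" using assms(2) by (auto simp: inj_on_def)
  show ?thesis
    unfolding Pow_insert using assms
    by (subst sum.union_disjoint) (auto simp: sum.reindex[OF inj] o_def)
qed

text \<open>If differentiation of the data inserts \<open>j\<close> into the index set, it does so
  for the solution too. The Leibniz rule applied to the recursion for \<open>F\<close> gives the
  recursion for \<open>insert j F\<close>, whose subsets are split according to whether they contain
  \<open>j\<close>.\<close>

lemma cumul_has_field_derivative:
  fixes a b :: "'c::real_normed_field \<Rightarrow> 'i set \<Rightarrow> 'c"
  assumes "finite F" "j \<notin> F" "a u {} \<noteq> 0"
    and da: "\<And>A. A \<subseteq> F \<Longrightarrow> ((\<lambda>x. a x A) has_field_derivative a u (insert j A)) (at u)"
    and db: "\<And>A. A \<subseteq> F \<Longrightarrow> ((\<lambda>x. b x A) has_field_derivative b u (insert j A)) (at u)"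
  shows "((\<lambda>x. cumul (a x) (b x) F) has_field_derivative cumul (a u) (b u) (insert j F)) (at u)"
  using assms(1,2) da db
proof (induction F rule: finite_psubset_induct)
  case (psubset F)
  define c where "c = (\<lambda>x A. cumul (a x) (b x) A)"
  have IH: "((\<lambda>x. c x A) has_field_derivative c u (insert j A)) (at u)" if "A \<subset> F" for A
    unfolding c_def by (rule psubset.IH) (use that psubset.prems in \<open>auto\<close>)
  have c_eq: "c x F = (b x F - (\<Sum>A\<in>Pow F - {F}. c x A * a x (F - A))) / a x {}" for x
    unfolding c_def using psubset.hyps by (subst cumul.simps) simp
  let ?D = "((b u (insert j F) - (\<Sum>A\<in>Pow F - {F}. c u (insert j A) * a u (F - A) + a u (insert j (F - A)) * c u A))
      * a u {} - (b u F - (\<Sum>A\<in>Pow F - {F}. c u A * a u (F - A))) * a u (insert j {})) / (a u {} * a u {})"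
  have "((\<lambda>x. c x F) has_field_derivative ?D) (at u)"
    unfolding c_eq
    by (intro DERIV_divide DERIV_diff DERIV_sum DERIV_mult psubset.prems IH) (use assms(3) in auto)
  moreover have "?D = c u (insert j F)"
  proof -
    have jA: "insert j F - A = insert j (F - A)" "insert j F - insert j A = F - A" if "A \<subseteq> F" for A
      using that psubset.prems(1) by auto
    have "b u (insert j F) = (\<Sum>A\<in>Pow (insert j F). c u A * a u (insert j F - A))"
      unfolding c_def using psubset.hyps assms(3) by (subst cumul_rec) auto
    also have "\<dots> = (\<Sum>A\<in>Pow F. c u A * a u (insert j F - A)) + (\<Sum>A\<in>Pow F. c u (insert j A) * a u (insert j F - insert j A))"
      using psubset.hyps psubset.prems(1) by (rule Pow_insert_disjoint_sum)
    also have "\<dots> = (\<Sum>A\<in>Pow F. c u (insert j A) * a u (F - A) + a u (insert j (F - A)) * c u A)"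
      unfolding sum.distrib[symmetric]
      by (rule sum.cong[OF refl]) (simp only: jA Pow_iff, simp add: ac_simps)
    also have "\<dots> = c u (insert j F) * a u {} + a u (insert j {}) * c u F +
       (\<Sum>A\<in>Pow F - {F}. c u (insert j A) * a u (F - A) + a u (insert j (F - A)) * c u A)"
      using psubset.hyps by (subst sum.remove[of _ F]) auto
    finally have "b u (insert j F) - (\<Sum>A\<in>Pow F - {F}. c u (insert j A) * a u (F - A) + a u (insert j (F - A)) * c u A)
       = c u (insert j F) * a u {} + a u (insert j {}) * c u F" by (simp add: algebra_simps)
    moreover have "b u F - (\<Sum>A\<in>Pow F - {F}. c u A * a u (F - A)) = c u F * a u {}"
      using c_eq[of u] assms(3) by simp
    ultimately show ?thesis using assms(3) by (simp add: field_simps)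
  qed
  ultimately show ?case unfolding c_def by simp
qed


section \<open>Mixed derivatives of the logarithm of the exponential moment\<close>

lemma exp_linear_form_derivative:
  fixes z :: "nat \<Rightarrow> complex"
  assumes "j < n"
  shows "((\<lambda>u. exp (\<Sum>i<n. (z(j := u)) i * c i)) has_field_derivative
      exp (\<Sum>i<n. (z(j := u0)) i * c i) * c j) (at u0)"
proof -
  have eq: "(\<Sum>i<n. (z(j := u)) i * c i) = u * c j + (\<Sum>i\<in>{..<n} - {j}. z i * c i)" for u
    using assms by (subst sum.remove[of _ j]) auto
  show ?thesis unfolding eq by (auto intro!: derivative_eq_intros)
qed

context
  fixes P :: "'a measure" and X :: "'a set" and p :: "'a \<Rightarrow> real" and Xs :: "('a \<Rightarrow> complex) list"
  assumes finite_X: "finite X"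
    and sum_p: "(\<Sum>x\<in>X. p x) = 1"
    and integral_P: "\<And>g :: 'a \<Rightarrow> complex. integral\<^sup>L P g = (\<Sum>x\<in>X. of_real (p x) * g x)"
begin

text \<open>Moments under the exponentially tilted, unnormalised weights. The factor
  \<open>f\<close> is kept apart from the product over \<open>A\<close> because \<open>f = 1\<close>
  and \<open>f = Xs ! 0\<close> supply the two arguments of \<open>cumul\<close>.\<close>

definition tilted_moment :: "('a \<Rightarrow> complex) \<Rightarrow> (nat \<Rightarrow> complex) \<Rightarrow> nat set \<Rightarrow> complex" where
  "tilted_moment f z A = (\<Sum>x\<in>X. f x * (of_real (p x) *
     exp (\<Sum>i<length Xs. z i * (Xs ! i) x) * (\<Prod>i\<in>A. (Xs ! i) x)))"

lemma tilted_moment_derivative: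
  assumes "j < length Xs" "j \<notin> A" "finite A"
  shows "((\<lambda>u. tilted_moment f (z(j := u)) A) has_field_derivative
    tilted_moment f (z(j := u0)) (insert j A)) (at u0)"
proof -
  have "((\<lambda>u. tilted_moment f (z(j := u)) A) has_field_derivative
    (\<Sum>x\<in>X. f x * (of_real (p x) * (exp (\<Sum>i<length Xs. (z(j := u0)) i * (Xs ! i) x) * (Xs ! j) x)
      * (\<Prod>i\<in>A. (Xs ! i) x)))) (at u0)"
    unfolding tilted_moment_def
    by (intro DERIV_sum DERIV_cmult DERIV_cmult_right exp_linear_form_derivative assms(1))
  also have "(\<Sum>x\<in>X. f x * (of_real (p x) * (exp (\<Sum>i<length Xs. (z(j := u0)) i * (Xs ! i) x) * (Xs ! j) x)
      * (\<Prod>i\<in>A. (Xs ! i) x))) = tilted_moment f (z(j := u0)) (insert j A)"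
    unfolding tilted_moment_def
    by (rule sum.cong[OF refl]) (simp add: assms prod.insert_if ac_simps)
  finally show ?thesis .
qed

text \<open>The first derivative of the logarithm is a quotient of tilted moments, which is
  \<open>cumul\<close> on the empty set; each further derivative inserts one index. The claim is
  made for all \<open>z\<close> with positive real part of the expectation, and not just for 0,
  because it has to be differentiated again.\<close>

lemma Ln_integral_mixed_partial:
  assumes "Re (tilted_moment (\<lambda>_. 1) z {}) > 0" "m < length Xs"
  shows "mixed_partial (Suc m)
      (\<lambda>z. Ln (integral\<^sup>L P (\<lambda>\<omega>. exp (\<Sum>i<length Xs. z i * (Xs ! i) \<omega>)))) z =
    cumul (tilted_moment (\<lambda>_. 1) z) (tilted_moment (Xs ! 0) z) {1..m}"
  using assms
proof (induction m arbitrary: z)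
  let ?a = "tilted_moment (\<lambda>_. 1)"
  have Ln_eq: "Ln (integral\<^sup>L P (\<lambda>\<omega>. exp (\<Sum>i<length Xs. z i * (Xs ! i) \<omega>))) = Ln (?a z {})" for z
    by (simp add: integral_P tilted_moment_def)
  {
    case 0
    have "((\<lambda>u. ?a (z(0 := u)) {}) has_field_derivative ?a (z(0 := z 0)) {0}) (at (z 0))"
      by (rule tilted_moment_derivative) (use 0 in auto)
    moreover have "?a (z(0 := z 0)) {} \<notin> \<real>\<^sub>\<le>\<^sub>0"
      using 0 by (auto simp: complex_nonpos_Reals_iff)
    ultimately have "((\<lambda>u. Ln (?a (z(0 := u)) {})) has_field_derivative
        inverse (?a (z(0 := z 0)) {}) * ?a (z(0 := z 0)) {0}) (at (z 0))"
      by (rule DERIV_chain2[OF has_field_derivative_Ln, rotated])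
    then have "mixed_partial (Suc 0)
        (\<lambda>z. Ln (integral\<^sup>L P (\<lambda>\<omega>. exp (\<Sum>i<length Xs. z i * (Xs ! i) \<omega>)))) z = ?a z {0} / ?a z {}"
      by (simp add: Ln_eq DERIV_imp_deriv field_simps)
    \<comment> \<open>Here the variable 0 moves from the index set into the factor \<open>f\<close>,
      and from now on only the indices 1, 2, ... are inserted.\<close>
    also have "?a z {0} = tilted_moment (Xs ! 0) z {}"
      by (simp add: tilted_moment_def ac_simps)
    finally show ?case by (simp add: cumul.simps)
  next
    case (Suc m)
    let ?j = "Suc m"
    let ?F = "\<lambda>z. Ln (integral\<^sup>L P (\<lambda>\<omega>. exp (\<Sum>i<length Xs. z i * (Xs ! i) \<omega>)))"
    \<comment> \<open>The induction hypothesis holds where the real part is positive. This is an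
      open condition on the coordinate \<open>Suc m\<close>, and \<open>deriv\<close> sees only the
      germ.\<close>
    have "isCont (\<lambda>u. ?a (z(?j := u)) {}) (z ?j)"
      using tilted_moment_derivative[of ?j "{}"] Suc.prems(2) by (blast intro: DERIV_isCont)
    then have "isCont (\<lambda>u. Re (?a (z(?j := u)) {})) (z ?j)" by (rule continuous_Re)
    then have "((\<lambda>u. Re (?a (z(?j := u)) {})) \<longlongrightarrow> Re (?a (z(?j := z ?j)) {})) (nhds (z ?j))"
      unfolding isCont_def by (rule tendsto_at_iff_tendsto_nhds[THEN iffD1])
    then have "\<forall>\<^sub>F u in nhds (z ?j). Re (?a (z(?j := u)) {}) > 0"
      by (rule order_tendstoD) (use Suc.prems in simp)
    then have ev: "\<forall>\<^sub>F u in nhds (z ?j). mixed_partial (Suc m) ?F (z(?j := u)) =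
        cumul (?a (z(?j := u))) (tilted_moment (Xs ! 0) (z(?j := u))) {1..m}"
      by eventually_elim (rule Suc.IH, assumption, use Suc.prems in linarith)
    have "((\<lambda>u. cumul (?a (z(?j := u))) (tilted_moment (Xs ! 0) (z(?j := u))) {1..m}) has_field_derivative
        cumul (?a (z(?j := z ?j))) (tilted_moment (Xs ! 0) (z(?j := z ?j))) (insert ?j {1..m})) (at (z ?j))"
      by (rule cumul_has_field_derivative; (rule tilted_moment_derivative)?)
        (use Suc.prems in \<open>auto intro: finite_subset\<close>)
    then show ?case
      unfolding mixed_partial.simps(2)[of "Suc m"] deriv_cong_ev[OF ev refl]
      by (simp add: DERIV_imp_deriv atLeastAtMostSuc_conv)
  }
qed

lemma joint_cumulant_eq_cumul:
  assumes "Xs \<noteq> []"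
  shows "joint_cumulant P Xs =
    cumul (\<lambda>A. \<Sum>x\<in>X. of_real (p x) * (\<Prod>i\<in>A. (Xs ! i) x))
      (\<lambda>A. \<Sum>x\<in>X. (Xs ! 0) x * (of_real (p x) * (\<Prod>i\<in>A. (Xs ! i) x))) {1..length Xs - 1}"
proof -
  have "tilted_moment (\<lambda>_. 1) (\<lambda>_. 0) {} = 1"
    by (simp add: tilted_moment_def sum_p flip: of_real_sum)
  then have "joint_cumulant P Xs =
      cumul (tilted_moment (\<lambda>_. 1) (\<lambda>_. 0)) (tilted_moment (Xs ! 0) (\<lambda>_. 0)) {1..length Xs - 1}"
    unfolding joint_cumulant_def
    using Ln_integral_mixed_partial[of "\<lambda>_. 0" "length Xs - 1"] assms by simp
  then show ?thesis by (simp add: tilted_moment_def [abs_def])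
qed

end

text \<open>By linearity in the first variable, its values appear as coefficients; what remains for
  each outcome \<open>x\<close> is the cumulant of the indicator of \<open>x\<close> with the
  variables \<open>Y i\<close>.\<close>

lemma joint_cumulant_indexed:
  fixes Y :: "'i \<Rightarrow> 'a \<Rightarrow> complex"
  assumes "finite X" "(\<Sum>x\<in>X. p x) = 1"
    and "\<And>g :: 'a \<Rightarrow> complex. integral\<^sup>L P g = (\<Sum>x\<in>X. of_real (p x) * g x)"
    and "distinct js"
  shows "joint_cumulant P (\<xi> # map Y js) =
    (\<Sum>x\<in>X. \<xi> x * cumul (\<lambda>A. \<Sum>x\<in>X. of_real (p x) * (\<Prod>i\<in>A. Y i x))
      (\<lambda>A. of_real (p x) * (\<Prod>i\<in>A. Y i x)) (set js))"
proof -
  \<comment> \<open>Position 0 of the list is occupied by \<open>\<xi>\<close>, so position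
    \<open>n\<close> holds the variable with index \<open>js ! (n - 1)\<close>.\<close>
  define h where "h n = js ! (n - 1)" for n
  let ?n = "length js"
  have inj: "inj_on h {1..?n}"
    unfolding h_def inj_on_def using assms(4) by (auto simp: nth_eq_iff_index_eq)
  have img: "h ` {1..?n} = set js"
  proof -
    have "h ` {1..?n} = (\<lambda>i. js ! i) ` {0..<?n}"
      unfolding h_def by (force simp: image_iff Bex_def intro: exI[of _ "Suc _"])
    then show ?thesis by (auto simp: set_conv_nth image_iff)
  qed
  have prod_eq: "(\<Prod>i\<in>A. ((\<xi> # map Y js) ! i) x) = (\<Prod>i\<in>h ` A. Y i x)" if "A \<subseteq> {1..?n}" for A x
  proof -
    have "(\<Prod>i\<in>h ` A. Y i x) = (\<Prod>i\<in>A. Y (h i) x)"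
      using inj_on_subset[OF inj that] by (simp add: prod.reindex)
    also have "\<dots> = (\<Prod>i\<in>A. ((\<xi> # map Y js) ! i) x)"
      using that by (intro prod.cong refl) (auto simp: h_def nth_Cons' subset_iff)
    finally show ?thesis ..
  qed
  let ?a = "\<lambda>A. \<Sum>x\<in>X. complex_of_real (p x) * (\<Prod>i\<in>A. Y i x)"
  let ?b = "\<lambda>A. \<Sum>x\<in>X. \<xi> x * (complex_of_real (p x) * (\<Prod>i\<in>A. Y i x))"
  have a0: "?a {} \<noteq> 0" using assms(2) by (simp flip: of_real_sum)
  have "joint_cumulant P (\<xi> # map Y js) = cumul (\<lambda>A. ?a (h ` A)) (\<lambda>A. ?b (h ` A)) {1..?n}"
    by (subst joint_cumulant_eq_cumul[OF assms(1-3)]) (auto intro!: cumul_cong simp: prod_eq)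
  also have "\<dots> = cumul ?a ?b (set js)"
    by (subst cumul_image[of _ ?a _ ?b]) (use a0 inj img in auto)
  also have "\<dots> = (\<Sum>x\<in>X. \<xi> x * cumul ?a (\<lambda>A. of_real (p x) * (\<Prod>i\<in>A. Y i x)) (set js))"
    by (rule cumul_sum[where a = ?a]) (use a0 in auto)
  finally show ?thesis .
qed

section \<open>Configurations and their strings\<close>


text \<open>Recovers the integer coordinate, in which order, bounds and interlacing have no
  \<open>\<theta>\<close>.\<close>

definition part :: "real \<Rightarrow> (nat \<Rightarrow> nat \<Rightarrow> real) \<Rightarrow> nat \<Rightarrow> nat \<Rightarrow> real" where
  "part \<theta> l r i = l r i + real i * \<theta>"

lemma W_set_iff:
  "y \<in> W_set \<theta> M n \<longleftrightarrow> y \<in> extensional {1..n} \<and>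
     (\<forall>b\<in>{1..n}. y b + real b * \<theta> \<in> \<int> \<and> 0 \<le> y b + real b * \<theta> \<and> y b + real b * \<theta> \<le> real M) \<and>
     (\<forall>b\<in>{1..n}. \<forall>c\<in>{b..n}. y c + real c * \<theta> \<le> y b + real b * \<theta>)" (is "?L \<longleftrightarrow> ?R")
proof
  assume ?L
  then obtain lam where lam: "lam \<in> Lambda_set M n"
    and y: "y = (\<lambda>i\<in>{1..n}. real_of_int (lam i) - real i * \<theta>)"
    unfolding W_set_def by auto
  have "0 \<le> lam b \<and> lam b \<le> int M" if "b \<in> {1..n}" for b
    using lam that by (auto simp: Lambda_set_def PiE_iff)
  moreover have "lam c \<le> lam b" if "b \<in> {1..n}" "c \<in> {b..n}" for b c
    using lam that by (auto simp: Lambda_set_def)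
  ultimately show ?R by (force simp: y)
next
  assume R: ?R
  define lam where "lam = (\<lambda>i\<in>{1..n}. \<lfloor>y i + real i * \<theta>\<rfloor>)"
  have eq: "real_of_int (lam b) = y b + real b * \<theta>" if "b \<in> {1..n}" for b
    using R that by (auto simp: lam_def elim!: Ints_cases)
  have "lam \<in> Lambda_set M n"
    unfolding Lambda_set_def
  proof (intro CollectI conjI allI impI)
    show "lam \<in> {1..n} \<rightarrow>\<^sub>E {0..int M}"
    proof
      fix b assume b: "b \<in> {1..n}"
      have "0 \<le> real_of_int (lam b) \<and> real_of_int (lam b) \<le> real M"
        using R b by (simp add: eq)
      then show "lam b \<in> {0..int M}" by auto
    qed (auto simp: lam_def)
    fix i j assume "1 \<le> i \<and> i \<le> j \<and> j \<le> n"
    then have "real_of_int (lam j) \<le> real_of_int (lam i)"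
      using R by (subst (1 2) eq) auto
    then show "lam j \<le> lam i" by simp
  qed
  moreover have "y = (\<lambda>i\<in>{1..n}. real_of_int (lam i) - real i * \<theta>)"
  proof
    fix b
    show "y b = (\<lambda>i\<in>{1..n}. real_of_int (lam i) - real i * \<theta>) b"
      using R eq[of b] by (cases "b \<in> {1..n}") (auto simp: extensional_def)
  qed
  ultimately show ?L unfolding W_set_def by auto
qed

lemma X_set_iff:
  "l \<in> X_set \<theta> M N k \<longleftrightarrow> l \<in> extensional {k..N} \<and> (\<forall>r\<in>{k..N}. l r \<in> extensional {1..r}) \<and>
     (\<forall>r\<in>{k..N}. \<forall>b\<in>{1..r}. part \<theta> l r b \<in> \<int> \<and> 0 \<le> part \<theta> l r b \<and> part \<theta> l r b \<le> real M) \<and>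
     (\<forall>r\<in>{k..N}. \<forall>b\<in>{1..r}. \<forall>c\<in>{b..r}. part \<theta> l r c \<le> part \<theta> l r b) \<and>
     (\<forall>r\<in>{k..<N}. \<forall>b\<in>{1..r}. part \<theta> l r b \<le> part \<theta> l (Suc r) b \<and> part \<theta> l (Suc r) (Suc b) \<le> part \<theta> l r b)"
proof -
  have "{1..<Suc r} = {1..r}" for r by auto
  then show ?thesis
    unfolding X_set_def PiE_iff W_set_iff interlaces_def part_def by auto
qed

lemma finite_X_set: "finite (X_set \<theta> M N k)"
proof -
  have "finite (Lambda_set M n)" for n
    unfolding Lambda_set_def
    by (rule finite_subset[of _ "{1..n} \<rightarrow>\<^sub>E {0..int M}"]) (auto intro: finite_PiE)
  then have "finite (\<Pi>\<^sub>E j\<in>{k..N}. W_set \<theta> M j)"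
    by (auto intro!: finite_PiE simp: W_set_def)
  then show ?thesis unfolding X_set_def by (rule rev_finite_subset) auto
qed

lemma X_set_nonempty: "X_set \<theta> M N k \<noteq> {}"
proof -
  have "(\<lambda>r\<in>{k..N}. \<lambda>b\<in>{1..r}. - real b * \<theta>) \<in> X_set \<theta> M N k"
    by (auto simp: X_set_iff part_def)
  then show ?thesis by auto
qed

definition shift_down :: "nat \<Rightarrow> nat \<Rightarrow> nat \<Rightarrow> (nat \<Rightarrow> nat \<Rightarrow> real) \<Rightarrow> nat \<Rightarrow> nat \<Rightarrow> real" where
  "shift_down i j a l = (\<lambda>r. if i \<le> r \<and> r \<le> j then (l r)(a := l r a - 1) else l r)"

definition shift_up :: "nat \<Rightarrow> nat \<Rightarrow> nat \<Rightarrow> (nat \<Rightarrow> nat \<Rightarrow> real) \<Rightarrow> nat \<Rightarrow> nat \<Rightarrow> real" where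
  "shift_up i j a l = (\<lambda>r. if i \<le> r \<and> r \<le> j then (l r)(a := l r a + 1) else l r)"

lemma shift_up_down [simp]: "shift_up i j a (shift_down i j a l) = l"
  and shift_down_up [simp]: "shift_down i j a (shift_up i j a l) = l"
  by (auto simp: shift_up_def shift_down_def fun_eq_iff)

lemma part_shift_down:
  "part \<theta> (shift_down i j a l) r b = (if i \<le> r \<and> r \<le> j \<and> b = a then part \<theta> l r b - 1 else part \<theta> l r b)"
  by (simp add: part_def shift_down_def)

lemma part_shift_up:
  "part \<theta> (shift_up i j a l) r b = (if i \<le> r \<and> r \<le> j \<and> b = a then part \<theta> l r b + 1 else part \<theta> l r b)"
  by (simp add: part_def shift_up_def)

lemma Ints_less_le_diff:
  fixes x y :: real
  assumes "x \<in> \<int>" "y \<in> \<int>" "x < y"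
  shows "x \<le> y - 1"
proof -
  obtain m n where "x = of_int m" "y = of_int n" using assms(1,2) by (auto elim!: Ints_cases)
  with assms(3) show ?thesis by simp
qed

section \<open>Order relations between the entries of a configuration\<close>

locale corners =
  fixes \<theta> :: real and N k M :: nat
  assumes theta_pos: "\<theta> > 0" and k_pos: "1 \<le> k" and k_le: "k \<le> N"
begin

abbreviation X where "X \<equiv> X_set \<theta> M N k"
abbreviation \<pi> where "\<pi> \<equiv> part \<theta>"

lemma X_mono: "\<lbrakk>l \<in> X; r \<in> {k..N}; 1 \<le> b; b \<le> c; c \<le> r\<rbrakk> \<Longrightarrow> \<pi> l r c \<le> \<pi> l r b"
  by (auto simp: X_set_iff)

lemma X_Ints: "\<lbrakk>l \<in> X; r \<in> {k..N}; b \<in> {1..r}\<rbrakk> \<Longrightarrow> \<pi> l r b \<in> \<int>"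
  by (auto simp: X_set_iff)

lemma X_bounds: "\<lbrakk>l \<in> X; r \<in> {k..N}; b \<in> {1..r}\<rbrakk> \<Longrightarrow> 0 \<le> \<pi> l r b \<and> \<pi> l r b \<le> real M"
  by (auto simp: X_set_iff)

lemma X_interlace_up: "\<lbrakk>l \<in> X; k \<le> r; r < N; b \<in> {1..r}\<rbrakk> \<Longrightarrow> \<pi> l r b \<le> \<pi> l (Suc r) b"
  by (auto simp: X_set_iff)

lemma X_interlace_down: "\<lbrakk>l \<in> X; k \<le> r; r < N; b \<in> {1..r}\<rbrakk> \<Longrightarrow> \<pi> l (Suc r) (Suc b) \<le> \<pi> l r b"
  by (auto simp: X_set_iff)

lemma X_level_mono: "\<lbrakk>l \<in> X; k \<le> r; r \<le> r'; r' \<le> N; b \<in> {1..r}\<rbrakk> \<Longrightarrow> \<pi> l r b \<le> \<pi> l r' b"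
proof (induction r')
  case (Suc n)
  show ?case
  proof (cases "r = Suc n")
    case False
    then have "\<pi> l r b \<le> \<pi> l n b" using Suc.prems by (intro Suc.IH) auto
    also have "\<dots> \<le> \<pi> l (Suc n) b" using Suc.prems False by (intro X_interlace_up) auto
    finally show ?thesis .
  qed simp
qed simp

text \<open>This gap and the two gaps between neighbouring levels below keep all Gamma arguments in
  the weight positive.\<close>

lemma X_gap:
  assumes "l \<in> X" "r \<in> {k..N}" "1 \<le> p" "p < q" "q \<le> r"
  shows "l r p - l r q \<ge> \<theta>"
proof -
  have "real q * \<theta> \<ge> real (p + 1) * \<theta>" using assms theta_pos by (intro mult_right_mono) auto
  then show ?thesis using X_mono[of l r p q] assms by (simp add: part_def algebra_simps)
qed

lemma X_gap_upper:
  assumes "l \<in> X" "k \<le> r" "r < N" "1 \<le> b" "b < q" "q \<le> Suc r"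
  shows "l r b - l (Suc r) q \<ge> \<theta>"
proof -
  have "real q * \<theta> \<ge> real (b + 1) * \<theta>" using assms theta_pos by (intro mult_right_mono) auto
  moreover have "\<pi> l (Suc r) q \<le> \<pi> l (Suc r) (Suc b)" using assms by (intro X_mono) auto
  moreover have "\<pi> l (Suc r) (Suc b) \<le> \<pi> l r b" using assms by (intro X_interlace_down) auto
  ultimately show ?thesis by (simp add: part_def algebra_simps)
qed

lemma X_gap_lower:
  assumes "l \<in> X" "k \<le> r" "r < N" "1 \<le> q" "q \<le> b" "b \<le> r"
  shows "l (Suc r) q - l r b \<ge> 0"
proof -
  have "real b * \<theta> \<ge> real q * \<theta>" using assms theta_pos by (intro mult_right_mono) auto
  moreover have "\<pi> l r b \<le> \<pi> l r q" using assms by (intro X_mono) auto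
  moreover have "\<pi> l r q \<le> \<pi> l (Suc r) q" using assms by (intro X_interlace_up) auto
  ultimately show ?thesis by (simp add: part_def algebra_simps)
qed

text \<open>Distinct entries make the poles contributed by a single level simple.\<close>

lemma X_inj:
  assumes "l \<in> X" "r \<in> {k..N}"
  shows "inj_on (l r) {1..r}"
proof (rule linorder_inj_onI')
  fix p q assume "p \<in> {1..r}" "q \<in> {1..r}" "p < q"
  then show "l r p \<noteq> l r q" using X_gap[OF assms, of p q] theta_pos by auto
qed

lemma X_range:
  assumes "l \<in> X" "r \<in> {k..N}" "b \<in> {1..r}"
  shows "- real N * \<theta> \<le> l r b \<and> l r b \<le> real M - \<theta>"
proof -
  have "real b * \<theta> \<le> real N * \<theta>" "1 * \<theta> \<le> real b * \<theta>"
    using assms theta_pos by (auto intro!: mult_right_mono)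
  then show ?thesis using X_bounds[OF assms] by (simp add: part_def)
qed

text \<open>The coefficient \<open>rplus l t a s\<close> is the residue at \<open>s = l t a + 1\<close> of the level-\<open>t\<close> observable
  of the loop equation, and \<open>rminus l t a s\<close> is the residue at \<open>s = l t a\<close> of the observable of
  level \<open>t + 1\<close> (of the \<open>\<Phi>\<^sup>-\<close>-term if \<open>t = N\<close>).  If both \<open>s - 1\<close> is an entry of level \<open>t + 1\<close> and
  \<open>s\<close> is one of level \<open>t\<close>, there is no pole, and the convention \<open>x / 0 = 0\<close> gives \<open>0\<close> for both.\<close>

definition rplus :: "(nat \<Rightarrow> nat \<Rightarrow> real) \<Rightarrow> nat \<Rightarrow> nat \<Rightarrow> real \<Rightarrow> real" where
  "rplus l t a s = \<theta> *
     (\<Prod>q\<in>{1..t} - {a}. if t = k then (s - l t q + \<theta> - 1) / (s - l t q - 1) else (s - l t q - \<theta>) / (s - l t q - 1)) *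
     (if t = k then 1 else \<Prod>q = 1..t - 1. (s - l (t - 1) q + \<theta> - 1) / (s - l (t - 1) q))"

definition rminus :: "(nat \<Rightarrow> nat \<Rightarrow> real) \<Rightarrow> nat \<Rightarrow> nat \<Rightarrow> real \<Rightarrow> real" where
  "rminus l t a s = - \<theta> *
     (\<Prod>q\<in>{1..t} - {a}. if t = N then (s - l t q - \<theta>) / (s - l t q) else (s - l t q + \<theta> - 1) / (s - l t q)) *
     (if t = N then 1 else \<Prod>q = 1..t + 1. (s - l (t + 1) q - \<theta>) / (s - l (t + 1) q - 1))"

text \<open>A pole at \<open>s = l j a\<close> for \<open>l\<close> is paired with a pole at \<open>s = l' i a + 1\<close> for \<open>l'\<close>.\<close>

definition string_rel where
  "string_rel s l l' i j a \<longleftrightarrow> l \<in> X \<and> l' \<in> X \<and> k \<le> i \<and> i \<le> j \<and> j \<le> N \<and> 1 \<le> a \<and> a \<le> i \<and>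
     (\<forall>r\<in>{i..j}. l r a = s) \<and> l' = shift_down i j a l"

section \<open>Uniqueness and existence of the partner configuration\<close>

lemma string_rel_lower_entries:
  assumes "string_rel s l l' i j a"
  shows "r \<in> {i..j} \<Longrightarrow> l' r a = s - 1"
  using assms by (auto simp: string_rel_def shift_down_def)

text \<open>With two different lower ends, the configuration with the higher end would have
  \<open>s\<close> as entry \<open>a\<close> just below that end and \<open>s - 1\<close> at the
  end, against interlacing.\<close>

lemma string_rel_unique_lower:
  assumes "string_rel s l l1 i1 j a" "string_rel s l l2 i2 j a"
  shows "i1 = i2 \<and> l1 = l2"
proof -
  have False if R: "string_rel s l l1 i1 j a" "string_rel s l l2 i2 j a" "i1 < i2" for i1 i2 l1 l2
  proof -
    obtain r where r: "i2 = Suc r" using R(3) by (cases i2) auto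
    have "l2 r a = s" "l2 i2 a = s - 1" "l2 \<in> X"
      using R r by (auto simp: string_rel_def shift_down_def)
    then show False
      using X_interlace_up[of l2 r a] R r by (auto simp: string_rel_def part_def)
  qed
  then have "i1 = i2" using assms by (metis linorder_neqE_nat)
  then show ?thesis using assms by (auto simp: string_rel_def)
qed

text \<open>With two different upper ends, the configuration with the lower end would have
  \<open>s\<close> as entry \<open>a\<close> at that end and \<open>s - 1\<close> one level above,
  against interlacing.\<close>

lemma string_rel_unique_upper:
  assumes "string_rel s l1 l' i j1 a" "string_rel s l2 l' i j2 a"
  shows "j1 = j2 \<and> l1 = l2"
proof -
  have False if R: "string_rel s l1 l' i j1 a" "string_rel s l2 l' i j2 a" "j1 < j2" for j1 j2 l1 l2
  proof -
    have "l' (Suc j1) a = s - 1"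
      using R by (intro string_rel_lower_entries[OF R(2)]) (auto simp: string_rel_def)
    moreover have "l' (Suc j1) a = l1 (Suc j1) a"
      using R(1) by (simp add: string_rel_def shift_down_def)
    ultimately have "l1 (Suc j1) a = s - 1" "l1 j1 a = s" "l1 \<in> X"
      using R(1) by (auto simp: string_rel_def)
    then show False
      using X_interlace_up[of l1 j1 a] R by (auto simp: string_rel_def part_def)
  qed
  then have j: "j1 = j2" using assms by (metis linorder_neqE_nat)
  have "l1 = shift_up i j1 a l'"
    using assms(1) unfolding string_rel_def by (metis shift_up_down)
  moreover have "l2 = shift_up i j2 a l'"
    using assms(2) unfolding string_rel_def by (metis shift_up_down)
  ultimately show ?thesis using j by simp
qed

text \<open>Taking the lowest possible \<open>i\<close> makes entry \<open>a\<close> just below the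
  string strictly smaller, so it does not block the move. From the other side only entry
  \<open>a + 1\<close> can block it, and then a numerator of \<open>rminus\<close> vanishes. If
  there is no entry \<open>a + 1\<close>, the string ends at entry \<open>N\<close> of level
  \<open>N\<close>, and only the bound 0 can block, at
  \<open>s = - real N * \<theta>\<close>.\<close>

lemma rminus_string:
  assumes l: "l \<in> X" and j: "j \<in> {k..N}" and a: "a \<in> {1..j}" and s: "l j a = s"
    and nz: "rminus l j a s \<noteq> 0" and s_ne: "s \<noteq> - real N * \<theta>"
  shows "\<exists>i l'. string_rel s l l' i j a"
proof -
  define i where "i = (LEAST i. max k a \<le> i \<and> i \<le> j \<and> (\<forall>r\<in>{i..j}. l r a = s))"
  have ex: "max k a \<le> j \<and> j \<le> j \<and> (\<forall>r\<in>{j..j}. l r a = s)" using j a s by auto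
  have i0: "max k a \<le> i \<and> i \<le> j \<and> (\<forall>r\<in>{i..j}. l r a = s)"
    unfolding i_def using ex by (rule LeastI)
  have i_least: "i \<le> y" if "max k a \<le> y \<and> y \<le> j \<and> (\<forall>r\<in>{y..j}. l r a = s)" for y
    unfolding i_def using that by (rule Least_le)
  have i: "max k a \<le> i" "i \<le> j" "\<And>r. i \<le> r \<Longrightarrow> r \<le> j \<Longrightarrow> l r a = s"
    using i0 by auto
  define c where "c = s + real a * \<theta>"
  have pc: "\<pi> l r a = c" if "i \<le> r" "r \<le> j" for r
    using i(3)[OF that] by (simp add: part_def c_def)
  have cZ: "c \<in> \<int>" using X_Ints[OF l j a] pc[of j] i(2) by simp
  have below: "\<pi> l r a \<le> c - 1" if "k \<le> r" "Suc r = i" "a \<le> r" for r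
  proof (rule Ints_less_le_diff[OF _ cZ])
    show "\<pi> l r a \<in> \<int>" using that j i a by (intro X_Ints[OF l]) auto
    have "\<pi> l r a \<noteq> c"
    proof
      assume "\<pi> l r a = c"
      then have "l r a = s" by (simp add: part_def c_def)
      moreover have "l r' a = s" if "r' \<in> {r..j}" "r' \<noteq> r" for r'
        using that \<open>Suc r = i\<close> by (intro i(3)) auto
      ultimately have "\<forall>r'\<in>{r..j}. l r' a = s" by metis
      then have "i \<le> r" using that i(1,2) a by (intro i_least) auto
      then show False using that by simp
    qed
    moreover have "\<pi> l r a \<le> \<pi> l (Suc r) a" using that i j a by (intro X_interlace_up[OF l]) auto
    ultimately show "\<pi> l r a < c" using pc[of i] that i by simp
  qed
  \<comment> \<open>Equality of the integer coordinates would mean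
    \<open>l (Suc j) (Suc a) = s - \<theta>\<close>, a zero of a numerator in \<open>rminus\<close>.
    For \<open>\<theta> = 1\<close> the denominator is zero as well, and the factor is still
    0.\<close>
  have next1: "\<pi> l (Suc j) (Suc a) \<le> c - 1" if "j < N"
  proof (rule Ints_less_le_diff[OF _ cZ])
    show "\<pi> l (Suc j) (Suc a) \<in> \<int>" using that j a by (intro X_Ints[OF l]) auto
    have "\<pi> l (Suc j) (Suc a) \<noteq> c"
    proof
      assume "\<pi> l (Suc j) (Suc a) = c"
      then have "(s - l (j + 1) (Suc a) - \<theta>) / (s - l (j + 1) (Suc a) - 1) = 0"
        by (simp add: part_def c_def algebra_simps)
      then have "(\<Prod>q = 1..j + 1. (s - l (j + 1) q - \<theta>) / (s - l (j + 1) q - 1)) = 0"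
        using a by (intro prod_zero) auto
      then show False using nz that by (simp add: rminus_def)
    qed
    moreover have "\<pi> l (Suc j) (Suc a) \<le> \<pi> l j a" using that j a by (intro X_interlace_down[OF l]) auto
    ultimately show "\<pi> l (Suc j) (Suc a) < c" using pc[of j] i by simp
  qed
  have next2: "\<pi> l N (Suc a) \<le> c - 1" if "j = N" "Suc a \<le> N"
  proof (rule Ints_less_le_diff[OF _ cZ])
    show "\<pi> l N (Suc a) \<in> \<int>" using that j a by (intro X_Ints[OF l]) auto
    have "\<pi> l N (Suc a) \<noteq> c"
    proof
      assume "\<pi> l N (Suc a) = c"
      then have "(s - l j (Suc a) - \<theta>) / (s - l j (Suc a)) = 0"
        using that by (simp add: part_def c_def algebra_simps)
      then have "(\<Prod>q\<in>{1..j} - {a}. if j = N then (s - l j q - \<theta>) / (s - l j q)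
          else (s - l j q + \<theta> - 1) / (s - l j q)) = 0"
        using that a by (intro prod_zero) auto
      then show False using nz by (simp add: rminus_def)
    qed
    moreover have "\<pi> l N (Suc a) \<le> \<pi> l N a" using that j a by (intro X_mono[OF l]) auto
    ultimately show "\<pi> l N (Suc a) < c" using pc[of j] i that by simp
  qed
  \<comment> \<open>Entries with a fixed index grow with the level, so the bound at the level above
    the string, or at level \<open>N\<close>, serves all levels.\<close>
  have nxt: "\<pi> l r (Suc a) \<le> c - 1" if "k \<le> r" "r \<le> Suc j" "r \<le> N" "Suc a \<le> r" for r
  proof (cases "j < N")
    case True
    have "\<pi> l r (Suc a) \<le> \<pi> l (Suc j) (Suc a)" using that True by (intro X_level_mono[OF l]) auto
    then show ?thesis using next1[OF True] by simp
  next
    case False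
    have "\<pi> l r (Suc a) \<le> \<pi> l N (Suc a)" using that by (intro X_level_mono[OF l]) auto
    then show ?thesis using next2 False that j by simp
  qed
  have c1: "c - 1 \<ge> 0"
  proof -
    consider "j < N" | "j = N" "Suc a \<le> N" | "j = N" "a = N" using j a by force
    then show ?thesis
    proof cases
      case 1
      then show ?thesis using next1 X_bounds[OF l, of "Suc j" "Suc a"] j a by auto
    next
      case 2
      then show ?thesis using next2 X_bounds[OF l, of N "Suc a"] j a by auto
    next
      case 3
      then have "c \<noteq> 0" using s_ne by (simp add: c_def)
      moreover have "0 \<le> c" using X_bounds[OF l j a] pc[of j] i by simp
      ultimately show ?thesis using Ints_less_le_diff[OF Ints_0 cZ] by simp
    qed
  qed
  have cM: "c \<le> real M" using X_bounds[OF l j a] pc[of j] i by simp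
  define l' where "l' = shift_down i j a l"
  have p': "\<pi> l' r b = (if i \<le> r \<and> r \<le> j \<and> b = a then c - 1 else \<pi> l r b)" for r b
    unfolding l'_def part_shift_down using pc by auto
  have "l' \<in> X"
    unfolding X_set_iff
  proof (intro conjI ballI)
    show "l' \<in> extensional {k..N}"
      using l i j by (auto simp: X_set_iff l'_def shift_down_def extensional_def)
    fix r assume "r \<in> {k..N}"
    then show "l' r \<in> extensional {1..r}"
      using l i j a by (auto simp: X_set_iff l'_def shift_down_def extensional_def)
  next
    fix r b assume rb: "r \<in> {k..N}" "b \<in> {1..r}"
    show "\<pi> l' r b \<in> \<int>" using X_Ints[OF l rb] cZ by (simp add: p')
    show "0 \<le> \<pi> l' r b" using X_bounds[OF l rb] c1 by (simp add: p')
    show "\<pi> l' r b \<le> real M" using X_bounds[OF l rb] cM by (simp add: p')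
  next
    fix r b d assume rb: "r \<in> {k..N}" "b \<in> {1..r}" "d \<in> {b..r}"
    have mono: "\<pi> l r d \<le> \<pi> l r b" using rb by (intro X_mono[OF l]) auto
    show "\<pi> l' r d \<le> \<pi> l' r b"
    proof (cases "i \<le> r \<and> r \<le> j \<and> b = a \<and> d \<noteq> a")
      case True
      have "\<pi> l r d \<le> \<pi> l r (Suc a)" using True rb by (intro X_mono[OF l]) auto
      also have "\<dots> \<le> c - 1" using True rb by (intro nxt) auto
      finally show ?thesis using True by (simp add: p')
    next
      case False
      then show ?thesis using mono pc[of r] by (auto simp: p')
    qed
  next
    fix r b assume rb: "r \<in> {k..<N}" "b \<in> {1..r}"
    have up: "\<pi> l r b \<le> \<pi> l (Suc r) b" using rb by (intro X_interlace_up[OF l]) auto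
    have dn: "\<pi> l (Suc r) (Suc b) \<le> \<pi> l r b" using rb by (intro X_interlace_down[OF l]) auto
    show "\<pi> l' r b \<le> \<pi> l' (Suc r) b"
    proof (cases "Suc r = i \<and> b = a")
      case True
      then show ?thesis using below[of r] rb i by (auto simp: p')
    next
      case False
      then show ?thesis using up pc[of r] pc[of "Suc r"] by (auto simp: p')
    qed
    show "\<pi> l' (Suc r) (Suc b) \<le> \<pi> l' r b"
    proof (cases "i \<le> r \<and> r \<le> j \<and> b = a")
      case True
      then show ?thesis using nxt[of "Suc r"] rb i by (auto simp: p')
    next
      case False
      then show ?thesis using dn pc[of "Suc r"] by (auto simp: p')
    qed
  qed
  then have "string_rel s l l' i j a"
    unfolding string_rel_def using l i j a by (auto simp: l'_def)
  then show ?thesis by blast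
qed

text \<open>The mirror image of \<open>rminus_string\<close>: the greatest possible \<open>j\<close>
  makes entry \<open>a\<close> just above the string strictly larger, entry \<open>a - 1\<close> can
  block only if a numerator of \<open>rplus\<close> vanishes, and for \<open>a = 1\<close> the bound
  \<open>M\<close> is reached only at \<open>s = real M + 1 - \<theta>\<close>.\<close>

lemma rplus_string:
  assumes l': "l' \<in> X" and i: "i \<in> {k..N}" and a: "a \<in> {1..i}" and s: "l' i a = s - 1"
    and nz: "rplus l' i a s \<noteq> 0" and s_ne: "s \<noteq> real M + 1 - \<theta>"
  shows "\<exists>j l. string_rel s l l' i j a"
proof -
  define j where "j = (GREATEST j. i \<le> j \<and> j \<le> N \<and> (\<forall>r\<in>{i..j}. l' r a = s - 1))"
  have ex: "i \<le> i \<and> i \<le> N \<and> (\<forall>r\<in>{i..i}. l' r a = s - 1)" using i s by auto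
  have j0: "i \<le> j \<and> j \<le> N \<and> (\<forall>r\<in>{i..j}. l' r a = s - 1)"
    unfolding j_def using ex by (rule GreatestI_nat) auto
  have j_greatest: "y \<le> j" if "i \<le> y \<and> y \<le> N \<and> (\<forall>r\<in>{i..y}. l' r a = s - 1)" for y
    unfolding j_def using that by (rule Greatest_le_nat[where b = N]) simp
  have j: "i \<le> j" "j \<le> N" "\<And>r. i \<le> r \<Longrightarrow> r \<le> j \<Longrightarrow> l' r a = s - 1"
    using j0 by auto
  define c where "c = s - 1 + real a * \<theta>"
  have pc: "\<pi> l' r a = c" if "i \<le> r" "r \<le> j" for r
    using j(3)[OF that] by (simp add: part_def c_def)
  have cZ: "c \<in> \<int>" using X_Ints[OF l' i a] pc[of i] j(1) by simp
  have above: "c + 1 \<le> \<pi> l' (Suc j) a" if "j < N"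
  proof -
    have "c \<noteq> \<pi> l' (Suc j) a"
    proof
      assume "c = \<pi> l' (Suc j) a"
      then have "l' (Suc j) a = s - 1" by (simp add: part_def c_def)
      then have "\<forall>r\<in>{i..Suc j}. l' r a = s - 1" using j(3) by (metis atLeastAtMost_iff le_Suc_eq)
      then have "i \<le> Suc j \<and> Suc j \<le> N \<and> (\<forall>r\<in>{i..Suc j}. l' r a = s - 1)"
        using that j(1) by simp
      then have "Suc j \<le> j" by (rule j_greatest)
      then show False by simp
    qed
    moreover have "\<pi> l' j a \<le> \<pi> l' (Suc j) a" using that i j a by (intro X_interlace_up[OF l']) auto
    ultimately have "c < \<pi> l' (Suc j) a" using pc[of j] j by simp
    moreover have "\<pi> l' (Suc j) a \<in> \<int>" using that i j a by (intro X_Ints[OF l']) auto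
    ultimately show ?thesis using Ints_less_le_diff[OF cZ] by force
  qed
  have prev: "c + 1 \<le> \<pi> l' r b" if "k \<le> r" "i \<le> Suc r" "r \<le> N" "a = Suc b" "1 \<le> b" for r b
  proof -
    \<comment> \<open>The numerators of \<open>rplus\<close> that detect a blocking entry belong to
      level \<open>i - 1\<close>, but to the level itself if \<open>i = k\<close>, since there is no
      lower level. From \<open>r0\<close> the bound spreads upwards through the levels.\<close>
    define r0 where "r0 = (if i = k then k else i - 1)"
    have r0: "k \<le> r0" "r0 \<le> r" "b \<in> {1..r0}" "r0 \<le> N"
      using that a i by (auto simp: r0_def)
    have bZ: "\<pi> l' r0 b \<in> \<int>" using r0 by (intro X_Ints[OF l']) auto
    have "c \<noteq> \<pi> l' r0 b"
    proof
      assume "c = \<pi> l' r0 b"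
      then have zero: "s - l' r0 b + \<theta> - 1 = 0"
        using that by (simp add: part_def c_def algebra_simps)
      show False
      proof (cases "i = k")
        case True
        then have "(\<Prod>q\<in>{1..i} - {a}. if i = k then (s - l' i q + \<theta> - 1) / (s - l' i q - 1)
            else (s - l' i q - \<theta>) / (s - l' i q - 1)) = 0"
          using zero that r0 by (intro prod_zero bexI[of _ b]) (auto simp: r0_def)
        then show False using nz by (simp add: rplus_def)
      next
        case False
        then have "(\<Prod>q = 1..i - 1. (s - l' (i - 1) q + \<theta> - 1) / (s - l' (i - 1) q)) = 0"
          using zero that r0 by (intro prod_zero bexI[of _ b]) (auto simp: r0_def)
        then show False using nz False by (simp add: rplus_def)
      qed
    qed
    moreover have "c \<le> \<pi> l' r0 b"
    proof (cases "i = k")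
      case True
      then show ?thesis using X_mono[OF l', of k b a] that a i pc[of i] j by (auto simp: r0_def)
    next
      case False
      then show ?thesis using X_interlace_down[OF l', of "i - 1" b] that a i pc[of i] j
        by (auto simp: r0_def)
    qed
    ultimately have "c + 1 \<le> \<pi> l' r0 b" using Ints_less_le_diff[OF cZ bZ] by force
    also have "\<dots> \<le> \<pi> l' r b" using r0 that by (intro X_level_mono[OF l']) auto
    finally show ?thesis .
  qed
  have cM: "c + 1 \<le> real M"
  proof (cases "a = 1")
    case True
    have "c \<noteq> real M" using s_ne True by (simp add: c_def)
    moreover have "c \<le> real M" using X_bounds[OF l' i a] pc[of i] j by simp
    ultimately show ?thesis using Ints_less_le_diff[OF cZ, of "real M"] by force
  next
    case False
    then have "c + 1 \<le> \<pi> l' i (a - 1)" using a i by (intro prev) auto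
    also have "\<dots> \<le> real M"
    proof -
      have "a - 1 \<in> {1..i}" using a False by auto
      then show ?thesis using X_bounds[OF l' i] by blast
    qed
    finally show ?thesis .
  qed
  have c0: "c \<ge> 0" using X_bounds[OF l' i a] pc[of i] j by simp
  define l where "l = shift_up i j a l'"
  have p: "\<pi> l r b = (if i \<le> r \<and> r \<le> j \<and> b = a then c + 1 else \<pi> l' r b)" for r b
    unfolding l_def part_shift_up using pc by auto
  have "l \<in> X"
    unfolding X_set_iff
  proof (intro conjI ballI)
    show "l \<in> extensional {k..N}"
      using l' i j by (auto simp: X_set_iff l_def shift_up_def extensional_def)
    fix r assume "r \<in> {k..N}"
    then show "l r \<in> extensional {1..r}"
      using l' i j a by (auto simp: X_set_iff l_def shift_up_def extensional_def)
  next
    fix r b assume rb: "r \<in> {k..N}" "b \<in> {1..r}"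
    show "\<pi> l r b \<in> \<int>" using X_Ints[OF l' rb] cZ by (simp add: p)
    show "0 \<le> \<pi> l r b" using X_bounds[OF l' rb] c0 by (simp add: p)
    show "\<pi> l r b \<le> real M" using X_bounds[OF l' rb] cM by (simp add: p)
  next
    fix r b d assume rb: "r \<in> {k..N}" "b \<in> {1..r}" "d \<in> {b..r}"
    have mono: "\<pi> l' r d \<le> \<pi> l' r b" using rb by (intro X_mono[OF l']) auto
    show "\<pi> l r d \<le> \<pi> l r b"
    proof (cases "i \<le> r \<and> r \<le> j \<and> d = a \<and> b \<noteq> a")
      case True
      have "c + 1 \<le> \<pi> l' r (a - 1)" using True rb by (intro prev) auto
      also have "\<dots> \<le> \<pi> l' r b" using True rb by (intro X_mono[OF l']) auto
      finally show ?thesis using True by (simp add: p)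
    next
      case False
      then show ?thesis using mono pc[of r] by (auto simp: p)
    qed
  next
    fix r b assume rb: "r \<in> {k..<N}" "b \<in> {1..r}"
    have up: "\<pi> l' r b \<le> \<pi> l' (Suc r) b" using rb by (intro X_interlace_up[OF l']) auto
    have dn: "\<pi> l' (Suc r) (Suc b) \<le> \<pi> l' r b" using rb by (intro X_interlace_down[OF l']) auto
    show "\<pi> l r b \<le> \<pi> l (Suc r) b"
    proof (cases "r = j \<and> b = a")
      case True
      then show ?thesis using above rb j by (auto simp: p)
    next
      case False
      then show ?thesis using up pc[of r] pc[of "Suc r"] by (auto simp: p)
    qed
    show "\<pi> l (Suc r) (Suc b) \<le> \<pi> l r b"
    proof (cases "i \<le> Suc r \<and> Suc r \<le> j \<and> Suc b = a")
      case True
      then show ?thesis using prev[of r b] rb i by (auto simp: p)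
    next
      case False
      then show ?thesis using dn pc[of r] by (auto simp: p)
    qed
  qed
  moreover have "l' = shift_down i j a l" unfolding l_def by simp
  moreover have "\<forall>r\<in>{i..j}. l r a = s" using j(3) by (simp add: l_def shift_up_def)
  ultimately have "string_rel s l l' i j a"
    unfolding string_rel_def using l' i j a by auto
  then show ?thesis by blast
qed

end

section \<open>Ratios of weights along a string\<close>


lemma Gamma_Suc_pos: "x > 0 \<Longrightarrow> Gamma (x + 1) = x * Gamma (x :: real)"
  by (rule Gamma_plus1) (auto dest: nonpos_Ints_nonpos)

lemma Gamma_pos_step: "\<lbrakk>x > 0; y = x + 1\<rbrakk> \<Longrightarrow> Gamma y = x * Gamma (x :: real)"
  by (simp add: Gamma_Suc_pos)

lemma prod_if_delta:
  fixes f :: "'a \<Rightarrow> 'c::comm_monoid_mult"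
  assumes "finite A" "a \<in> A"
  shows "(\<Prod>q\<in>A. if q = a then f q else 1) = f a"
  using assms by (simp add: prod.delta)

lemma finite_lt_pairs: "finite (lt_pairs n)"
  by (rule finite_subset[of _ "{1..n} \<times> {1..n}"]) (auto simp: lt_pairs_def)

lemma prod_lt_pairs_through:
  fixes g :: "nat \<Rightarrow> 'c::comm_monoid_mult"
  assumes "a \<in> {1..n}"
  shows "(\<Prod>(p, q)\<in>lt_pairs n. if p = a then g q else if q = a then g p else 1) = (\<Prod>q\<in>{1..n} - {a}. g q)"
proof -
  let ?h = "\<lambda>(p, q). if p = a then g q else if q = a then g p else 1"
  let ?U = "(\<lambda>q. if a < q then (a, q) else (q, a)) ` ({1..n} - {a})"
  have inj: "inj_on (\<lambda>q. if a < q then (a, q) else (q, a)) ({1..n} - {a})"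
    by (auto simp: inj_on_def split: if_splits)
  have sub: "?U \<subseteq> lt_pairs n" using assms by (auto simp: lt_pairs_def)
  have "prod ?h (lt_pairs n) = prod ?h ?U"
  proof (rule prod.mono_neutral_right[OF finite_lt_pairs sub], safe)
    fix p q assume pq: "(p, q) \<in> lt_pairs n" "(p, q) \<notin> ?U"
    then have "p \<noteq> a" "q \<noteq> a" by (force simp: lt_pairs_def image_iff)+
    then show "(if p = a then g q else if q = a then g p else 1) = 1" by simp
  qed
  also have "\<dots> = (\<Prod>q\<in>{1..n} - {a}. g q)"
  proof (subst prod.reindex[OF inj], rule prod.cong[OF refl])
    fix q assume "q \<in> {1..n} - {a}"
    then show "(?h \<circ> (\<lambda>q. if a < q then (a, q) else (q, a))) q = g q"
      by (cases "a < q") auto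
  qed
  finally show ?thesis .
qed

section \<open>Factors of the weight within a level and between neighbouring levels\<close>

context corners
begin

text \<open>All that the weight contains about a pair of entries of one level. The first factor
  comes from the interaction with the level above, or from \<open>H_top\<close>; the second comes
  from the interaction with the level below, or from \<open>H_bot\<close>.\<close>

definition pair_factor :: "nat \<Rightarrow> real \<Rightarrow> real" where
  "pair_factor r d =
     (if r = N then Gamma (d + 1) / Gamma (d + 1 - \<theta>) else Gamma (d + 1) / Gamma (d + \<theta>)) *
     (if r = k then Gamma (d + \<theta>) / Gamma d else Gamma (d + 1 - \<theta>) / Gamma d)"

text \<open>Chosen to match the residues: over the other entries of a level, the product of
  \<open>top_ratio\<close> is the inverse of the same-level part of \<open>rminus\<close>, and the
  product of \<open>bot_ratio\<close> is the same-level part of \<open>rplus\<close>.\<close>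

definition top_ratio :: "nat \<Rightarrow> real \<Rightarrow> real" where
  "top_ratio r x = (if r = N then x / (x - \<theta>) else x / (x - 1 + \<theta>))"

definition bot_ratio :: "nat \<Rightarrow> real \<Rightarrow> real" where
  "bot_ratio r x = (if r = k then (x - 1 + \<theta>) / (x - 1) else (x - \<theta>) / (x - 1))"

lemma pair_factor_down:
  assumes "d - 1 \<ge> \<theta>"
  shows "pair_factor r d = pair_factor r (d - 1) * (top_ratio r d * bot_ratio r d)"
proof -
  define A B C where "A = Gamma (d - 1)" and "B = Gamma (d - 1 + \<theta>)" and "C = Gamma (d - \<theta>)"
  have pos: "A > 0" "B > 0" "C > 0"
    using assms theta_pos by (auto intro!: Gamma_real_pos simp: A_def B_def C_def)
  have e1: "Gamma d = (d - 1) * A"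
    using Gamma_Suc_pos[of "d - 1"] assms theta_pos by (simp add: A_def)
  have e2: "Gamma (d + \<theta>) = (d - 1 + \<theta>) * B"
    unfolding B_def by (rule Gamma_pos_step) (use assms theta_pos in auto)
  have e3: "Gamma (d + 1 - \<theta>) = (d - \<theta>) * C"
    unfolding C_def by (rule Gamma_pos_step) (use assms theta_pos in auto)
  have e4: "Gamma (d + 1) = d * ((d - 1) * A)"
    using Gamma_Suc_pos[of d] e1 assms theta_pos by simp
  have ne: "d - 1 \<noteq> 0" "d - 1 + \<theta> \<noteq> 0" "d - \<theta> \<noteq> 0" "d \<noteq> 0" "A \<noteq> 0" "B \<noteq> 0" "C \<noteq> 0"
    using assms theta_pos pos by auto
  have up: "pair_factor r d =
      (if r = N then d * ((d - 1) * A) / ((d - \<theta>) * C) else d * ((d - 1) * A) / ((d - 1 + \<theta>) * B)) *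
      (if r = k then (d - 1 + \<theta>) * B / ((d - 1) * A) else (d - \<theta>) * C / ((d - 1) * A))"
    unfolding pair_factor_def e1 e2 e3 e4 ..
  have "d - 1 + 1 = d" "d - 1 + 1 - \<theta> = d - \<theta>" by auto
  then have dn: "pair_factor r (d - 1) =
      (if r = N then (d - 1) * A / C else (d - 1) * A / B) * (if r = k then B / A else C / A)"
    unfolding pair_factor_def by (simp only: e1 A_def[symmetric] B_def[symmetric] C_def[symmetric])
  show ?thesis
    unfolding up dn top_ratio_def bot_ratio_def using ne
    by (cases "r = N"; cases "r = k") (simp_all only: if_True if_False, simp_all add: nonzero_divide_eq_eq nonzero_eq_divide_eq)
qed

text \<open>For an entry preceding the moved one, the difference grows when the string is lowered.
  The quotient is nevertheless the same rational function of \<open>s\<close> minus the other entry.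
  This holds for the product of the two ratios, not for the two factors of
  \<open>pair_factor\<close> separately.\<close>

lemma pair_factor_up:
  assumes "d \<ge> \<theta>"
  shows "pair_factor r d = pair_factor r (d + 1) * (top_ratio r (- d) * bot_ratio r (- d))"
proof -
  define A B C where "A = Gamma d" and "B = Gamma (d + \<theta>)" and "C = Gamma (d + 1 - \<theta>)"
  have pos: "A > 0" "B > 0" "C > 0"
    using assms theta_pos by (auto intro!: Gamma_real_pos simp: A_def B_def C_def)
  have e1: "Gamma (d + 1) = d * A"
    using Gamma_Suc_pos[of d] assms theta_pos by (simp add: A_def)
  have e2: "Gamma (d + 1 + \<theta>) = (d + \<theta>) * B"
    unfolding B_def by (rule Gamma_pos_step) (use assms theta_pos in auto)
  have e3: "Gamma (d + 1 + 1 - \<theta>) = (d + 1 - \<theta>) * C"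
    unfolding C_def by (rule Gamma_pos_step) (use assms theta_pos in auto)
  have e4: "Gamma (d + 1 + 1) = (d + 1) * (d * A)"
    using Gamma_Suc_pos[of "d + 1"] e1 assms theta_pos by simp
  define E F where "E = d + 1 - \<theta>" and "F = d + \<theta>"
  have ne: "d \<noteq> 0" "F \<noteq> 0" "E \<noteq> 0" "d + 1 \<noteq> 0" "A \<noteq> 0" "B \<noteq> 0" "C \<noteq> 0"
    using assms theta_pos pos by (auto simp: E_def F_def)
  have lo: "pair_factor r d = (if r = N then d * A / C else d * A / B) * (if r = k then B / A else C / A)"
    unfolding pair_factor_def by (simp only: e1 A_def[symmetric] B_def[symmetric] C_def[symmetric])
  have hi: "pair_factor r (d + 1) =
      (if r = N then (d + 1) * (d * A) / (E * C) else (d + 1) * (d * A) / (F * B)) *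
      (if r = k then F * B / (d * A) else E * C / (d * A))"
    unfolding pair_factor_def e1 e2 e3 e4 E_def F_def ..
  have "- d - \<theta> = - F" "- d - 1 + \<theta> = - E" "- d - 1 = - (d + 1)" by (auto simp: E_def F_def)
  then have ratios: "top_ratio r (- d) = (if r = N then d / F else d / E)"
    "bot_ratio r (- d) = (if r = k then E / (d + 1) else F / (d + 1))"
    unfolding top_ratio_def bot_ratio_def by (simp_all only: minus_divide_divide)
  show ?thesis
    unfolding lo hi ratios using ne
    by (cases "r = N"; cases "r = k") (simp_all only: if_True if_False, simp_all add: nonzero_divide_eq_eq nonzero_eq_divide_eq)
qed

lemma level_ratio:
  assumes a: "a \<in> {1..r}" and y: "y a = s"
    and gap: "\<And>p q. 1 \<le> p \<Longrightarrow> p < q \<Longrightarrow> q \<le> r \<Longrightarrow> y p - y q \<ge> \<theta>"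
    and gap': "\<And>p q. 1 \<le> p \<Longrightarrow> p < q \<Longrightarrow> q \<le> r \<Longrightarrow> (y(a := s - 1)) p - (y(a := s - 1)) q \<ge> \<theta>"
  shows "(\<Prod>(p, q)\<in>lt_pairs r. pair_factor r (y p - y q)) =
    (\<Prod>(p, q)\<in>lt_pairs r. pair_factor r ((y(a := s - 1)) p - (y(a := s - 1)) q)) *
    ((\<Prod>q\<in>{1..r} - {a}. top_ratio r (s - y q)) * (\<Prod>q\<in>{1..r} - {a}. bot_ratio r (s - y q)))"
proof -
  let ?y' = "y(a := s - 1)" and ?\<rho> = "\<lambda>q. top_ratio r (s - y q) * bot_ratio r (s - y q)"
  have "(\<Prod>(p, q)\<in>lt_pairs r. pair_factor r (y p - y q)) =
    (\<Prod>(p, q)\<in>lt_pairs r. pair_factor r (?y' p - ?y' q) * (if p = a then ?\<rho> q else if q = a then ?\<rho> p else 1))"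
  proof (rule prod.cong[OF refl], safe)
    fix p q assume "(p, q) \<in> lt_pairs r"
    then have pq: "1 \<le> p" "p < q" "q \<le> r" by (auto simp: lt_pairs_def)
    consider "p = a" | "q = a" "p \<noteq> a" | "p \<noteq> a" "q \<noteq> a" by blast
    then show "pair_factor r (y p - y q) = pair_factor r (?y' p - ?y' q) *
        (if p = a then ?\<rho> q else if q = a then ?\<rho> p else 1)"
    proof cases
      case 1
      then show ?thesis using pair_factor_down[of "s - y q" r] gap'[OF pq] pq y
        by (simp add: algebra_simps)
    next
      case 2
      then show ?thesis using pair_factor_up[of "y p - s" r] gap[OF pq] pq y
        by (simp add: algebra_simps)
    qed auto
  qed
  also have "\<dots> = (\<Prod>(p, q)\<in>lt_pairs r. pair_factor r (?y' p - ?y' q)) *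
      (\<Prod>(p, q)\<in>lt_pairs r. if p = a then ?\<rho> q else if q = a then ?\<rho> p else 1)"
    by (simp only: prod.distrib[symmetric] case_prod_unfold)
  also have "(\<Prod>(p, q)\<in>lt_pairs r. if p = a then ?\<rho> q else if q = a then ?\<rho> p else 1) = (\<Prod>q\<in>{1..r} - {a}. ?\<rho> q)"
    by (rule prod_lt_pairs_through[OF a])
  finally show ?thesis by (simp add: prod.distrib)
qed

text \<open>The two products between levels in \<open>I_weight\<close> run over \<open>b < q\<close>
  and over \<open>q \<le> b\<close>. Together they fill a rectangle, so moving one entry changes a
  full row or column.\<close>

definition cross_factor :: "nat \<Rightarrow> nat \<Rightarrow> real \<Rightarrow> real \<Rightarrow> real" where
  "cross_factor b q y x =
     (if b < q then Gamma (y - x) / Gamma (y - x + 1 - \<theta>) else Gamma (x - y + \<theta>) / Gamma (x - y + 1))"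

definition cross_weight :: "nat \<Rightarrow> (nat \<Rightarrow> real) \<Rightarrow> (nat \<Rightarrow> real) \<Rightarrow> real" where
  "cross_weight r x y = (\<Prod>b\<in>{1..r}. \<Prod>q\<in>{1..Suc r}. cross_factor b q (y b) (x q))"

definition level_weight :: "(real \<Rightarrow> real) \<Rightarrow> nat \<Rightarrow> (nat \<Rightarrow> real) \<Rightarrow> real" where
  "level_weight w r y = (\<Prod>(p, q)\<in>lt_pairs r. pair_factor r (y p - y q)) * (if r = N then \<Prod>p = 1..N. w (y p) else 1)"

lemma cross_weight_eq:
  "cross_weight r x y =
     (\<Prod>(p, q)\<in>lt_pairs (r + 1). Gamma (y p - x q) / Gamma (y p - x q + 1 - \<theta>)) *
     (\<Prod>(p, q)\<in>le_pairs r. Gamma (x p - y q + \<theta>) / Gamma (x p - y q + 1))"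
proof -
  let ?U = "{1..r} \<times> {1..Suc r}"
  have "cross_weight r x y = (\<Prod>z\<in>?U. if fst z < snd z
      then Gamma (y (fst z) - x (snd z)) / Gamma (y (fst z) - x (snd z) + 1 - \<theta>)
      else Gamma (x (snd z) - y (fst z) + \<theta>) / Gamma (x (snd z) - y (fst z) + 1))"
    by (simp add: cross_weight_def prod.cartesian_product cross_factor_def case_prod_unfold del: prod.cl_ivl_Suc)
  also have "\<dots> =
      (\<Prod>z\<in>?U \<inter> {z. fst z < snd z}. Gamma (y (fst z) - x (snd z)) / Gamma (y (fst z) - x (snd z) + 1 - \<theta>)) *
      (\<Prod>z\<in>?U \<inter> - {z. fst z < snd z}. Gamma (x (snd z) - y (fst z) + \<theta>) / Gamma (x (snd z) - y (fst z) + 1))"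
    by (rule prod.If_cases) auto
  also have "?U \<inter> {z. fst z < snd z} = lt_pairs (r + 1)"
    by (auto simp: lt_pairs_def)
  also have "(\<Prod>z\<in>?U \<inter> - {z. fst z < snd z}. Gamma (x (snd z) - y (fst z) + \<theta>) / Gamma (x (snd z) - y (fst z) + 1)) =
      (\<Prod>z\<in>le_pairs r. Gamma (x (fst z) - y (snd z) + \<theta>) / Gamma (x (fst z) - y (snd z) + 1))"
    by (rule prod.reindex_bij_witness[of _ prod.swap prod.swap]) (auto simp: le_pairs_def)
  finally show ?thesis by (simp add: case_prod_unfold)
qed

lemma Gamma_quotient_shift:
  fixes x y :: real
  assumes "x > 0" "y > 0"
  shows "Gamma x / Gamma y = Gamma (x + 1) / Gamma (y + 1) * (y / x)"
    "Gamma (x + 1) / Gamma (y + 1) = Gamma x / Gamma y * (x / y)"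
  using assms unfolding Gamma_Suc_pos[OF assms(1)] Gamma_Suc_pos[OF assms(2)]
  by (simp_all add: divide_simps)

text \<open>Both branches of \<open>cross_factor\<close> give the same rational factor, because one
  is the other with the signs of numerator and denominator reversed. It is the inverse of a
  \<open>top_ratio\<close> of the lower level; likewise the factor in
  \<open>cross_factor_lower\<close> is the inverse of a \<open>bot_ratio\<close> of the upper
  level.\<close>

lemma cross_factor_upper:
  assumes "b < q \<Longrightarrow> y - s \<ge> \<theta>" "\<not> b < q \<Longrightarrow> s - 1 - y \<ge> 0"
  shows "cross_factor b q y s = cross_factor b q y (s - 1) * ((s - y - 1 + \<theta>) / (s - y))"
proof (cases "b < q")
  case True
  have args: "y - (s - 1) = y - s + 1" "y - s + 1 + 1 - \<theta> = y - s + 1 - \<theta> + 1" by auto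
  have "(s - y - 1 + \<theta>) / (s - y) = (y - s + 1 - \<theta>) / (y - s)"
    by (subst minus_divide_divide[symmetric]) (simp add: algebra_simps)
  then show ?thesis
    unfolding cross_factor_def args using True assms(1) theta_pos
    by (simp only: if_True) (rule Gamma_quotient_shift, auto)
next
  case False
  have args: "s - y = s - 1 - y + 1" "s - 1 - y + 1 - 1 + \<theta> = s - 1 - y + \<theta>"
    "s - 1 - y + 1 + \<theta> = s - 1 - y + \<theta> + 1" by auto
  show ?thesis
    unfolding cross_factor_def using False assms(2) theta_pos
    by (simp only: if_False args) (rule Gamma_quotient_shift, auto)
qed

lemma cross_factor_lower:
  assumes "b < q \<Longrightarrow> s - 1 - x \<ge> \<theta>" "\<not> b < q \<Longrightarrow> x - s \<ge> 0"
  shows "cross_factor b q s x = cross_factor b q (s - 1) x * ((s - x - 1) / (s - x - \<theta>))"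
proof (cases "b < q")
  case True
  have args: "s - x = s - 1 - x + 1" "s - 1 - x + 1 - 1 = s - 1 - x"
    "s - 1 - x + 1 + 1 - \<theta> = s - 1 - x + 1 - \<theta> + 1" by auto
  show ?thesis
    unfolding cross_factor_def using True assms(1) theta_pos
    by (simp only: if_True args) (rule Gamma_quotient_shift, auto)
next
  case False
  have args: "x - (s - 1) = x - s + 1" "x - s + 1 + \<theta> = x - s + \<theta> + 1" by auto
  have "(s - x - 1) / (s - x - \<theta>) = (x - s + 1) / (x - s + \<theta>)"
    by (subst minus_divide_divide[symmetric]) (simp add: algebra_simps)
  then show ?thesis
    unfolding cross_factor_def args using False assms(2) theta_pos
    by (simp only: if_False) (rule Gamma_quotient_shift, auto)
qed

text \<open>\<open>xm\<close> and \<open>ym\<close> tell whether the upper and the lower level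
  belong to the string. If both do, the difference of the two moved entries is unchanged, so the
  pair of them is left out of the products.\<close>

lemma cross_ratio:
  assumes x': "x' = (if xm then x(a := s - 1) else x)" and y': "y' = (if ym then y(a := s - 1) else y)"
    and xa: "xm \<Longrightarrow> x a = s \<and> a \<in> {1..Suc r}" and ya: "ym \<Longrightarrow> y a = s \<and> a \<in> {1..r}"
    and up: "\<And>b q. b \<in> {1..r} \<Longrightarrow> q \<in> {1..Suc r} \<Longrightarrow> b < q \<Longrightarrow> y b - x q \<ge> \<theta> \<and> y' b - x' q \<ge> \<theta>"
    and dn: "\<And>b q. b \<in> {1..r} \<Longrightarrow> q \<in> {1..Suc r} \<Longrightarrow> \<not> b < q \<Longrightarrow> x q - y b \<ge> 0 \<and> x' q - y' b \<ge> 0"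
  shows "cross_weight r x y = cross_weight r x' y' *
    ((if xm then \<Prod>b\<in>{1..r} - (if ym then {a} else {}). (s - y b - 1 + \<theta>) / (s - y b) else 1) *
     (if ym then \<Prod>q\<in>{1..Suc r} - (if xm then {a} else {}). (s - x q - 1) / (s - x q - \<theta>) else 1))"
proof -
  let ?\<alpha> = "\<lambda>b q. if xm \<and> q = a \<and> \<not> (ym \<and> b = a) then (s - y b - 1 + \<theta>) / (s - y b) else 1"
  let ?\<beta> = "\<lambda>b q. if ym \<and> b = a \<and> \<not> (xm \<and> q = a) then (s - x q - 1) / (s - x q - \<theta>) else 1"
  have "cross_weight r x y =
      (\<Prod>b\<in>{1..r}. \<Prod>q\<in>{1..Suc r}. cross_factor b q (y' b) (x' q) * (?\<alpha> b q * ?\<beta> b q))"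
    unfolding cross_weight_def
  proof (intro prod.cong refl)
    fix b q assume b: "b \<in> {1..r}" and q: "q \<in> {1..Suc r}"
    consider "xm" "q = a" "ym" "b = a" | "xm" "q = a" "\<not> (ym \<and> b = a)"
      | "\<not> (xm \<and> q = a)" "ym" "b = a" | "\<not> (xm \<and> q = a)" "\<not> (ym \<and> b = a)" by blast
    then show "cross_factor b q (y b) (x q) = cross_factor b q (y' b) (x' q) * (?\<alpha> b q * ?\<beta> b q)"
    proof cases
      case 1
      then show ?thesis using xa ya by (simp add: x' y' cross_factor_def)
    next
      case 2
      then have "y' b = y b" "x q = s" "x' q = s - 1" using xa by (auto simp: x' y')
      then show ?thesis using 2 cross_factor_upper[of b q "y b" s] up[OF b q] dn[OF b q] by auto
    next
      case 3
      then have "x' q = x q" "y b = s" "y' b = s - 1" using ya by (auto simp: x' y')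
      then show ?thesis using 3 cross_factor_lower[of b q s "x q"] up[OF b q] dn[OF b q] by auto
    next
      case 4
      then show ?thesis by (auto simp: x' y')
    qed
  qed
  also have "\<dots> = cross_weight r x' y' *
      ((\<Prod>b\<in>{1..r}. \<Prod>q\<in>{1..Suc r}. ?\<alpha> b q) * (\<Prod>b\<in>{1..r}. \<Prod>q\<in>{1..Suc r}. ?\<beta> b q))"
    by (simp only: cross_weight_def prod.distrib)
  also have "(\<Prod>b\<in>{1..r}. \<Prod>q\<in>{1..Suc r}. ?\<alpha> b q) =
      (if xm then \<Prod>b\<in>{1..r} - (if ym then {a} else {}). (s - y b - 1 + \<theta>) / (s - y b) else 1)"
  proof (cases xm)
    case True
    have "(\<Prod>q\<in>{1..Suc r}. ?\<alpha> b q) = (if b \<in> (if ym then {a} else {}) then 1 else (s - y b - 1 + \<theta>) / (s - y b))" for b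
    proof -
      have "(\<Prod>q\<in>{1..Suc r}. ?\<alpha> b q) = (\<Prod>q\<in>{1..Suc r}. if q = a then ?\<alpha> b a else 1)"
        by (intro prod.cong refl) simp
      also have "\<dots> = ?\<alpha> b a" using xa True by (intro prod_if_delta) auto
      finally show ?thesis using True by auto
    qed
    then show ?thesis using True
      by (simp add: prod.If_cases Diff_eq[symmetric] del: prod.cl_ivl_Suc)
  qed simp
  also have "(\<Prod>b\<in>{1..r}. \<Prod>q\<in>{1..Suc r}. ?\<beta> b q) = (\<Prod>q\<in>{1..Suc r}. \<Prod>b\<in>{1..r}. ?\<beta> b q)"
    by (rule prod.swap)
  also have "\<dots> = (if ym then \<Prod>q\<in>{1..Suc r} - (if xm then {a} else {}). (s - x q - 1) / (s - x q - \<theta>) else 1)"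
  proof (cases ym)
    case True
    have "(\<Prod>b\<in>{1..r}. ?\<beta> b q) = (if q \<in> (if xm then {a} else {}) then 1 else (s - x q - 1) / (s - x q - \<theta>))" for q
    proof -
      have "(\<Prod>b\<in>{1..r}. ?\<beta> b q) = (\<Prod>b\<in>{1..r}. if b = a then ?\<beta> a q else 1)"
        by (intro prod.cong refl) simp
      also have "\<dots> = ?\<beta> a q" using ya True by (intro prod_if_delta) auto
      finally show ?thesis using True by auto
    qed
    then show ?thesis using True
      by (simp add: prod.If_cases Diff_eq[symmetric] del: prod.cl_ivl_Suc)
  qed simp
  finally show ?thesis .
qed

text \<open>Regroups the weight by levels: from each interaction the part about the upper level goes
  to \<open>bot\<close> of that level and the part about the lower level to \<open>top\<close> of
  that level.\<close>

lemma weight_factorization: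
  "weight \<theta> w N k l = (\<Prod>r = k..N. level_weight w r (l r)) * (\<Prod>r = k..<N. cross_weight r (l (Suc r)) (l r))"
proof -
  define top where "top = (\<lambda>r. \<Prod>(p, q)\<in>lt_pairs r. if r = N then Gamma (l r p - l r q + 1) / Gamma (l r p - l r q + 1 - \<theta>)
     else Gamma (l r p - l r q + 1) / Gamma (l r p - l r q + \<theta>))"
  define bot where "bot = (\<lambda>r. \<Prod>(p, q)\<in>lt_pairs r. if r = k then Gamma (l r p - l r q + \<theta>) / Gamma (l r p - l r q)
     else Gamma (l r p - l r q + 1 - \<theta>) / Gamma (l r p - l r q))"
  define wN where "wN = (\<Prod>p = 1..N. w (l N p))"
  have lw: "level_weight w r (l r) = top r * bot r * (if r = N then wN else 1)" for r
    unfolding level_weight_def pair_factor_def top_def bot_def wN_def by (simp add: case_prod_unfold prod.distrib)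
  have sets: "{k..N} = insert N {k..<N}" "{k..N} = insert k (Suc ` {k..<N})"
    using k_le by (auto simp: image_Suc_atLeastLessThan)
  have T: "(\<Prod>r = k..N. top r) = top N * (\<Prod>r = k..<N. top r)"
    unfolding sets(1) by (subst prod.insert) auto
  have "prod bot (Suc ` {k..<N}) = (\<Prod>r = k..<N. bot (Suc r))"
    by (subst prod.reindex) (auto simp: o_def simp del: image_Suc_atLeastLessThan)
  then have B: "(\<Prod>r = k..N. bot r) = bot k * (\<Prod>r = k..<N. bot (Suc r))"
    unfolding sets(2) by (subst prod.insert) (auto simp del: image_Suc_atLeastLessThan)
  have I: "I_weight \<theta> r (l (Suc r)) (l r) = bot (Suc r) * top r * cross_weight r (l (Suc r)) (l r)"
    if "r \<in> {k..<N}" for r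
    using that unfolding I_weight_def cross_weight_eq top_def bot_def by (simp add: ac_simps)
  have "(\<Prod>r = k..<N. I_weight \<theta> r (l (Suc r)) (l r)) =
      (\<Prod>r = k..<N. bot (Suc r) * top r * cross_weight r (l (Suc r)) (l r))"
    by (intro prod.cong refl I)
  also have "\<dots> = (\<Prod>r = k..<N. bot (Suc r)) * (\<Prod>r = k..<N. top r) *
      (\<Prod>r = k..<N. cross_weight r (l (Suc r)) (l r))"
    by (simp only: prod.distrib)
  finally have "weight \<theta> w N k l = (top N * wN) * bot k * ((\<Prod>r = k..<N. bot (Suc r)) *
      (\<Prod>r = k..<N. top r) * (\<Prod>r = k..<N. cross_weight r (l (Suc r)) (l r)))"
    by (simp add: weight_def H_top_def H_bot_def top_def bot_def wN_def)
  also have "\<dots> = (\<Prod>r = k..N. top r) * (\<Prod>r = k..N. bot r) * wN * (\<Prod>r = k..<N. cross_weight r (l (Suc r)) (l r))"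
    unfolding T B by (simp only: ac_simps)
  also have "\<dots> = (\<Prod>r = k..N. level_weight w r (l r)) * (\<Prod>r = k..<N. cross_weight r (l (Suc r)) (l r))"
  proof -
    have "(\<Prod>r = k..N. if r = N then wN else 1) = wN" using k_le by (subst prod_if_delta) auto
    then show ?thesis unfolding lw by (simp add: prod.distrib)
  qed
  finally show ?thesis .
qed

lemma pair_factor_prod_pos:
  assumes l: "l \<in> X" and r: "r \<in> {k..N}"
  shows "(\<Prod>(p, q)\<in>lt_pairs r. pair_factor r (l r p - l r q)) > 0"
proof -
  have "pair_factor r (l r p - l r q) > 0" if "(p, q) \<in> lt_pairs r" for p q
  proof -
    define d where "d = l r p - l r q"
    have "d \<ge> \<theta>" using X_gap[OF l r, of p q] that by (auto simp: d_def lt_pairs_def)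
    then have "Gamma d > 0" "Gamma (d + \<theta>) > 0" "Gamma (d + 1) > 0" "Gamma (d + 1 - \<theta>) > 0"
      using theta_pos by (auto intro!: Gamma_real_pos)
    then show ?thesis unfolding pair_factor_def d_def[symmetric] by simp
  qed
  then show ?thesis by (intro prod_pos) auto
qed

lemma cross_weight_pos:
  assumes l: "l \<in> X" and r: "r \<in> {k..<N}"
  shows "cross_weight r (l (Suc r)) (l r) > 0"
  unfolding cross_weight_def
proof (intro prod_pos)
  fix b q assume "b \<in> {1..r}" "q \<in> {1..Suc r}"
  then show "cross_factor b q (l r b) (l (Suc r) q) > 0"
    using X_gap_upper[OF l, of r b q] X_gap_lower[OF l, of r q b] r theta_pos
    unfolding cross_factor_def by (auto intro!: divide_pos_pos Gamma_real_pos)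
qed

lemma weight_pos:
  assumes l: "l \<in> X" and w_pos: "\<And>x. x \<in> {- real N * \<theta> .. real M - \<theta>} \<Longrightarrow> w x > 0"
  shows "weight \<theta> w N k l > 0"
proof -
  have "(\<Prod>p = 1..N. w (l N p)) > 0"
    using X_range[OF l, of N] k_le by (intro prod_pos w_pos) auto
  then have "level_weight w r (l r) > 0" if "r \<in> {k..N}" for r
    using pair_factor_prod_pos[OF l that] unfolding level_weight_def by simp
  then show ?thesis
    unfolding weight_factorization using cross_weight_pos[OF l]
    by (intro mult_pos_pos prod_pos) auto
qed

text \<open>Neighbouring levels of the string contribute mutually inverse factors, so only the two ends of the
  string are left in the ratio of the weights.\<close>

lemma weight_string:
  assumes R: "string_rel s l l' i j a"
    and w_pos: "\<And>x. x \<in> {- real N * \<theta> .. real M - \<theta>} \<Longrightarrow> w x > 0"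
  shows "weight \<theta> w N k l * rminus l j a s =
    - (weight \<theta> w N k l' * rplus l' i a s) * (if j = N then w s / w (s - 1) else 1)"
proof -
  have l: "l \<in> X" and l': "l' \<in> X" and ij: "k \<le> i" "i \<le> j" "j \<le> N" and a: "1 \<le> a" "a \<le> i"
    and ls: "\<And>r. i \<le> r \<Longrightarrow> r \<le> j \<Longrightarrow> l r a = s" and l'_eq: "l' = shift_down i j a l"
    using R by (auto simp: string_rel_def)
  have l'r: "l' r = (if i \<le> r \<and> r \<le> j then (l r)(a := s - 1) else l r)" for r
    using ls by (auto simp: l'_eq shift_down_def)
  define T where "T r = (\<Prod>q\<in>{1..r} - {a}. top_ratio r (s - l r q))" for r
  define B where "B r = (\<Prod>q\<in>{1..r} - {a}. bot_ratio r (s - l r q))" for r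
  define U where "U = (\<Prod>b\<in>{1..i - 1}. (s - l (i - 1) b - 1 + \<theta>) / (s - l (i - 1) b))"
  define D where "D = (\<Prod>q\<in>{1..Suc j}. (s - l (Suc j) q - 1) / (s - l (Suc j) q - \<theta>))"
  define wr where "wr = (if j = N then w s / w (s - 1) else 1)"
  \<comment> \<open>Between two levels of the string the quotient inverts one factor of each level.
    \<open>U\<close> belongs to the pair of levels at the lower end, of which only the upper one
    moves, and \<open>D\<close> to the pair at the upper end.\<close>
  define cr where "cr r = (if i \<le> r \<and> Suc r \<le> j then inverse (T r) * inverse (B (Suc r))
      else if Suc r = i then U else if r = j then D else 1)" for r
  have pairs: "(\<Prod>(p, q)\<in>lt_pairs r. pair_factor r (l r p - l r q)) =
      (\<Prod>(p, q)\<in>lt_pairs r. pair_factor r (l' r p - l' r q)) * (T r * B r)" if r: "i \<le> r" "r \<le> j" for r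
  proof -
    have "l' r = (l r)(a := s - 1)" using r by (simp add: l'r)
    then show ?thesis
      using level_ratio[of a r "l r" s] X_gap[OF l, of r] X_gap[OF l', of r] r a ij ls[OF r]
      unfolding T_def B_def by auto
  qed
  have TB: "T r \<noteq> 0" "B r \<noteq> 0" if r: "i \<le> r" "r \<le> j" for r
    using pairs[OF r] pair_factor_prod_pos[OF l, of r] r ij by auto
  have wprod: "(\<Prod>p = 1..N. w (l N p)) = (\<Prod>p = 1..N. w (l' N p)) * wr"
  proof (cases "j = N")
    case True
    have mem: "a \<in> {1..N}" using a ij by auto
    have "l' N a = s - 1" using True ij by (simp add: l'r)
    then have "w (s - 1) > 0" using X_range[OF l', of N a] mem k_le by (intro w_pos) auto
    moreover have "(\<Prod>p\<in>{1..N} - {a}. w (l N p)) = (\<Prod>p\<in>{1..N} - {a}. w (l' N p))"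
      by (intro prod.cong) (auto simp: l'r)
    moreover have "l N a = s" using True ij ls by simp
    ultimately show ?thesis
      using True \<open>l' N a = s - 1\<close> prod.remove[OF finite_atLeastAtMost mem, of "\<lambda>p. w (l N p)"]
        prod.remove[OF finite_atLeastAtMost mem, of "\<lambda>p. w (l' N p)"]
      by (simp add: wr_def)
  next
    case False
    then show ?thesis using ij by (simp add: l'r wr_def)
  qed
  have lev: "level_weight w r (l r) = level_weight w r (l' r) *
      ((if r \<in> {i..j} then T r * B r else 1) * (if r = N then wr else 1))" for r
  proof (cases "r \<in> {i..j}")
    case True
    then show ?thesis using pairs[of r] wprod unfolding level_weight_def by auto
  next
    case False
    then have "l' r = l r" by (auto simp: l'r)
    then show ?thesis using False wprod unfolding level_weight_def by (cases "r = N") auto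
  qed
  have levels: "(\<Prod>r = k..N. level_weight w r (l r)) = (\<Prod>r = k..N. level_weight w r (l' r)) *
      ((\<Prod>r = i..j. T r * B r) * wr)"
  proof -
    have "(\<Prod>r = k..N. if r \<in> {i..j} then T r * B r else 1) = (\<Prod>r = i..j. T r * B r)"
      using ij by (intro prod.mono_neutral_cong_right) auto
    moreover have "(\<Prod>r = k..N. if r = N then wr else 1) = wr"
      using k_le by (subst prod_if_delta) auto
    ultimately show ?thesis by (simp only: lev prod.distrib)
  qed
  have cross: "cross_weight r (l (Suc r)) (l r) = cross_weight r (l' (Suc r)) (l' r) * cr r"
    if r: "r \<in> {k..<N}" for r
  proof -
    let ?xm = "i \<le> Suc r \<and> Suc r \<le> j" and ?ym = "i \<le> r \<and> r \<le> j"
    have "cross_weight r (l (Suc r)) (l r) = cross_weight r (l' (Suc r)) (l' r) *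
      ((if ?xm then \<Prod>b\<in>{1..r} - (if ?ym then {a} else {}). (s - l r b - 1 + \<theta>) / (s - l r b) else 1) *
       (if ?ym then \<Prod>q\<in>{1..Suc r} - (if ?xm then {a} else {}). (s - l (Suc r) q - 1) / (s - l (Suc r) q - \<theta>) else 1))"
      by (rule cross_ratio)
        (use r ij a ls X_gap_upper[OF l, of r] X_gap_upper[OF l', of r] X_gap_lower[OF l, of r] X_gap_lower[OF l', of r]
          in \<open>auto simp: l'r[of r] l'r[of "Suc r"] simp del: fun_upd_apply\<close>)
    also have "((if ?xm then \<Prod>b\<in>{1..r} - (if ?ym then {a} else {}). (s - l r b - 1 + \<theta>) / (s - l r b) else 1) *
       (if ?ym then \<Prod>q\<in>{1..Suc r} - (if ?xm then {a} else {}). (s - l (Suc r) q - 1) / (s - l (Suc r) q - \<theta>) else 1)) = cr r"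
    proof -
      consider "?xm" "?ym" | "Suc r = i" "?xm" "\<not> ?ym" | "r = j" "\<not> ?xm" "?ym" | "\<not> ?xm" "\<not> ?ym" "Suc r \<noteq> i" "r \<noteq> j"
        using ij by force
      then show ?thesis
      proof cases
        case 1
        have "(\<Prod>b\<in>{1..r} - {a}. (s - l r b - 1 + \<theta>) / (s - l r b)) = inverse (T r)"
          using r by (simp add: T_def top_ratio_def flip: prod_inversef)
        moreover have "(\<Prod>q\<in>{1..Suc r} - {a}. (s - l (Suc r) q - 1) / (s - l (Suc r) q - \<theta>)) = inverse (B (Suc r))"
          using r by (simp add: B_def bot_ratio_def flip: prod_inversef)
        ultimately show ?thesis using 1 by (simp add: cr_def)
      next
        case 2
        then show ?thesis by (auto simp: cr_def U_def)
      next
        case 3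
        then show ?thesis using ij by (auto simp: cr_def D_def simp del: prod.cl_ivl_Suc)
      next
        case 4
        then show ?thesis by (auto simp: cr_def)
      qed
    qed
    finally show ?thesis .
  qed
  \<comment> \<open>\<open>rminus\<close> contains the inverse of \<open>D\<close>. The quotient of
    two positive cross weights cannot vanish, which excludes a zero numerator or denominator in
    \<open>D\<close>.\<close>
  have D_ne: "D \<noteq> 0" if "j < N"
  proof -
    have "cr j \<noteq> 0" using cross[of j] cross_weight_pos[OF l, of j] that ij by auto
    then show ?thesis using ij by (simp add: cr_def split: if_splits)
  qed
  have cr_prod: "(\<Prod>r = k..<N. cr r) = (if i = k then 1 else U) *
      ((\<Prod>r = i..<j. inverse (T r)) * (\<Prod>r = i..<j. inverse (B (Suc r)))) * (if j = N then 1 else D)"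
  proof -
    have "(\<Prod>r = k..<N. cr r) = (\<Prod>r = k..<i. cr r) * (\<Prod>r = i..<j. cr r) * (\<Prod>r = j..<N. cr r)"
      using ij by (simp add: prod.atLeastLessThan_concat)
    also have "(\<Prod>r = k..<i. cr r) = (\<Prod>r = k..<i. if r = i - 1 then U else 1)"
      using ij by (intro prod.cong) (auto simp: cr_def)
    also have "\<dots> = (if i = k then 1 else U)" using ij by (auto simp: prod.delta)
    also have "(\<Prod>r = i..<j. cr r) = (\<Prod>r = i..<j. inverse (T r)) * (\<Prod>r = i..<j. inverse (B (Suc r)))"
      by (auto simp: cr_def simp flip: prod.distrib intro!: prod.cong)
    also have "(\<Prod>r = j..<N. cr r) = (\<Prod>r = j..<N. if r = j then D else 1)"
      using ij by (intro prod.cong) (auto simp: cr_def)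
    also have "\<dots> = (if j = N then 1 else D)" using ij by (auto simp: prod.delta)
    finally show ?thesis .
  qed
  have TB_prod: "(\<Prod>r = i..j. T r * B r) * ((\<Prod>r = i..<j. inverse (T r)) * (\<Prod>r = i..<j. inverse (B (Suc r)))) = T j * B i"
  proof -
    have s1: "{i..j} = insert j {i..<j}" and s2: "{i..j} = insert i (Suc ` {i..<j})"
      using ij by (auto simp: image_Suc_atLeastLessThan)
    have "(\<Prod>r = i..j. T r) = T j * (\<Prod>r = i..<j. T r)" unfolding s1 by (subst prod.insert) auto
    moreover have "(\<Prod>r = i..j. B r) = B i * (\<Prod>r = i..<j. B (Suc r))"
    proof -
      have "prod B (Suc ` {i..<j}) = (\<Prod>r = i..<j. B (Suc r))"
        by (subst prod.reindex) (auto simp: o_def simp del: image_Suc_atLeastLessThan)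
      then show ?thesis
        unfolding s2 by (subst prod.insert) (auto simp del: image_Suc_atLeastLessThan)
    qed
    moreover have "(\<Prod>r = i..<j. T r) \<noteq> 0" "(\<Prod>r = i..<j. B (Suc r)) \<noteq> 0"
      using TB by auto
    moreover have "(\<Prod>r = i..<j. inverse (T r)) = inverse (\<Prod>r = i..<j. T r)"
      "(\<Prod>r = i..<j. inverse (B (Suc r))) = inverse (\<Prod>r = i..<j. B (Suc r))"
      using prod_inversef[of T "{i..<j}"] prod_inversef[of "\<lambda>r. B (Suc r)" "{i..<j}"]
      by (simp_all add: o_def)
    moreover have "(t * p) * (b * q) * (inverse p * inverse q) = t * b" if "p \<noteq> 0" "q \<noteq> 0" for t p b q :: real
      using that by (simp add: field_simps)
    ultimately show ?thesis by (simp only: prod.distrib)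
  qed
  have W: "weight \<theta> w N k l = weight \<theta> w N k l' *
      (T j * B i * (if i = k then 1 else U) * (if j = N then 1 else D) * wr)"
  proof -
    have "(\<Prod>r = k..<N. cross_weight r (l (Suc r)) (l r)) =
        (\<Prod>r = k..<N. cross_weight r (l' (Suc r)) (l' r)) * (\<Prod>r = k..<N. cr r)"
      unfolding prod.distrib[symmetric] by (intro prod.cong refl cross) auto
    then show ?thesis
      unfolding weight_factorization[of w l] weight_factorization[of w l'] levels cr_prod TB_prod[symmetric]
      by (simp only: ac_simps)
  qed
  have minus: "rminus l j a s = - \<theta> * inverse (T j) * (if j = N then 1 else inverse D)"
    unfolding rminus_def T_def D_def top_ratio_def
    by (auto simp: algebra_simps simp del: prod.cl_ivl_Suc simp flip: prod_inversef)
  have plus: "rplus l' i a s = \<theta> * B i * (if i = k then 1 else U)"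
  proof -
    have "l' (i - 1) = l (i - 1)" if "i \<noteq> k" using that ij k_pos by (auto simp: l'r)
    moreover have "(\<Prod>q\<in>{1..i} - {a}. g (l' i q)) = (\<Prod>q\<in>{1..i} - {a}. g (l i q))" for g :: "real \<Rightarrow> real"
      by (intro prod.cong) (auto simp: l'r)
    note this[of "\<lambda>y. if i = k then (s - y + \<theta> - 1) / (s - y - 1) else (s - y - \<theta>) / (s - y - 1)"]
    ultimately show ?thesis
      unfolding rplus_def B_def U_def bot_ratio_def
      by (auto simp: algebra_simps)
  qed
  show ?thesis
    unfolding W minus plus wr_def[symmetric] using TB[of j] D_ne ij
    by (cases "j = N") (simp_all add: field_simps)
qed

end

section \<open>Residues of the observables\<close>


text \<open>\<open>R\<close> is a partial bijection. Terms without a partner are zero, so both sums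
  reduce to a sum over the graph of \<open>R\<close>.\<close>

lemma sum_matching:
  fixes f :: "'a \<Rightarrow> 'c::comm_monoid_add"
  assumes "finite A" "finite B"
    and R: "\<And>x y. R x y \<Longrightarrow> x \<in> A \<and> y \<in> B \<and> f x = g y"
    and ex1: "\<And>x. x \<in> A \<Longrightarrow> f x \<noteq> 0 \<Longrightarrow> \<exists>y. R x y"
    and ex2: "\<And>y. y \<in> B \<Longrightarrow> g y \<noteq> 0 \<Longrightarrow> \<exists>x. R x y"
    and un1: "\<And>x y y'. R x y \<Longrightarrow> R x y' \<Longrightarrow> y = y'"
    and un2: "\<And>x x' y. R x y \<Longrightarrow> R x' y \<Longrightarrow> x = x'"
  shows "sum f A = sum g B"
proof -
  let ?P = "{(x, y). R x y}"
  have inj1: "inj_on fst ?P" and inj2: "inj_on snd ?P"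
    using un1 un2 by (auto simp: inj_on_def)
  have "sum f A = sum f (fst ` ?P)"
    using R ex1 by (intro sum.mono_neutral_right assms) (force simp: image_iff)+
  also have "\<dots> = sum (f \<circ> fst) ?P" by (rule sum.reindex[OF inj1])
  also have "\<dots> = sum (g \<circ> snd) ?P" using R by (intro sum.cong) auto
  also have "\<dots> = sum g (snd ` ?P)" by (rule sum.reindex[OF inj2, symmetric])
  also have "\<dots> = sum g B"
    using R ex2 by (intro sum.mono_neutral_left assms) (force simp: image_iff)+
  finally show ?thesis .
qed

section \<open>Simple poles of products and sums of fractions\<close>

lemma prod_frac_tendsto:
  fixes c d :: "'i \<Rightarrow> complex"
  assumes "\<And>i. i \<in> I \<Longrightarrow> d i \<noteq> s"
  shows "((\<lambda>\<zeta>. \<Prod>i\<in>I. (\<zeta> - c i) / (\<zeta> - d i)) \<longlongrightarrow> (\<Prod>i\<in>I. (s - c i) / (s - d i))) (at s)"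
  using assms by (intro tendsto_intros) auto

text \<open>The sum has at most one term, as \<open>d\<close> is injective; as a sum it also covers
  the case without a pole.\<close>

lemma prod_frac_residue:
  fixes c d :: "'i \<Rightarrow> complex"
  assumes "finite I" "inj_on d I"
  shows "((\<lambda>\<zeta>. (\<zeta> - s) * (\<Prod>i\<in>I. (\<zeta> - c i) / (\<zeta> - d i))) \<longlongrightarrow>
    (\<Sum>a\<in>{a \<in> I. d a = s}. (s - c a) * (\<Prod>i\<in>I - {a}. (s - c i) / (s - d i)))) (at s)"
proof (cases "\<exists>a\<in>I. d a = s")
  case True
  then obtain a where a: "a \<in> I" "d a = s" by auto
  then have set_eq: "{a \<in> I. d a = s} = {a}" using assms(2) by (auto simp: inj_on_def)
  have "((\<lambda>\<zeta>. (\<zeta> - c a) * (\<Prod>i\<in>I - {a}. (\<zeta> - c i) / (\<zeta> - d i))) \<longlongrightarrow>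
      (s - c a) * (\<Prod>i\<in>I - {a}. (s - c i) / (s - d i))) (at s)"
    using a assms(2) by (intro tendsto_intros prod_frac_tendsto) (auto simp: inj_on_def)
  moreover have "\<forall>\<^sub>F \<zeta> in at s. (\<zeta> - c a) * (\<Prod>i\<in>I - {a}. (\<zeta> - c i) / (\<zeta> - d i)) =
      (\<zeta> - s) * (\<Prod>i\<in>I. (\<zeta> - c i) / (\<zeta> - d i))"
    using eventually_neq_at_within[of s s UNIV]
    by eventually_elim (use a assms(1) in \<open>simp add: prod.remove[of I a]\<close>)
  ultimately show ?thesis unfolding set_eq by (auto intro: Lim_transform_eventually)
next
  case False
  then have "((\<lambda>\<zeta>. (\<zeta> - s) * (\<Prod>i\<in>I. (\<zeta> - c i) / (\<zeta> - d i))) \<longlongrightarrow>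
      (s - s) * (\<Prod>i\<in>I. (s - c i) / (s - d i))) (at s)"
    by (intro tendsto_intros prod_frac_tendsto) auto
  moreover have e: "{a \<in> I. d a = s} = {}" using False by auto
  ultimately show ?thesis unfolding e by simp
qed

text \<open>The numerator of index \<open>a'\<close> cancels the denominator of index
  \<open>a\<close>.\<close>

lemma prod_frac_cancel_tendsto:
  fixes c d :: "'i \<Rightarrow> complex"
  assumes "finite I" "inj_on d I" "a \<in> I" "d a = s" "a' \<in> I" "c a' = s" "a' \<noteq> a"
  shows "\<exists>L. ((\<lambda>\<zeta>. \<Prod>i\<in>I. (\<zeta> - c i) / (\<zeta> - d i)) \<longlongrightarrow> L) (at s)"
proof -
  have ne: "d i \<noteq> s" if "i \<in> I - {a}" for i
    using that assms(2-4) by (auto simp: inj_on_def)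
  have "((\<lambda>\<zeta>. (\<zeta> - c a) / (\<zeta> - d a') * (\<Prod>i\<in>I - {a} - {a'}. (\<zeta> - c i) / (\<zeta> - d i))) \<longlongrightarrow>
      (s - c a) / (s - d a') * (\<Prod>i\<in>I - {a} - {a'}. (s - c i) / (s - d i))) (at s)"
    using ne ne[of a'] assms(5,7) by (intro tendsto_intros prod_frac_tendsto) auto
  moreover have "\<forall>\<^sub>F \<zeta> in at s. (\<zeta> - c a) / (\<zeta> - d a') * (\<Prod>i\<in>I - {a} - {a'}. (\<zeta> - c i) / (\<zeta> - d i)) =
      (\<Prod>i\<in>I. (\<zeta> - c i) / (\<zeta> - d i))"
    using eventually_neq_at_within[of s s UNIV]
  proof eventually_elim
    case (elim \<zeta>)
    have "(\<Prod>i\<in>I. (\<zeta> - c i) / (\<zeta> - d i)) = (\<zeta> - c a) / (\<zeta> - s) * ((\<zeta> - s) / (\<zeta> - d a') *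
        (\<Prod>i\<in>I - {a} - {a'}. (\<zeta> - c i) / (\<zeta> - d i)))"
      using assms by (simp add: prod.remove[of I a] prod.remove[of "I - {a}" a'])
    then show ?case using elim by simp
  qed
  ultimately show ?thesis by (blast intro: Lim_transform_eventually)
qed

lemma sum_frac_residue:
  fixes d :: "'i \<Rightarrow> complex"
  assumes "finite I"
  shows "((\<lambda>\<zeta>. (\<zeta> - s) * (\<Sum>i\<in>I. 1 / (\<zeta> - d i))) \<longlongrightarrow> (\<Sum>a\<in>{a \<in> I. d a = s}. 1)) (at s)"
proof -
  have "((\<lambda>\<zeta>. (\<zeta> - s) * (1 / (\<zeta> - d i))) \<longlongrightarrow> (if d i = s then 1 else 0)) (at s)" for i
  proof (cases "d i = s")
    case True
    have "((\<lambda>\<zeta>. 1 :: complex) \<longlongrightarrow> 1) (at s)" by simp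
    moreover have "\<forall>\<^sub>F \<zeta> in at s. 1 = (\<zeta> - s) * (1 / (\<zeta> - d i))"
      using eventually_neq_at_within[of s s UNIV] by eventually_elim (simp add: True)
    ultimately show ?thesis using True by (auto intro: Lim_transform_eventually)
  next
    case False
    then have "((\<lambda>\<zeta>. (\<zeta> - s) * (1 / (\<zeta> - d i))) \<longlongrightarrow> (s - s) * (1 / (s - d i))) (at s)"
      by (intro tendsto_intros) auto
    then show ?thesis using False by simp
  qed
  then have "((\<lambda>\<zeta>. \<Sum>i\<in>I. (\<zeta> - s) * (1 / (\<zeta> - d i))) \<longlongrightarrow> (\<Sum>i\<in>I. if d i = s then 1 else 0)) (at s)"
    by (rule tendsto_sum)
  moreover have "(\<Sum>i\<in>I. if d i = s then 1 else 0 :: complex) = (\<Sum>a\<in>{a \<in> I. d a = s}. 1)"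
    using assms by (intro sum.inter_filter[symmetric])
  ultimately show ?thesis by (simp only: sum_distrib_left)
qed

section \<open>Pairing of the residues over all configurations\<close>

context corners
begin

text \<open>Residue at \<open>s\<close> of the observable \<open>obs t l\<close>, as established in
  \<open>obs_residue\<close>. The observable of index \<open>Suc N\<close> has no poles of the first
  kind and that of index \<open>k\<close> none of the second.\<close>

definition res :: "(nat \<Rightarrow> nat \<Rightarrow> real) \<Rightarrow> nat \<Rightarrow> real \<Rightarrow> real" where
  "res l t s = (if t \<le> N then \<Sum>a\<in>{a \<in> {1..t}. l t a = s - 1}. rplus l t a s else 0) +
     (if k < t then \<Sum>a\<in>{a \<in> {1..t - 1}. l (t - 1) a = s}. rminus l (t - 1) a s else 0)"

text \<open>The index \<open>t = N + 1\<close> stands for the observable that is multiplied by \<open>\<Phi>\<^sup>-\<close>.\<close>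

definition obs :: "nat \<Rightarrow> (nat \<Rightarrow> nat \<Rightarrow> real) \<Rightarrow> complex \<Rightarrow> complex" where
  "obs t l \<zeta> =
     (if t = Suc N then \<Prod>p = 1..N. (\<zeta> - of_real (l N p) - of_real \<theta>) / (\<zeta> - of_real (l N p))
      else if t = k then \<Prod>p = 1..k. (\<zeta> - of_real (l k p) + of_real \<theta> - 1) / (\<zeta> - of_real (l k p) - 1)
      else Pi_obs \<theta> t \<zeta> l)"

text \<open>A nonzero \<open>rplus\<close> would let the string be raised, and the raised
  configuration would have the entry \<open>s\<close> outside the admissible interval. A pole of the
  other kind sits at an entry, hence inside the interval. This makes possible poles on the contour
  harmless.\<close>

lemma res_eq_0:
  assumes l: "l \<in> X" and t: "t \<in> {k..Suc N}" and s: "s \<notin> {- real N * \<theta> .. real M - \<theta>}" "s \<noteq> real M + 1 - \<theta>"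
  shows "res l t s = 0"
proof -
  have "- real N * \<theta> \<le> real M - \<theta>"
  proof -
    have "1 * \<theta> \<le> real N * \<theta>" using theta_pos k_pos k_le by (intro mult_right_mono) auto
    then show ?thesis by simp
  qed
  then have "rplus l t a s = 0" if a: "t \<le> N" "a \<in> {1..t}" "l t a = s - 1" for a
  proof (rule_tac ccontr)
    assume "rplus l t a s \<noteq> 0"
    then obtain j l2 where "string_rel s l2 l t j a"
      using rplus_string[OF l _ a(2,3)] a(1) t s by auto
    then have "l2 \<in> X" "l2 t a = s" by (auto simp: string_rel_def)
    then show False using X_range[of l2 t a] a t s by auto
  qed
  moreover have "{a \<in> {1..t - 1}. l (t - 1) a = s} = {}" if "k < t"
    using X_range[OF l, of "t - 1"] that t s by fastforce
  ultimately show ?thesis by (auto simp: res_def intro!: sum.neutral)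
qed

text \<open>\<open>H\<close> stands for the shifted products of the \<open>Y f\<close>, of which
  only the invariance along a string matters. The double sum becomes a sum over triples of a
  configuration, a level and an entry, separately for the two kinds of poles, and
  \<open>sum_matching\<close> identifies the two parts up to sign.\<close>

lemma residue_pairing:
  fixes H :: "(nat \<Rightarrow> nat \<Rightarrow> real) \<Rightarrow> nat \<Rightarrow> complex" and \<Phi>p \<Phi>m :: complex
  assumes w_pos: "\<And>x. x \<in> {- real N * \<theta> .. real M - \<theta>} \<Longrightarrow> w x > 0"
    and s: "s \<noteq> - real N * \<theta>" "s \<noteq> real M + 1 - \<theta>"
    and ratio: "s \<in> {- real N * \<theta> + 1 .. real M - \<theta>} \<Longrightarrow> of_real (w s / w (s - 1)) = \<Phi>p / \<Phi>m"
    and H: "\<And>l l' i j a. string_rel s l l' i j a \<Longrightarrow> H l (Suc j) = H l' i"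
  shows "(\<Sum>l\<in>X. \<Sum>t\<in>{k..Suc N}. of_real (res l t s) * (if t = Suc N then \<Phi>m else \<Phi>p) *
    (of_real (weight \<theta> w N k l) * H l t)) = 0"
proof -
  define SP where "SP = {(l, i, a). l \<in> X \<and> i \<in> {k..N} \<and> a \<in> {1..i} \<and> l i a = s - 1}"
  define SQ where "SQ = {(l, j, a). l \<in> X \<and> j \<in> {k..N} \<and> a \<in> {1..j} \<and> l j a = s}"
  define P where "P = (\<lambda>(l, i, a). - (of_real (rplus l i a s) * \<Phi>p * (of_real (weight \<theta> w N k l) * H l i)))"
  define Q where "Q = (\<lambda>(l, j, a). of_real (rminus l j a s) * (if j = N then \<Phi>m else \<Phi>p) *
      (of_real (weight \<theta> w N k l) * H l (Suc j)))"
  have fin: "finite SP" "finite SQ"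
    by (rule finite_subset[of _ "X \<times> {k..N} \<times> {1..N}"]; force simp: SP_def SQ_def finite_X_set)+
  let ?R = "\<lambda>(l, j, a) (l', i, a'). a' = a \<and> string_rel s l l' i j a"
  have "sum Q SQ = sum P SP"
  proof (rule sum_matching[OF fin(2,1), where R = ?R], goal_cases)
    case (1 x y)
    obtain l j a l' i where xy: "x = (l, j, a)" "y = (l', i, a)" and R: "string_rel s l l' i j a"
      using 1 by (cases x; cases y) auto
    have mem: "l \<in> X" "l' \<in> X" "l j a = s" "l' i a = s - 1" "j \<in> {k..N}" "i \<in> {k..N}" "a \<in> {1..i}" "a \<in> {1..j}"
      using R string_rel_lower_entries[OF R, of i] by (auto simp: string_rel_def)
    have rng: "s \<in> {- real N * \<theta> + 1 .. real M - \<theta>}"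
      using X_range[of l j a] X_range[of l' i a] mem by auto
    have wpos: "w s > 0" "w (s - 1) > 0" using rng by (auto intro!: w_pos)
    \<comment> \<open>A zero of \<open>\<Phi>m\<close> would make the quotient 0 by the convention
      \<open>x / 0 = 0\<close>, against the positivity of \<open>w\<close>.\<close>
    have "complex_of_real (w s / w (s - 1)) \<noteq> 0" using wpos by simp
    then have "\<Phi>m \<noteq> 0" using ratio[OF rng] by auto
    \<comment> \<open>A string that reaches level \<open>N\<close> also changes the factor
      \<open>w\<close>, which turns \<open>\<Phi>m\<close> into \<open>\<Phi>p\<close>. A shorter
      one changes no value of \<open>w\<close>, and both of its poles carry
      \<open>\<Phi>p\<close>.\<close>
    then have ratio': "of_real (if j = N then w s / w (s - 1) else 1) * (if j = N then \<Phi>m else \<Phi>p) = \<Phi>p"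
      using ratio[OF rng] by auto
    let ?wr = "if j = N then w s / w (s - 1) else 1" and ?c = "if j = N then \<Phi>m else \<Phi>p"
    have "complex_of_real (weight \<theta> w N k l * rminus l j a s) =
        of_real (- (weight \<theta> w N k l' * rplus l' i a s) * ?wr)"
      using weight_string[OF R w_pos] by (simp only:)
    then have *: "complex_of_real (weight \<theta> w N k l) * of_real (rminus l j a s) =
        - (of_real (weight \<theta> w N k l') * of_real (rplus l' i a s)) * of_real ?wr"
      by (simp only: of_real_mult of_real_minus)
    have "Q x = of_real (weight \<theta> w N k l) * of_real (rminus l j a s) * (?c * H l (Suc j))"
      unfolding Q_def xy by (simp only: prod.case ac_simps)
    also have "\<dots> = - (of_real (rplus l' i a s) * (of_real ?wr * ?c) * (of_real (weight \<theta> w N k l') * H l' i))"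
      unfolding * H[OF R] by (simp only: mult_minus_left mult_minus_right ac_simps)
    also have "\<dots> = P y"
      unfolding ratio' by (simp only: P_def xy prod.case)
    finally show ?case using mem by (auto simp: xy SP_def SQ_def)
  next
    case (2 x)
    then obtain l j a where x: "x = (l, j, a)" "l \<in> X" "j \<in> {k..N}" "a \<in> {1..j}" "l j a = s" "rminus l j a s \<noteq> 0"
      by (auto simp: SQ_def Q_def)
    then obtain i l' where "string_rel s l l' i j a" using rminus_string s(1) by blast
    then show ?case by (intro exI[of _ "(l', i, a)"]) (simp add: x)
  next
    case (3 y)
    then obtain l' i a where y: "y = (l', i, a)" "l' \<in> X" "i \<in> {k..N}" "a \<in> {1..i}" "l' i a = s - 1" "rplus l' i a s \<noteq> 0"
      by (auto simp: SP_def P_def)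
    then obtain j l where "string_rel s l l' i j a" using rplus_string s(2) by blast
    then show ?case by (intro exI[of _ "(l, j, a)"]) (simp add: y)
  next
    case (4 x y y')
    then show ?case by (cases x; cases y; cases y') (auto dest: string_rel_unique_lower)
  next
    case (5 x x' y)
    then show ?case by (cases x; cases x'; cases y) (auto dest: string_rel_unique_upper)
  qed
  moreover have "sum P SP = - (\<Sum>l\<in>X. \<Sum>t\<in>{k..N}. \<Sum>a\<in>{a \<in> {1..t}. l t a = s - 1}.
      of_real (rplus l t a s) * \<Phi>p * (of_real (weight \<theta> w N k l) * H l t))"
  proof -
    have "SP = (SIGMA l:X. SIGMA t:{k..N}. {a \<in> {1..t}. l t a = s - 1})" by (auto simp: SP_def)
    then show ?thesis
      by (simp add: P_def sum.Sigma finite_X_set case_prod_unfold flip: sum_negf)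
  qed
  moreover have "sum Q SQ = (\<Sum>l\<in>X. \<Sum>j\<in>{k..N}. \<Sum>a\<in>{a \<in> {1..j}. l j a = s}.
      of_real (rminus l j a s) * (if j = N then \<Phi>m else \<Phi>p) * (of_real (weight \<theta> w N k l) * H l (Suc j)))"
  proof -
    have "SQ = (SIGMA l:X. SIGMA t:{k..N}. {a \<in> {1..t}. l t a = s})" by (auto simp: SQ_def)
    then show ?thesis
      by (simp add: Q_def sum.Sigma finite_X_set case_prod_unfold)
  qed
  moreover have "(\<Sum>t\<in>{k..Suc N}. of_real (res l t s) * (if t = Suc N then \<Phi>m else \<Phi>p) *
        (of_real (weight \<theta> w N k l) * H l t)) =
      (\<Sum>t\<in>{k..N}. \<Sum>a\<in>{a \<in> {1..t}. l t a = s - 1}.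
        of_real (rplus l t a s) * \<Phi>p * (of_real (weight \<theta> w N k l) * H l t)) +
      (\<Sum>j\<in>{k..N}. \<Sum>a\<in>{a \<in> {1..j}. l j a = s}.
        of_real (rminus l j a s) * (if j = N then \<Phi>m else \<Phi>p) * (of_real (weight \<theta> w N k l) * H l (Suc j)))" for l
  proof -
    let ?c = "\<lambda>t. (if t = Suc N then \<Phi>m else \<Phi>p) * (of_real (weight \<theta> w N k l) * H l t)"
    let ?a = "\<lambda>t. \<Sum>a\<in>{a \<in> {1..t}. l t a = s - 1}. rplus l t a s"
    let ?b = "\<lambda>j. \<Sum>a\<in>{a \<in> {1..j}. l j a = s}. rminus l j a s"
    have "(\<Sum>t\<in>{k..Suc N}. of_real (res l t s) * (if t = Suc N then \<Phi>m else \<Phi>p) *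
        (of_real (weight \<theta> w N k l) * H l t)) =
        (\<Sum>t\<in>{k..Suc N}. of_real (if t \<le> N then ?a t else 0) * ?c t) +
        (\<Sum>t\<in>{k..Suc N}. of_real (if k < t then ?b (t - 1) else 0) * ?c t)"
      unfolding res_def by (simp only: of_real_add distrib_right sum.distrib mult.assoc)
    also have "(\<Sum>t\<in>{k..Suc N}. of_real (if t \<le> N then ?a t else 0) * ?c t) = (\<Sum>t\<in>{k..N}. of_real (?a t) * ?c t)"
      by (rule sum.mono_neutral_cong_right) auto
    also have "(\<Sum>t\<in>{k..Suc N}. of_real (if k < t then ?b (t - 1) else 0) * ?c t) =
        (\<Sum>t\<in>{Suc k..Suc N}. of_real (?b (t - 1)) * ?c t)"
      by (rule sum.mono_neutral_cong_right) auto
    also have "\<dots> = (\<Sum>j\<in>{k..N}. of_real (?b j) * ?c (Suc j))"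
      by (subst sum.shift_bounds_cl_Suc_ivl) simp
    finally show ?thesis
      by (auto simp: sum_distrib_right mult.assoc intro!: arg_cong2[of _ _ _ _ "(+)"] sum.cong)
  qed
  ultimately show ?thesis by (simp add: sum.distrib)
qed

text \<open>The two equations and integrality force the integer coordinates of \<open>l t a\<close>
  and \<open>l (t - 1) b\<close> to be equal. All entries that interlacing places between them then
  have the same integer coordinate; the outermost of these are the numerator zeros
  \<open>a' = b + 1\<close> and \<open>b' = a - 1\<close>.\<close>

lemma double_pole_cancels:
  assumes l: "l \<in> X" and t: "k < t" "t \<le> N" and a: "a \<in> {1..t}" and b: "b \<in> {1..t - 1}"
    and la: "l t a = s - 1" and lb: "l (t - 1) b = s"
  shows "(\<exists>a'\<in>{1..t}. l t a' = s - \<theta>) \<and> (\<exists>b'\<in>{1..t - 1}. l (t - 1) b' = s - 1 + \<theta>)"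
proof -
  obtain r where r: "t = Suc r" "k \<le> r" "r < N" using t by (cases t) auto
  have br: "b \<in> {1..r}" using b r by simp
  have pa: "\<pi> l t a = s - 1 + real a * \<theta>" and pb: "\<pi> l r b = s + real b * \<theta>"
    using la lb r by (auto simp: part_def)
  have ba: "b < a"
  proof (rule ccontr)
    assume "\<not> b < a"
    then have ab: "a \<le> b" by simp
    then have "real a * \<theta> \<le> real b * \<theta>" using theta_pos by (intro mult_right_mono) auto
    moreover have "\<pi> l r b \<le> \<pi> l r a" using ab br a r by (intro X_mono[OF l]) auto
    moreover have "\<pi> l r a \<le> \<pi> l t a" unfolding r(1) using ab br a r by (intro X_interlace_up[OF l]) auto
    ultimately show False using pa pb by simp
  qed
  have up: "\<pi> l t (Suc b) \<le> \<pi> l r b" unfolding r(1) using br r by (intro X_interlace_down[OF l]) auto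
  have m1: "\<pi> l t a \<le> \<pi> l t (Suc b)" using ba a t by (intro X_mono[OF l]) auto
  have eq: "\<pi> l t a = \<pi> l r b"
  proof (rule ccontr)
    assume "\<pi> l t a \<noteq> \<pi> l r b"
    then have "\<pi> l t a < \<pi> l r b" using up m1 by simp
    moreover have "\<pi> l t a \<in> \<int>" "\<pi> l r b \<in> \<int>" using a t br r by (auto intro!: X_Ints[OF l])
    ultimately have "\<pi> l t a \<le> \<pi> l r b - 1" using Ints_less_le_diff by blast
    moreover have "real b * \<theta> < real a * \<theta>" using ba theta_pos by simp
    ultimately show False using pa pb by simp
  qed
  have "l t (Suc b) = s - \<theta>" using up m1 eq pb by (simp add: part_def algebra_simps)
  moreover have "Suc b \<in> {1..t}" using ba a by auto
  moreover
  obtain a0 where a0: "a = Suc a0" "b \<le> a0" using ba by (cases a) auto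
  have "\<pi> l t (Suc a0) \<le> \<pi> l r a0" unfolding r(1) using a0 br a r by (intro X_interlace_down[OF l]) auto
  moreover have "\<pi> l r a0 \<le> \<pi> l r b" using a0 br a r by (intro X_mono[OF l]) auto
  ultimately have "l r a0 = s - 1 + \<theta>" using eq pa a0 by (simp add: part_def algebra_simps)
  moreover have "a0 \<in> {1..r}" using a0 br a r by auto
  ultimately show ?thesis
    using \<open>l t (Suc b) = s - \<theta>\<close> \<open>Suc b \<in> {1..t}\<close> r by auto
qed

end


section \<open>Identification of \<open>res\<close> as the residue of \<open>obs\<close>\<close>

lemma prod_frac_tendsto_of_real:
  fixes c d :: "'i \<Rightarrow> real"
  assumes "\<And>i. i \<in> I \<Longrightarrow> d i \<noteq> s"
  shows "((\<lambda>\<zeta> :: complex. \<Prod>i\<in>I. (\<zeta> - of_real (c i)) / (\<zeta> - of_real (d i))) \<longlongrightarrow>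
    of_real (\<Prod>i\<in>I. (s - c i) / (s - d i))) (at (of_real s))"
  using prod_frac_tendsto[of I "\<lambda>i. of_real (d i)" "of_real s" "\<lambda>i. of_real (c i)"] assms by simp

lemma prod_frac_residue_of_real:
  fixes c d :: "'i \<Rightarrow> real"
  assumes "finite I" "inj_on d I"
  shows "((\<lambda>\<zeta> :: complex. (\<zeta> - of_real s) * (\<Prod>i\<in>I. (\<zeta> - of_real (c i)) / (\<zeta> - of_real (d i)))) \<longlongrightarrow>
    of_real (\<Sum>a\<in>{a \<in> I. d a = s}. (s - c a) * (\<Prod>i\<in>I - {a}. (s - c i) / (s - d i)))) (at (of_real s))"
  using prod_frac_residue[of I "\<lambda>i. of_real (d i)" "of_real s" "\<lambda>i. of_real (c i)"] assms
  by (simp add: inj_on_def)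

lemma inj_on_fibre: "inj_on f I \<Longrightarrow> {a \<in> I. f a = c} = {} \<or> (\<exists>a. {a \<in> I. f a = c} = {a})"
  unfolding inj_on_def by blast

context corners
begin

lemma Pi_obs_eq_products:
  assumes "\<theta> \<noteq> 1"
  shows "Pi_obs \<theta> t \<zeta> l = of_real (\<theta> / (1 - \<theta>)) *
    (\<Prod>i\<in>{1..t}. (\<zeta> - of_real (l t i + \<theta>)) / (\<zeta> - of_real (l t i + 1))) *
    (\<Prod>i\<in>{1..t - 1}. (\<zeta> - of_real (l (t - 1) i - \<theta> + 1)) / (\<zeta> - of_real (l (t - 1) i)))"
  using assms unfolding Pi_obs_def by (simp add: algebra_simps)

text \<open>At a simple pole for \<open>\<theta> \<noteq> 1\<close> the polar numerator is
  \<open>1 - \<theta>\<close> up to sign, and the prefactor turns it into \<open>\<theta>\<close> up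
  to sign, as in \<open>rplus\<close> and \<open>rminus\<close>. If poles of both levels meet at
  \<open>s\<close>, the residue is zero.\<close>

lemma Pi_obs_residue:
  assumes l: "l \<in> X" and t: "k < t" "t \<le> N"
  shows "((\<lambda>\<zeta>. (\<zeta> - of_real s) * Pi_obs \<theta> t \<zeta> l) \<longlongrightarrow> of_real (res l t s)) (at (of_real s))"
proof -
  define A where "A = {a \<in> {1..t}. l t a = s - 1}"
  define B where "B = {b \<in> {1..t - 1}. l (t - 1) b = s}"
  have res: "res l t s = (\<Sum>a\<in>A. rplus l t a s) + (\<Sum>b\<in>B. rminus l (t - 1) b s)"
    using t by (simp add: res_def A_def B_def)
  have inj1: "inj_on (l t) {1..t}" using t by (intro X_inj[OF l]) auto
  have inj2: "inj_on (l (t - 1)) {1..t - 1}" using t by (intro X_inj[OF l]) auto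
  have A_alt: "{a \<in> {1..t}. l t a + 1 = s} = A" by (auto simp: A_def)
  have rp: "rplus l t a s = \<theta> * (\<Prod>q\<in>{1..t} - {a}. (s - (l t q + \<theta>)) / (s - (l t q + 1))) *
      (\<Prod>q = 1..t - 1. (s - (l (t - 1) q - \<theta> + 1)) / (s - l (t - 1) q))" for a
    using t by (simp add: rplus_def algebra_simps)
  have rm: "rminus l (t - 1) b s = - \<theta> * (\<Prod>q\<in>{1..t - 1} - {b}. (s - (l (t - 1) q - \<theta> + 1)) / (s - l (t - 1) q)) *
      (\<Prod>q = 1..t. (s - (l t q + \<theta>)) / (s - (l t q + 1)))" for b
    using t k_pos by (simp add: rminus_def algebra_simps)
  \<comment> \<open>Each coefficient contains the factor whose denominator vanishes because of the
    other pole, and \<open>x / 0 = 0\<close> makes it zero.\<close>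
  have both: "rplus l t a s = 0" "rminus l (t - 1) b s = 0" if "a \<in> A" "b \<in> B" for a b
  proof -
    have "(\<Prod>q = 1..t - 1. (s - (l (t - 1) q - \<theta> + 1)) / (s - l (t - 1) q)) = 0"
      using that by (intro prod_zero bexI[of _ b]) (auto simp: B_def)
    then show "rplus l t a s = 0" by (simp only: rp mult_zero_right)
    have "(\<Prod>q = 1..t. (s - (l t q + \<theta>)) / (s - (l t q + 1))) = 0"
      using that by (intro prod_zero bexI[of _ a]) (auto simp: A_def)
    then show "rminus l (t - 1) b s = 0" by (simp only: rm mult_zero_right)
  qed
  show ?thesis
  proof (cases "\<theta> = 1")
    case True
    have lim: "((\<lambda>\<zeta> :: complex. (\<zeta> - of_real s) * (\<Sum>i\<in>{1..t}. 1 / (\<zeta> - of_real (l t i + 1))) -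
        (\<zeta> - of_real s) * (\<Sum>i\<in>{1..t - 1}. 1 / (\<zeta> - of_real (l (t - 1) i)))) \<longlongrightarrow>
        (\<Sum>a\<in>{a \<in> {1..t}. complex_of_real (l t a + 1) = of_real s}. 1) -
        (\<Sum>b\<in>{b \<in> {1..t - 1}. complex_of_real (l (t - 1) b) = of_real s}. 1)) (at (of_real s))"
      by (intro tendsto_diff sum_frac_residue) auto
    have eA: "{a \<in> {1..t}. complex_of_real (l t a + 1) = of_real s} = A"
      unfolding of_real_eq_iff A_alt ..
    have eB: "{b \<in> {1..t - 1}. complex_of_real (l (t - 1) b) = of_real s} = B"
      unfolding of_real_eq_iff B_def ..
    have ePi: "(\<zeta> - of_real s) * (\<Sum>i\<in>{1..t}. 1 / (\<zeta> - of_real (l t i + 1))) -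
        (\<zeta> - of_real s) * (\<Sum>i\<in>{1..t - 1}. 1 / (\<zeta> - of_real (l (t - 1) i))) =
        (\<zeta> - of_real s) * Pi_obs \<theta> t \<zeta> l" for \<zeta>
      by (simp only: Pi_obs_def True simp_thms if_True right_diff_distrib of_real_add of_real_1 diff_diff_eq)
    \<comment> \<open>For \<open>\<theta> = 1\<close> every factor that is not polar equals 1, so
      the two kinds of poles count as 1 and -1. If both are present, they cancel, in agreement with
      the convention.\<close>
    have eres: "res l t s = (\<Sum>a\<in>A. 1) - (\<Sum>b\<in>B. 1)"
    proof -
      have A1: "A = {} \<or> (\<exists>a. A = {a})" unfolding A_def by (rule inj_on_fibre[OF inj1])
      have B1: "B = {} \<or> (\<exists>b. B = {b})" unfolding B_def by (rule inj_on_fibre[OF inj2])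
      have "rplus l t a s = 1" if "a \<in> A" "B = {}" for a
      proof -
        have "(\<Prod>q\<in>{1..t} - {a}. (s - (l t q + \<theta>)) / (s - (l t q + 1))) = 1"
        proof (intro prod.neutral ballI)
          fix q assume "q \<in> {1..t} - {a}"
          then have "l t q \<noteq> l t a" using inj_onD[OF inj1, of q a] that(1) by (auto simp: A_def)
          then show "(s - (l t q + \<theta>)) / (s - (l t q + 1)) = 1" using that(1) True by (simp add: A_def)
        qed
        moreover have "(\<Prod>q = 1..t - 1. (s - (l (t - 1) q - \<theta> + 1)) / (s - l (t - 1) q)) = 1"
          using that True by (intro prod.neutral) (auto simp: B_def)
        ultimately show ?thesis unfolding rp by (simp only: True mult_1)
      qed
      moreover have "rminus l (t - 1) b s = - 1" if "b \<in> B" "A = {}" for b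
      proof -
        have "(\<Prod>q\<in>{1..t - 1} - {b}. (s - (l (t - 1) q - \<theta> + 1)) / (s - l (t - 1) q)) = 1"
        proof (intro prod.neutral ballI)
          fix q assume "q \<in> {1..t - 1} - {b}"
          then have "l (t - 1) q \<noteq> l (t - 1) b" using inj_onD[OF inj2, of q b] that(1) by (auto simp: B_def)
          then show "(s - (l (t - 1) q - \<theta> + 1)) / (s - l (t - 1) q) = 1" using that(1) True by (simp add: B_def)
        qed
        moreover have "(\<Prod>q = 1..t. (s - (l t q + \<theta>)) / (s - (l t q + 1))) = 1"
          using that True by (intro prod.neutral) (auto simp: A_def)
        ultimately show ?thesis unfolding rm by (simp only: True mult_1_right)
      qed
      ultimately show ?thesis using A1 B1 both unfolding res by auto
    qed
    show ?thesis
      using lim unfolding ePi eA eB eres of_real_diff of_real_sum of_real_1 .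
  next
    case False
    let ?K = "complex_of_real (\<theta> / (1 - \<theta>))"
    let ?P1 = "\<lambda>\<zeta> :: complex. \<Prod>i\<in>{1..t}. (\<zeta> - of_real (l t i + \<theta>)) / (\<zeta> - of_real (l t i + 1))"
    let ?P2 = "\<lambda>\<zeta> :: complex. \<Prod>i\<in>{1..t - 1}. (\<zeta> - of_real (l (t - 1) i - \<theta> + 1)) / (\<zeta> - of_real (l (t - 1) i))"
    have res1: "((\<lambda>\<zeta>. (\<zeta> - of_real s) * ?P1 \<zeta>) \<longlongrightarrow>
        of_real (\<Sum>a\<in>A. (s - (l t a + \<theta>)) * (\<Prod>i\<in>{1..t} - {a}. (s - (l t i + \<theta>)) / (s - (l t i + 1))))) (at (of_real s))"
      unfolding A_alt[symmetric] using inj1 by (intro prod_frac_residue_of_real inj_onI) (auto dest: inj_onD)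
    have res2: "((\<lambda>\<zeta>. (\<zeta> - of_real s) * ?P2 \<zeta>) \<longlongrightarrow>
        of_real (\<Sum>b\<in>B. (s - (l (t - 1) b - \<theta> + 1)) *
          (\<Prod>i\<in>{1..t - 1} - {b}. (s - (l (t - 1) i - \<theta> + 1)) / (s - l (t - 1) i)))) (at (of_real s))"
      unfolding B_def using inj2 by (intro prod_frac_residue_of_real) auto
    have eq: "(\<zeta> - of_real s) * Pi_obs \<theta> t \<zeta> l = ?K * ((\<zeta> - of_real s) * ?P1 \<zeta>) * ?P2 \<zeta>"
      "(\<zeta> - of_real s) * Pi_obs \<theta> t \<zeta> l = ?K * ?P1 \<zeta> * ((\<zeta> - of_real s) * ?P2 \<zeta>)" for \<zeta>
      unfolding Pi_obs_eq_products[OF False] by (simp_all only: ac_simps)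
    have K: "\<theta> / (1 - \<theta>) * (s - (l t a + \<theta>)) = \<theta>" if "a \<in> A" for a
    proof -
      have e: "s - (l t a + \<theta>) = 1 - \<theta>" using that by (simp add: A_def)
      show ?thesis unfolding e using False by simp
    qed
    have K2: "\<theta> / (1 - \<theta>) * (s - (l (t - 1) b - \<theta> + 1)) = - \<theta>" if "b \<in> B" for b
    proof -
      have e: "s - (l (t - 1) b - \<theta> + 1) = - (1 - \<theta>)" using that by (simp add: B_def)
      show ?thesis unfolding e mult_minus_right using False by simp
    qed
    consider "B = {}" | "A = {}" | a b where "a \<in> A" "b \<in> B" by blast
    then show ?thesis
    proof cases
      case 1
      have "((\<lambda>\<zeta>. ?K * ((\<zeta> - of_real s) * ?P1 \<zeta>) * ?P2 \<zeta>) \<longlongrightarrow>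
          ?K * of_real (\<Sum>a\<in>A. (s - (l t a + \<theta>)) * (\<Prod>i\<in>{1..t} - {a}. (s - (l t i + \<theta>)) / (s - (l t i + 1)))) *
          of_real (\<Prod>q\<in>{1..t - 1}. (s - (l (t - 1) q - \<theta> + 1)) / (s - l (t - 1) q))) (at (of_real s))"
        using 1 by (intro tendsto_mult tendsto_const res1 prod_frac_tendsto_of_real) (auto simp: B_def)
      moreover have "res l t s = \<theta> / (1 - \<theta>) * (\<Sum>a\<in>A. (s - (l t a + \<theta>)) *
          (\<Prod>i\<in>{1..t} - {a}. (s - (l t i + \<theta>)) / (s - (l t i + 1)))) *
          (\<Prod>q\<in>{1..t - 1}. (s - (l (t - 1) q - \<theta> + 1)) / (s - l (t - 1) q))"
        unfolding res 1 rp sum_distrib_left sum_distrib_right mult.assoc[symmetric]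
        by (simp only: sum.empty add_0_right) (intro sum.cong refl, simp only: K)
      ultimately show ?thesis unfolding eq(1) by (simp only: of_real_mult)
    next
      case 2
      have "((\<lambda>\<zeta>. ?K * ?P1 \<zeta> * ((\<zeta> - of_real s) * ?P2 \<zeta>)) \<longlongrightarrow>
          ?K * of_real (\<Prod>q\<in>{1..t}. (s - (l t q + \<theta>)) / (s - (l t q + 1))) *
          of_real (\<Sum>b\<in>B. (s - (l (t - 1) b - \<theta> + 1)) *
          (\<Prod>i\<in>{1..t - 1} - {b}. (s - (l (t - 1) i - \<theta> + 1)) / (s - l (t - 1) i)))) (at (of_real s))"
        using 2 by (intro tendsto_mult tendsto_const res2 prod_frac_tendsto_of_real) (auto simp: A_def)
      moreover have "res l t s = \<theta> / (1 - \<theta>) * (\<Prod>q\<in>{1..t}. (s - (l t q + \<theta>)) / (s - (l t q + 1))) *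
          (\<Sum>b\<in>B. (s - (l (t - 1) b - \<theta> + 1)) *
          (\<Prod>i\<in>{1..t - 1} - {b}. (s - (l (t - 1) i - \<theta> + 1)) / (s - l (t - 1) i)))"
        unfolding res 2 rm sum_distrib_left
        by (simp only: sum.empty add_0_left) (intro sum.cong refl, simp only: K2[symmetric], simp only: ac_simps)
      ultimately show ?thesis unfolding eq(2) by (simp only: of_real_mult)
    next
      case 3
      have a: "a \<in> {1..t}" "l t a = s - 1" and b: "b \<in> {1..t - 1}" "l (t - 1) b = s"
        using 3 by (auto simp: A_def B_def)
      obtain a' b' where a': "a' \<in> {1..t}" "l t a' = s - \<theta>" and b': "b' \<in> {1..t - 1}" "l (t - 1) b' = s - 1 + \<theta>"
        using double_pole_cancels[OF l t a(1) b(1) a(2) b(2)] by blast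
      have "a' \<noteq> a" "b' \<noteq> b" using a a' b b' False by auto
      \<comment> \<open>In the double case the extra numerator zeros keep the first product bounded
        and remove the pole of the second, so the residue of the whole product is zero.\<close>
      have "\<exists>L. (?P1 \<longlongrightarrow> L) (at (of_real s))"
      proof (rule prod_frac_cancel_tendsto[where a = a and a' = a'])
        show "inj_on (\<lambda>i. complex_of_real (l t i + 1)) {1..t}" using inj1 by (intro inj_onI) (auto dest: inj_onD)
      qed (use a a' \<open>a' \<noteq> a\<close> in auto)
      then obtain P where P: "(?P1 \<longlongrightarrow> P) (at (of_real s))" by blast
      have zero: "(\<Sum>b\<in>B. (s - (l (t - 1) b - \<theta> + 1)) *
          (\<Prod>i\<in>{1..t - 1} - {b}. (s - (l (t - 1) i - \<theta> + 1)) / (s - l (t - 1) i))) = 0"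
      proof (rule sum.neutral, rule ballI)
        fix b1 assume "b1 \<in> B"
        then have "b1 = b" using b inj_onD[OF inj2, of b1 b] by (simp add: B_def)
        then have "(\<Prod>i\<in>{1..t - 1} - {b1}. (s - (l (t - 1) i - \<theta> + 1)) / (s - l (t - 1) i)) = 0"
          using b' \<open>b' \<noteq> b\<close> by (intro prod_zero bexI[of _ b']) auto
        then show "(s - (l (t - 1) b1 - \<theta> + 1)) *
          (\<Prod>i\<in>{1..t - 1} - {b1}. (s - (l (t - 1) i - \<theta> + 1)) / (s - l (t - 1) i)) = 0" by simp
      qed
      have "((\<lambda>\<zeta>. ?K * ?P1 \<zeta> * ((\<zeta> - of_real s) * ?P2 \<zeta>)) \<longlongrightarrow> ?K * P * of_real 0) (at (of_real s))"
        using res2[unfolded zero] by (intro tendsto_mult tendsto_const P)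
      moreover have "res l t s = 0"
        unfolding res using both 3 by (simp add: sum.neutral)
      ultimately show ?thesis unfolding eq(2) by simp
    qed
  qed
qed

lemma obs_residue:
  assumes l: "l \<in> X" and t: "t \<in> {k..Suc N}"
  shows "((\<lambda>\<zeta>. (\<zeta> - of_real s) * obs t l \<zeta>) \<longlongrightarrow> of_real (res l t s)) (at (of_real s))"
proof -
  consider "t = Suc N" | "t = k" "t \<noteq> Suc N" | "k < t" "t \<le> N" using t by force
  then show ?thesis
  proof cases
    case 1
    have "inj_on (l N) {1..N}" using k_le by (intro X_inj[OF l]) auto
    then have lim: "((\<lambda>\<zeta> :: complex. (\<zeta> - of_real s) * (\<Prod>i\<in>{1..N}. (\<zeta> - of_real (l N i + \<theta>)) / (\<zeta> - of_real (l N i)))) \<longlongrightarrow>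
      of_real (\<Sum>a\<in>{a \<in> {1..N}. l N a = s}. (s - (l N a + \<theta>)) *
        (\<Prod>i\<in>{1..N} - {a}. (s - (l N i + \<theta>)) / (s - l N i)))) (at (of_real s))"
      by (intro prod_frac_residue_of_real) auto
    have res_eq: "(\<Sum>a\<in>{a \<in> {1..N}. l N a = s}. (s - (l N a + \<theta>)) *
        (\<Prod>i\<in>{1..N} - {a}. (s - (l N i + \<theta>)) / (s - l N i))) = res l t s"
      using 1 k_le by (auto simp: res_def rminus_def diff_diff_eq intro!: sum.cong)
    have obs_eq: "obs t l \<zeta> = (\<Prod>i\<in>{1..N}. (\<zeta> - of_real (l N i + \<theta>)) / (\<zeta> - of_real (l N i)))" for \<zeta>
      using 1 by (simp add: obs_def diff_diff_eq)
    show ?thesis unfolding obs_eq res_eq[symmetric] by (rule lim)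
  next
    case 2
    have inj: "inj_on (\<lambda>i. l k i + 1) {1..k}" 
    proof -
      have "inj_on (l k) {1..k}" using k_le by (intro X_inj[OF l]) auto
      then show ?thesis by (intro inj_onI) (auto dest: inj_onD)
    qed
    have lim: "((\<lambda>\<zeta> :: complex. (\<zeta> - of_real s) *
        (\<Prod>i\<in>{1..k}. (\<zeta> - of_real (l k i - \<theta> + 1)) / (\<zeta> - of_real (l k i + 1)))) \<longlongrightarrow>
      of_real (\<Sum>a\<in>{a \<in> {1..k}. l k a + 1 = s}. (s - (l k a - \<theta> + 1)) *
        (\<Prod>i\<in>{1..k} - {a}. (s - (l k i - \<theta> + 1)) / (s - (l k i + 1))))) (at (of_real s))"
      by (rule prod_frac_residue_of_real[OF _ inj]) simp
    have res_eq: "(\<Sum>a\<in>{a \<in> {1..k}. l k a + 1 = s}. (s - (l k a - \<theta> + 1)) *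
        (\<Prod>i\<in>{1..k} - {a}. (s - (l k i - \<theta> + 1)) / (s - (l k i + 1)))) = res l t s"
    proof -
      have "{a \<in> {1..k}. l k a + 1 = s} = {a \<in> {1..k}. l k a = s - 1}" by auto
      moreover have "(s - (l k a - \<theta> + 1)) * (\<Prod>i\<in>{1..k} - {a}. (s - (l k i - \<theta> + 1)) / (s - (l k i + 1))) =
          rplus l k a s" if "l k a = s - 1" for a
        using that by (simp add: rplus_def algebra_simps)
      moreover have "res l t s = (\<Sum>a\<in>{a \<in> {1..k}. l k a = s - 1}. rplus l k a s)"
        using 2 k_le by (simp add: res_def)
      ultimately show ?thesis by (auto simp only: mem_Collect_eq intro!: sum.cong)
    qed
    have obs_eq: "obs t l \<zeta> = (\<Prod>i\<in>{1..k}. (\<zeta> - of_real (l k i - \<theta> + 1)) / (\<zeta> - of_real (l k i + 1)))" for \<zeta>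
      using 2 by (simp add: obs_def algebra_simps)
    show ?thesis unfolding obs_eq res_eq[symmetric] by (rule lim)
  next
    case 3
    then show ?thesis using Pi_obs_residue[OF l 3] by (simp add: obs_def)
  qed
qed

definition poles :: "real set" where
  "poles = (\<Union>l\<in>X. \<Union>r\<in>{k..N}. \<Union>b\<in>{1..r}. {l r b, l r b + 1})"

lemma finite_poles: "finite poles"
  by (auto simp: poles_def finite_X_set)

lemma obs_holomorphic:
  assumes l: "l \<in> X" and t: "t \<in> {k..Suc N}" and S: "S \<inter> of_real ` poles = {}"
  shows "obs t l holomorphic_on S"
proof -
  have ne: "\<zeta> - of_real (l r b) \<noteq> 0" "\<zeta> - of_real (l r b) - 1 \<noteq> 0" if "\<zeta> \<in> S" "r \<in> {k..N}" "b \<in> {1..r}" for \<zeta> r b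
  proof -
    have "\<zeta> \<noteq> of_real x" if x: "x \<in> {l r b, l r b + 1}" for x
    proof -
      have "x \<in> poles"
        unfolding poles_def
        by (rule UN_I[OF l], rule UN_I[OF \<open>r \<in> {k..N}\<close>], rule UN_I[OF \<open>b \<in> {1..r}\<close>], rule x)
      then show ?thesis using S \<open>\<zeta> \<in> S\<close> by auto
    qed
    from this[of "l r b"] this[of "l r b + 1"] show "\<zeta> - of_real (l r b) \<noteq> 0" "\<zeta> - of_real (l r b) - 1 \<noteq> 0"
      by (auto simp: diff_eq_eq add.commute)
  qed
  consider "t = Suc N" | "t = k" "t \<noteq> Suc N" | "k < t" "t \<le> N" using t by force
  then show ?thesis
  proof cases
    case 1
    then show ?thesis unfolding obs_def using ne[of _ N] k_le by (auto intro!: holomorphic_intros)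
  next
    case 2
    then show ?thesis unfolding obs_def using ne[of _ k] k_le by (auto intro!: holomorphic_intros)
  next
    case 3
    have "t \<in> {k..N}" "t - 1 \<in> {k..N}" using 3 by auto
    then have "(\<lambda>\<zeta>. Pi_obs \<theta> t \<zeta> l) holomorphic_on S"
      unfolding Pi_obs_def using ne
      by (cases "\<theta> = 1") (auto intro!: holomorphic_intros)
    then show ?thesis using 3 by (simp add: obs_def[abs_def])
  qed
qed

end

section \<open>The loop equation\<close>


lemma distinct_concat_map_Pair:
  assumes "distinct rs" "\<And>r. r \<in> set rs \<Longrightarrow> distinct (g r)"
  shows "distinct (concat (map (\<lambda>r. map (Pair r) (g r)) rs))"
  using assms by (induction rs) (auto simp: distinct_map inj_on_def)

text \<open>By injectivity a simple path meets a finite set at finitely many parameters, a null set.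
  This lets an integrand be replaced by its holomorphic extension even when removable singularities
  lie on the contour.\<close>

lemma has_contour_integral_spike_finite_simple_path:
  assumes "(f has_contour_integral I) g" "finite A" "simple_path g" "\<And>x. x \<in> path_image g - A \<Longrightarrow> f' x = f x"
  shows "(f' has_contour_integral I) g"
proof -
  have "finite (g -` A \<inter> {0<..<1})"
    using assms(2,3) by (intro finite_vimage_IntI simple_path_inj_on) auto
  then have neg: "negligible ({0, 1} \<union> g -` A \<inter> {0<..<1})" by (intro negligible_finite) auto
  show ?thesis
    unfolding has_contour_integral
  proof (rule has_integral_spike[OF neg])
    show "((\<lambda>x. f (g x) * vector_derivative g (at x)) has_integral I) {0..1}"
      using assms(1) by (simp add: has_contour_integral)
    fix x assume "x \<in> {0..1} - ({0, 1} \<union> g -` A \<inter> {0<..<1})"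
    then have "g x \<in> path_image g - A" by (auto simp: path_image_def)
    then show "f' (g x) * vector_derivative g (at x) = f (g x) * vector_derivative g (at x)"
      using assms(4) by simp
  qed
qed

text \<open>Riemann's theorem on removable singularities, one point at a time; \<open>U\<close>
  varies in the induction because the point treated last is first deleted from it.\<close>

lemma holomorphic_extend_finite:
  fixes f :: "complex \<Rightarrow> complex"
  assumes "finite K" "open U" "f holomorphic_on U - K"
    and "\<And>\<xi>. \<xi> \<in> K \<Longrightarrow> \<xi> \<in> U \<Longrightarrow> ((\<lambda>z. (z - \<xi>) * f z) \<longlongrightarrow> 0) (at \<xi>)"
  shows "\<exists>g. g holomorphic_on U \<and> (\<forall>z\<in>U - K. g z = f z)"
  using assms
proof (induction K arbitrary: U rule: finite_induct)
  case empty
  then show ?case by (intro exI[of _ f]) simp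
next
  case (insert \<xi> K)
  have "\<exists>g. g holomorphic_on (U - {\<xi>}) \<and> (\<forall>z\<in>U - {\<xi>} - K. g z = f z)"
  proof (rule insert.IH)
    show "open (U - {\<xi>})" using insert.prems(1) by (rule open_delete)
    have e: "U - {\<xi>} - K = U - insert \<xi> K" by blast
    show "f holomorphic_on U - {\<xi>} - K" unfolding e by (rule insert.prems(2))
    fix \<eta> assume "\<eta> \<in> K" "\<eta> \<in> U - {\<xi>}"
    then show "((\<lambda>z. (z - \<eta>) * f z) \<longlongrightarrow> 0) (at \<eta>)"
      by (intro insert.prems(3)) simp_all
  qed
  then obtain g where g: "g holomorphic_on (U - {\<xi>})" "\<And>z. z \<in> U - insert \<xi> K \<Longrightarrow> g z = f z"
    by auto
  show ?case
  proof (cases "\<xi> \<in> U")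
    case False
    then show ?thesis using g by (intro exI[of _ g]) auto
  next
    case True
    have "open (U - K)" using insert.hyps insert.prems by (intro open_Diff finite_imp_closed) auto
    then have "\<forall>\<^sub>F z in at \<xi>. z \<in> U - K - {\<xi>}"
      using True insert.hyps by (intro eventually_at_in_open) auto
    then have ev: "\<forall>\<^sub>F z in at \<xi>. (z - \<xi>) * f z = (z - \<xi>) * g z"
      by eventually_elim (use g(2) in auto)
    have "((\<lambda>z. (z - \<xi>) * g z) \<longlongrightarrow> 0) (at \<xi>)"
      using Lim_transform_eventually[OF insert.prems(3)[OF _ True] ev] by auto
    moreover have "\<xi> \<in> interior U" using True insert.prems(1) by (simp add: interior_open)
    ultimately obtain h where "h holomorphic_on U" "\<forall>z\<in>U - {\<xi>}. h z = g z"
      using holomorphic_on_extend_lim[OF g(1)] by blast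
    then show ?thesis using g(2) by (intro exI[of _ h]) auto
  qed
qed


section \<open>The integrands of the loop equation and their singularities\<close>

locale loop_setting = corners \<theta> N k M for \<theta> :: real and N k M :: nat +
  fixes w :: "real \<Rightarrow> real"
    and \<M> :: "complex set" and \<Phi>p \<Phi>m :: "complex \<Rightarrow> complex"
    and L :: real and m :: "nat \<Rightarrow> nat" and vs :: "nat \<Rightarrow> nat \<Rightarrow> complex"
    and \<gamma> :: "real \<Rightarrow> complex" and v :: complex
  assumes w_pos: "\<And>x. x \<in> {- real N * \<theta> .. real M - \<theta>} \<Longrightarrow> w x > 0"
    and domain_open: "open \<M>"
    and holo_plus: "\<Phi>p holomorphic_on \<M>"
    and holo_minus: "\<Phi>m holomorphic_on \<M>"
    and ratio: "\<And>x. x \<in> {- real N * \<theta> + 1 .. real M - \<theta>} \<Longrightarrow>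
          complex_of_real (w x / w (x - 1)) = \<Phi>p (of_real x) / \<Phi>m (of_real x)"
    and L_pos: "L > 0"
    and vs_domain: "\<And>j i. j \<in> {k..N} \<Longrightarrow> i \<in> {1..m j} \<Longrightarrow>
          of_real L * vs j i \<notin> complex_of_real ` {- real N * \<theta> .. real M - \<theta>}"
    and contour: "pos_simple_contour \<gamma>"
    and contour_domain: "\<And>z. z \<in> path_image \<gamma> \<union> inside (path_image \<gamma>) \<Longrightarrow> of_real L * z \<in> \<M>"
    and contour_encloses:
      "complex_of_real ` {- \<theta> * real N / L .. (real M - \<theta>) / L} \<subseteq> inside (path_image \<gamma>)"
    and contour_excludes: "\<And>j i. j \<in> {k..N} \<Longrightarrow> i \<in> {1..m j} \<Longrightarrow>
          vs j i \<in> outside (path_image \<gamma>) \<and> vs j i + of_real (1 / L) \<in> outside (path_image \<gamma>)"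
    and v_outside: "v \<in> outside (path_image \<gamma>)"
begin

definition indices :: "(nat \<times> nat) set" where "indices = (SIGMA r:{k..N}. {1..m r})"

definition prob :: "(nat \<Rightarrow> nat \<Rightarrow> real) \<Rightarrow> real" where
  "prob l = weight \<theta> w N k l / (\<Sum>l'\<in>X. weight \<theta> w N k l')"

definition Y :: "nat \<times> nat \<Rightarrow> (nat \<Rightarrow> nat \<Rightarrow> real) \<Rightarrow> complex" where
  "Y f l = G_obs L (fst f) (vs (fst f) (snd f)) l"

definition moment :: "(nat \<times> nat) set \<Rightarrow> complex" where
  "moment A = (\<Sum>l\<in>X. of_real (prob l) * (\<Prod>f\<in>A. Y f l))"

text \<open>The joint cumulant of the indicator of the configuration \<open>l\<close> and the
  variables \<open>Y f\<close>, \<open>f \<in> F\<close>.\<close>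

definition cumulant_density :: "(nat \<Rightarrow> nat \<Rightarrow> real) \<Rightarrow> (nat \<times> nat) set \<Rightarrow> complex" where
  "cumulant_density l F = cumul moment (\<lambda>A. of_real (prob l) * (\<Prod>f\<in>A. Y f l)) F"

text \<open>The value 0 on levels below \<open>t\<close> encodes the indicators of the theorem: an
  index missing from \<open>F\<close> on such a level kills the product.\<close>

definition shift_term :: "nat \<Rightarrow> complex \<Rightarrow> nat \<times> nat \<Rightarrow> complex" where
  "shift_term t z f = (if t \<le> fst f then 1 / (of_real L * (vs (fst f) (snd f) - z) *
     (vs (fst f) (snd f) - z + of_real (1 / L))) else 0)"

text \<open>The kernel with its quadratic polynomial in the numerator, so that it is holomorphic,
  with value 0, at the two exceptional points. Total division makes it agree with the original
  kernel at every \<open>z\<close>.\<close>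

definition inv_S :: "complex \<Rightarrow> complex" where
  "inv_S z = (of_real L * z + of_nat N * of_real \<theta>) * (of_real L * z - of_nat M - 1 + of_real \<theta>) /
     (2 * of_real pi * \<i> * (of_real L * (z - v)))"

definition \<Phi>t :: "nat \<Rightarrow> complex \<Rightarrow> complex" where
  "\<Phi>t t z = (if t = Suc N then \<Phi>m (of_real L * z) else \<Phi>p (of_real L * z))"

text \<open>A common domain of holomorphy of all factors except the observables. The points taken
  out lie outside the contour.\<close>

definition U where "U = {z. of_real L * z \<in> \<M>} - ({v} \<union> (\<Union>f\<in>indices. {vs (fst f) (snd f), vs (fst f) (snd f) + of_real (1 / L)}))"

definition sing where "sing = (\<lambda>s. complex_of_real (s / L)) ` poles"

lemma finite_indices: "finite indices" by (simp add: indices_def)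

lemma finite_sing: "finite sing" by (simp add: sing_def finite_poles)

lemma sum_weight_pos: "(\<Sum>l\<in>X. weight \<theta> w N k l) > 0"
  by (rule sum_pos[OF finite_X_set X_set_nonempty weight_pos[OF _ w_pos]])

lemma sum_prob: "(\<Sum>l\<in>X. prob l) = 1"
  unfolding prob_def sum_divide_distrib[symmetric] using sum_weight_pos by simp

lemma integral_P_measure:
  fixes g :: "(nat \<Rightarrow> nat \<Rightarrow> real) \<Rightarrow> complex"
  shows "integral\<^sup>L (P_measure \<theta> w M N k) g = (\<Sum>l\<in>X. of_real (prob l) * g l)"
proof -
  \<comment> \<open>\<open>ennreal\<close> would truncate a negative density to 0.\<close>
  have "0 \<le> prob l" if "l \<in> X" for l
    unfolding prob_def by (intro divide_nonneg_pos less_imp_le[OF weight_pos[OF that w_pos]] sum_weight_pos)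
  then show ?thesis
    unfolding P_measure_def prob_def[symmetric]
    by (subst lebesgue_integral_point_measure_finite) (auto simp: finite_X_set scaleR_conv_of_real)
qed

lemma moment_empty: "moment {} = 1"
  by (simp add: moment_def sum_prob flip: of_real_sum)

text \<open>Separates the observable, which depends on \<open>z\<close>, from coefficients that do
  not, so that holomorphy and residues concern the observable alone.\<close>

lemma cumulant_G_eq:
  assumes "\<And>r. r \<in> {k..N} \<Longrightarrow> F r \<subseteq> {1..m r}"
  shows "cumulant_G \<theta> w M N k L vs \<xi> F = (\<Sum>l\<in>X. \<xi> l * cumulant_density l (SIGMA r:{k..N}. F r))"
proof -
  define js where "js = concat (map (\<lambda>j. map (Pair j) (sorted_list_of_set (F j))) [k..<Suc N])"
  have fin: "finite (F r)" if "r \<in> {k..N}" for r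
    using assms[OF that] finite_subset by auto
  have set_js: "set js = (SIGMA r:{k..N}. F r)"
    using fin by (auto simp: js_def)
  have "distinct js"
    unfolding js_def by (intro distinct_concat_map_Pair) auto
  moreover have "concat (map (\<lambda>j. map (\<lambda>i. G_obs L j (vs j i)) (sorted_list_of_set (F j))) [k..<Suc N]) = map Y js"
    by (simp add: js_def map_concat o_def Y_def[abs_def] del: upt_Suc)
  ultimately show ?thesis
    unfolding cumulant_G_def set_js[symmetric] cumulant_density_def moment_def[abs_def]
    using joint_cumulant_indexed[OF finite_X_set sum_prob integral_P_measure, of js \<xi> Y] by simp
qed

lemma \<Phi>t_over_S: "\<Phi>t t z / (2 * of_real pi * \<i> * S_scaled \<theta> M N L v z) = \<Phi>t t z * inv_S z"
  by (simp add: S_scaled_def inv_S_def)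

lemma open_U: "open U"
proof -
  have "open ((\<lambda>z. complex_of_real L * z) -` \<M>)"
    using domain_open by (intro open_vimage continuous_intros)
  then show ?thesis unfolding U_def vimage_def
    using finite_indices by (intro open_Diff finite_imp_closed) auto
qed

lemma contour_in_U: "path_image \<gamma> \<union> inside (path_image \<gamma>) \<subseteq> U"
proof
  fix z assume z: "z \<in> path_image \<gamma> \<union> inside (path_image \<gamma>)"
  then have no: "z \<notin> outside (path_image \<gamma>)"
    using outside_no_overlap[of "path_image \<gamma>"] inside_Int_outside[of "path_image \<gamma>"] by blast
  have "z \<noteq> vs (fst f) (snd f) \<and> z \<noteq> vs (fst f) (snd f) + of_real (1 / L)" if "f \<in> indices" for f
    using contour_excludes[of "fst f" "snd f"] that no by (auto simp: indices_def)
  then show "z \<in> U" using contour_domain[OF z] v_outside no by (auto simp: U_def)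
qed

lemma \<Phi>t_holomorphic: "\<Phi>t t holomorphic_on U"
proof -
  have "(\<lambda>z. f (of_real L * z)) holomorphic_on U" if "f holomorphic_on \<M>" for f
    using holomorphic_on_compose_gen[of "\<lambda>z. of_real L * z" U f \<M>] that
    by (auto simp: o_def U_def intro!: holomorphic_intros)
  then show ?thesis
    using holo_plus holo_minus by (cases "t = Suc N") (simp_all add: \<Phi>t_def[abs_def])
qed

lemma inv_S_holomorphic: "inv_S holomorphic_on U"
  unfolding inv_S_def[abs_def] using L_pos by (intro holomorphic_intros) (auto simp: U_def)

lemma shift_term_holomorphic: "f \<in> indices \<Longrightarrow> (\<lambda>z. shift_term t z f) holomorphic_on U"
  unfolding shift_term_def using L_pos
  by (cases "t \<le> fst f") (auto intro!: holomorphic_intros simp: U_def diff_add_eq)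

lemma isCont_U: "f holomorphic_on U \<Longrightarrow> z \<in> U \<Longrightarrow> isCont f z"
  using open_U holomorphic_on_imp_continuous_on continuous_on_eq_continuous_at by blast

lemma term_holomorphic:
  assumes "l \<in> X" "t \<in> {k..Suc N}"
  shows "(\<lambda>z. \<Phi>t t z * inv_S z * obs t l (of_real L * z)) holomorphic_on U - sing"
proof -
  have "(\<lambda>z. obs t l (of_real L * z)) holomorphic_on U - sing"
  proof -
    have "(obs t l \<circ> (\<lambda>z. of_real L * z)) holomorphic_on U - sing"
    proof (rule holomorphic_on_compose)
      show "obs t l holomorphic_on (\<lambda>z. of_real L * z) ` (U - sing)"
      proof (rule obs_holomorphic[OF assms], rule ccontr)
        assume "(\<lambda>z. of_real L * z) ` (U - sing) \<inter> of_real ` poles \<noteq> {}"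
        then obtain z s where z: "z \<notin> sing" "s \<in> poles" "of_real L * z = complex_of_real s" by blast
        then have "z = of_real (s / L)" using L_pos by (simp add: field_simps)
        then show False using z by (auto simp: sing_def)
      qed
    qed (intro holomorphic_intros)
    then show ?thesis by (simp add: o_def)
  qed
  then show ?thesis
    by (intro holomorphic_intros holomorphic_on_subset[OF \<Phi>t_holomorphic] holomorphic_on_subset[OF inv_S_holomorphic]) auto
qed

lemma term_residue:
  assumes l: "l \<in> X" and t: "t \<in> {k..Suc N}" and U: "of_real (s / L) \<in> U"
  shows "((\<lambda>z. (z - of_real (s / L)) * (\<Phi>t t z * inv_S z * obs t l (of_real L * z))) \<longlongrightarrow>
    \<Phi>t t (of_real (s / L)) * inv_S (of_real (s / L)) * (of_real (res l t s) / of_real L)) (at (of_real (s / L)))"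
proof -
  let ?z = "complex_of_real (s / L)"
  have Lz: "of_real L * ?z = of_real s" using L_pos by simp
  have "filterlim (\<lambda>z. of_real L * z) (at (of_real s)) (at ?z)"
  proof (rule filterlim_atI)
    show "((\<lambda>z. of_real L * z) \<longlongrightarrow> complex_of_real s) (at ?z)"
      unfolding Lz[symmetric] by (intro tendsto_intros)
    show "\<forall>\<^sub>F z in at ?z. of_real L * z \<noteq> complex_of_real s"
      using eventually_neq_at_within[of ?z ?z UNIV]
      by eventually_elim (use L_pos in \<open>auto simp: field_simps\<close>)
  qed
  from filterlim_compose[OF obs_residue[OF l t] this]
  have "((\<lambda>z. (of_real L * z - of_real s) * obs t l (of_real L * z)) \<longlongrightarrow> of_real (res l t s)) (at ?z)" .
  then have "((\<lambda>z. (of_real L * z - of_real s) * obs t l (of_real L * z) / of_real L) \<longlongrightarrow>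
      of_real (res l t s) / of_real L) (at ?z)"
    using L_pos by (intro tendsto_intros) auto
  moreover have "(of_real L * z - of_real s) * obs t l (of_real L * z) / of_real L = (z - ?z) * obs t l (of_real L * z)" for z
    using L_pos by (simp add: field_simps)
  ultimately have lim: "((\<lambda>z. (z - ?z) * obs t l (of_real L * z)) \<longlongrightarrow> of_real (res l t s) / of_real L) (at ?z)"
    by simp
  have "(\<Phi>t t \<longlongrightarrow> \<Phi>t t ?z) (at ?z)" "(inv_S \<longlongrightarrow> inv_S ?z) (at ?z)"
    using isCont_U[OF \<Phi>t_holomorphic U] isCont_U[OF inv_S_holomorphic U] by (auto simp: isCont_def)
  from tendsto_mult[OF tendsto_mult[OF this] lim] show ?thesis
    by (simp only: ac_simps)
qed

lemma inv_S_eq_0: "s = - real N * \<theta> \<or> s = real M + 1 - \<theta> \<Longrightarrow> inv_S (of_real (s / L)) = 0"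
  using L_pos by (auto simp: inv_S_def)

text \<open>The contour avoids the interval \<open>?J\<close>. Away from it every possible pole has
  residue 0 or lies at the right zero of \<open>inv_S\<close>, so each single term extends
  holomorphically to an open neighbourhood of the contour. Inside the contour only the sum of the
  terms extends.\<close>

lemma term_integrable:
  assumes l: "l \<in> X" and t: "t \<in> {k..Suc N}" and h: "h holomorphic_on U"
  shows "(\<lambda>z. \<Phi>t t z * inv_S z * obs t l (of_real L * z) * h z) contour_integrable_on \<gamma>"
proof -
  let ?f = "\<lambda>z. \<Phi>t t z * inv_S z * obs t l (of_real L * z) * h z"
  let ?J = "complex_of_real ` {- \<theta> * real N / L .. (real M - \<theta>) / L}"
  let ?V = "U - ?J"
  have "compact ?J" by (intro compact_continuous_image continuous_intros) auto
  then have V: "open ?V" using open_U by (intro open_Diff compact_imp_closed)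
  have gV: "path_image \<gamma> \<subseteq> ?V"
    using contour_in_U contour_encloses inside_no_overlap[of "path_image \<gamma>"] by blast
  have vp: "valid_path \<gamma>" "simple_path \<gamma>" using contour by (auto simp: pos_simple_contour_def)
  have "\<exists>g. g holomorphic_on ?V \<and> (\<forall>z\<in>?V - sing. g z = ?f z)"
  proof (rule holomorphic_extend_finite[OF finite_sing V])
    show "?f holomorphic_on ?V - sing"
      by (rule holomorphic_on_subset[of _ "U - sing"])
        (auto intro!: holomorphic_on_mult[OF term_holomorphic[OF l t]] holomorphic_on_subset[OF h])
    fix \<xi> assume "\<xi> \<in> sing" "\<xi> \<in> ?V"
    then obtain s where s: "\<xi> = of_real (s / L)" "\<xi> \<in> U" "\<xi> \<notin> ?J" by (auto simp: sing_def)
    have "s / L \<notin> {- \<theta> * real N / L .. (real M - \<theta>) / L}" using s by blast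
    then have sI: "s \<notin> {- real N * \<theta> .. real M - \<theta>}"
      using L_pos by (auto simp: field_simps)
    have "inv_S \<xi> * of_real (res l t s) = 0"
      using res_eq_0[OF l t sI] inv_S_eq_0[of s] s by (cases "s = real M + 1 - \<theta>") auto
    moreover have "((\<lambda>z. (z - \<xi>) * (\<Phi>t t z * inv_S z * obs t l (of_real L * z)) * h z) \<longlongrightarrow>
        \<Phi>t t \<xi> * inv_S \<xi> * (of_real (res l t s) / of_real L) * h \<xi>) (at \<xi>)"
      unfolding s(1) using isCont_U[OF h s(2)] s(2)
      by (intro tendsto_mult[OF term_residue[OF l t]]) (simp_all only: isCont_def s(1))
    ultimately show "((\<lambda>z. (z - \<xi>) * ?f z) \<longlongrightarrow> 0) (at \<xi>)"
      by (auto simp: mult.assoc)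
  qed
  then obtain g where g: "g holomorphic_on ?V" "\<And>z. z \<in> ?V - sing \<Longrightarrow> g z = ?f z" by auto
  obtain J where "(g has_contour_integral J) \<gamma>"
    using contour_integrable_holomorphic_simple[OF g(1) V vp(1) gV] by (auto simp: contour_integrable_on_def)
  then have "(?f has_contour_integral J) \<gamma>"
    by (rule has_contour_integral_spike_finite_simple_path[OF _ finite_sing vp(2)]) (use g(2) gV in auto)
  then show ?thesis by (auto simp: contour_integrable_on_def)
qed

text \<open>Below the string neither side has an added term and above it both have the same one. On
  the string only the lowered configuration has it, and by partial fractions it replaces the summand
  of the entry \<open>s - 1\<close> by that of \<open>s\<close>. Both values are entries, so
  \<open>vs_domain\<close> keeps the denominators away from 0.\<close>

lemma Y_string:
  assumes R: "string_rel s l l' i j a" and f: "f \<in> indices"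
  shows "Y f l + shift_term (Suc j) (of_real (s / L)) f = Y f l' + shift_term i (of_real (s / L)) f"
proof -
  obtain r n where rn: "f = (r, n)" "r \<in> {k..N}" "n \<in> {1..m r}" using f by (auto simp: indices_def)
  let ?u = "vs r n"
  have mem: "l \<in> X" "l' \<in> X" "l j a = s" "l' i a = s - 1" "j \<in> {k..N}" "i \<in> {k..N}" "a \<in> {1..i}" "a \<in> {1..j}"
    using R string_rel_lower_entries[OF R, of i] by (auto simp: string_rel_def)
  have "s \<in> {- real N * \<theta> .. real M - \<theta>}" "s - 1 \<in> {- real N * \<theta> .. real M - \<theta>}"
    using X_range[of l j a] X_range[of l' i a] mem by auto
  then have "complex_of_real s \<in> of_real ` {- real N * \<theta> .. real M - \<theta>}"
    "complex_of_real (s - 1) \<in> of_real ` {- real N * \<theta> .. real M - \<theta>}" by (blast intro: imageI)+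
  then have "of_real L * ?u \<noteq> of_real s" "of_real L * ?u \<noteq> of_real (s - 1)"
    using vs_domain[OF rn(2,3)] by metis+
  then have ne: "?u - of_real (s / L) \<noteq> 0" "?u - of_real ((s - 1) / L) \<noteq> 0"
    using L_pos by (auto simp: field_simps)
  have shift: "?u - of_real (s / L) + of_real (1 / L) = ?u - of_real ((s - 1) / L)"
    using L_pos by (simp add: field_simps)
  consider "r < i" | "i \<le> r" "r \<le> j" | "j < r" by linarith
  then show ?thesis
  proof cases
    case 1
    then have "l' r = l r" using R by (auto simp: string_rel_def shift_down_def)
    then show ?thesis using 1 R by (auto simp: rn Y_def G_obs_def shift_term_def string_rel_def)
  next
    case 2
    have ar: "a \<in> {1..r}" using 2 mem by auto
    have la: "l r a = s" "l' r a = s - 1"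
      using R 2 string_rel_lower_entries[OF R, of r] by (auto simp: string_rel_def)
    have other: "l' r b = l r b" if "b \<noteq> a" for b
      using R that by (auto simp: string_rel_def shift_down_def)
    let ?S = "\<Sum>b\<in>{1..r} - {a}. 1 / (?u - of_real (l r b / L))"
    have "Y f l = 1 / (?u - of_real (s / L)) + ?S"
      unfolding rn Y_def G_obs_def using ar la by (subst sum.remove[of _ a]) auto
    moreover have "Y f l' = 1 / (?u - of_real ((s - 1) / L)) + ?S"
      unfolding rn Y_def G_obs_def using ar la other by (subst sum.remove[of _ a]) auto
    moreover have "shift_term (Suc j) (of_real (s / L)) f = 0" using 2 by (simp add: shift_term_def rn)
    moreover have "shift_term i (of_real (s / L)) f = 1 / (of_real L * (?u - of_real (s / L)) * (?u - of_real ((s - 1) / L)))"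
      using 2 shift by (simp add: shift_term_def rn)
    moreover have "1 / (?u - of_real (s / L)) - 1 / (?u - of_real ((s - 1) / L)) =
        1 / (of_real L * (?u - of_real (s / L)) * (?u - of_real ((s - 1) / L)))"
    proof -
      have "1 / x - 1 / y = 1 / (of_real L * x * y)" if "x \<noteq> 0" "y \<noteq> 0" "y - x = 1 / of_real L" for x y :: complex
      proof -
        have "1 / x - 1 / y = (y - x) / (x * y)" using that by (simp add: field_simps)
        then show ?thesis using that by simp
      qed
      moreover have "(?u - of_real ((s - 1) / L)) - (?u - of_real (s / L)) = 1 / of_real L"
        using L_pos by (simp add: field_simps)
      ultimately show ?thesis using ne by blast
    qed
    ultimately show ?thesis by (simp add: algebra_simps)
  next
    case 3
    then have "l' r = l r" using R by (auto simp: string_rel_def shift_down_def)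
    then show ?thesis using 3 R by (auto simp: rn Y_def G_obs_def shift_term_def string_rel_def)
  qed
qed

definition total_coeff :: "nat \<Rightarrow> (nat \<Rightarrow> nat \<Rightarrow> real) \<Rightarrow> complex \<Rightarrow> complex" where
  "total_coeff t l z = (\<Sum>F\<in>Pow indices. (\<Prod>f\<in>indices - F. shift_term t z f) * cumulant_density l F)"

lemma total_coeff_holomorphic: "total_coeff t l holomorphic_on U"
  unfolding total_coeff_def[abs_def] by (intro holomorphic_intros shift_term_holomorphic) auto

lemma total_coeff_eq_cumul:
  "total_coeff t l z = cumul moment (\<lambda>A. of_real (prob l) * (\<Prod>f\<in>A. Y f l + shift_term t z f)) indices"
  unfolding total_coeff_def cumulant_density_def by (rule cumul_shift[symmetric]) (auto simp: finite_indices moment_empty)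

text \<open>By linearity the sum is \<open>cumul\<close> of a single right-hand side. On each
  \<open>A\<close> that right-hand side is an instance of \<open>residue_pairing\<close>, divided by
  the normalization, and hence 0.\<close>

lemma residues_cancel:
  assumes s: "s \<noteq> - real N * \<theta>" "s \<noteq> real M + 1 - \<theta>"
  shows "(\<Sum>l\<in>X. \<Sum>t\<in>{k..Suc N}. \<Phi>t t (of_real (s / L)) * of_real (res l t s) * total_coeff t l (of_real (s / L))) = 0"
proof -
  let ?z = "complex_of_real (s / L)"
  have Lz: "of_real L * ?z = of_real s" using L_pos by simp
  have "(\<Sum>x\<in>X \<times> {k..Suc N}. \<Phi>t (snd x) ?z * of_real (res (fst x) (snd x) s) *
      cumul moment (\<lambda>A. of_real (prob (fst x)) * (\<Prod>f\<in>A. Y f (fst x) + shift_term (snd x) ?z f)) indices) =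
    cumul moment (\<lambda>A. \<Sum>x\<in>X \<times> {k..Suc N}. \<Phi>t (snd x) ?z * of_real (res (fst x) (snd x) s) *
      (of_real (prob (fst x)) * (\<Prod>f\<in>A. Y f (fst x) + shift_term (snd x) ?z f))) indices"
    by (rule cumul_sum[symmetric]) (auto simp: finite_indices moment_empty)
  also have "\<dots> = cumul moment (\<lambda>A. 0) indices"
  proof (rule cumul_cong)
    fix A assume A: "A \<subseteq> indices"
    let ?H = "\<lambda>l t. \<Prod>f\<in>A. Y f l + shift_term t ?z f"
    let ?Z = "\<Sum>l\<in>X. weight \<theta> w N k l"
    have "(\<Sum>l\<in>X. \<Sum>t\<in>{k..Suc N}. of_real (res l t s) * (if t = Suc N then \<Phi>m (of_real s) else \<Phi>p (of_real s)) *
        (of_real (weight \<theta> w N k l) * ?H l t)) = 0"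
    proof (rule residue_pairing[where w = w])
      fix l l' i j a assume R: "string_rel s l l' i j a"
      show "?H l (Suc j) = ?H l' i" using A by (intro prod.cong refl Y_string[OF R]) auto
    qed (use w_pos s ratio in blast)+
    then have "(\<Sum>l\<in>X. \<Sum>t\<in>{k..Suc N}. of_real (res l t s) * (if t = Suc N then \<Phi>m (of_real s) else \<Phi>p (of_real s)) *
        (of_real (weight \<theta> w N k l) * ?H l t)) / of_real ?Z = 0" by simp
    also have "(\<Sum>l\<in>X. \<Sum>t\<in>{k..Suc N}. of_real (res l t s) * (if t = Suc N then \<Phi>m (of_real s) else \<Phi>p (of_real s)) *
        (of_real (weight \<theta> w N k l) * ?H l t)) / of_real ?Z =
      (\<Sum>l\<in>X. \<Sum>t\<in>{k..Suc N}. \<Phi>t t ?z * of_real (res l t s) * (of_real (prob l) * ?H l t))"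
      unfolding sum_divide_distrib \<Phi>t_def Lz prob_def
      by (intro sum.cong refl) (simp only: of_real_divide times_divide_eq_left times_divide_eq_right ac_simps)
    finally show "(\<Sum>x\<in>X \<times> {k..Suc N}. \<Phi>t (snd x) ?z * of_real (res (fst x) (snd x) s) *
      (of_real (prob (fst x)) * ?H (fst x) (snd x))) = 0"
      by (simp only: sum.cartesian_product case_prod_unfold)
  qed simp
  also have "\<dots> = 0"
    by (rule cumul_zero) (auto simp: finite_indices moment_empty)
  finally show ?thesis
    unfolding total_coeff_eq_cumul by (simp only: sum.cartesian_product case_prod_unfold)
qed

text \<open>All singularities in \<open>U\<close> are removable for the sum. Since \<open>U\<close>
  contains the contour and its inside, the winding number vanishes at every point off
  \<open>U\<close>, and the global Cauchy theorem applies.\<close>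

lemma total_integral:
  "contour_integral \<gamma> (\<lambda>z. \<Sum>l\<in>X. \<Sum>t\<in>{k..Suc N}. \<Phi>t t z * inv_S z * obs t l (of_real L * z) * total_coeff t l z) = 0"
proof -
  let ?f = "\<lambda>z. \<Sum>l\<in>X. \<Sum>t\<in>{k..Suc N}. \<Phi>t t z * inv_S z * obs t l (of_real L * z) * total_coeff t l z"
  have \<gamma>: "valid_path \<gamma>" "simple_path \<gamma>" "pathfinish \<gamma> = pathstart \<gamma>"
    using contour by (auto simp: pos_simple_contour_def)
  have "\<exists>g. g holomorphic_on U \<and> (\<forall>z\<in>U - sing. g z = ?f z)"
  proof (rule holomorphic_extend_finite[OF finite_sing open_U])
    show "?f holomorphic_on U - sing"
      by (intro holomorphic_on_sum holomorphic_on_mult[OF term_holomorphic] holomorphic_on_subset[OF total_coeff_holomorphic]) auto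
    fix \<xi> assume "\<xi> \<in> sing" and U: "\<xi> \<in> U"
    then obtain s where s: "\<xi> = of_real (s / L)" by (auto simp: sing_def)
    have "((\<lambda>z. \<Sum>l\<in>X. \<Sum>t\<in>{k..Suc N}. (z - \<xi>) * (\<Phi>t t z * inv_S z * obs t l (of_real L * z)) * total_coeff t l z) \<longlongrightarrow>
        (\<Sum>l\<in>X. \<Sum>t\<in>{k..Suc N}. \<Phi>t t \<xi> * inv_S \<xi> * (of_real (res l t s) / of_real L) * total_coeff t l \<xi>)) (at \<xi>)"
      unfolding s using isCont_U[OF total_coeff_holomorphic U] U
      by (intro tendsto_sum tendsto_mult[OF term_residue]) (simp_all only: isCont_def s)
    also have "(\<Sum>l\<in>X. \<Sum>t\<in>{k..Suc N}. \<Phi>t t \<xi> * inv_S \<xi> * (of_real (res l t s) / of_real L) * total_coeff t l \<xi>) =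
        inv_S \<xi> / of_real L * (\<Sum>l\<in>X. \<Sum>t\<in>{k..Suc N}. \<Phi>t t \<xi> * of_real (res l t s) * total_coeff t l \<xi>)"
      unfolding sum_distrib_left by (intro sum.cong refl) (simp only: times_divide_eq_left times_divide_eq_right ac_simps)
    also have "\<dots> = 0"
    proof (cases "s = - real N * \<theta> \<or> s = real M + 1 - \<theta>")
      case True
      then show ?thesis using inv_S_eq_0[OF True] by (simp only: s) simp
    next
      case False
      then show ?thesis using residues_cancel[of s] by (simp only: s) simp
    qed
    finally show "((\<lambda>z. (z - \<xi>) * ?f z) \<longlongrightarrow> 0) (at \<xi>)"
      by (simp only: sum_distrib_left mult.assoc)
  qed
  then obtain g where g: "g holomorphic_on U" "\<And>z. z \<in> U - sing \<Longrightarrow> g z = ?f z" by auto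
  have "(g has_contour_integral 0) \<gamma>"
  proof (rule Cauchy_theorem_global[OF open_U g(1) \<gamma>(1,3)])
    show "path_image \<gamma> \<subseteq> U" using contour_in_U by auto
    fix z assume "z \<notin> U"
    then have "z \<in> outside (path_image \<gamma>)"
      using contour_in_U inside_Un_outside[of "path_image \<gamma>"] by blast
    then show "winding_number \<gamma> z = 0"
      using \<gamma> by (intro winding_number_zero_in_outside) (auto simp: valid_path_imp_path)
  qed
  then have "(?f has_contour_integral 0) \<gamma>"
    by (rule has_contour_integral_spike_finite_simple_path[OF _ finite_sing \<gamma>(2)]) (use g(2) contour_in_U in auto)
  then show ?thesis by (rule contour_integral_unique)
qed

section \<open>Return from the shifted cumulants to the terms of the theorem\<close>

lemma shift_term_prod:
  assumes F: "F \<in> (\<Pi>\<^sub>E r\<in>{k..N}. Pow {1..m r})" and t: "t \<in> {k..Suc N}"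
  shows "(\<Prod>f\<in>indices - (SIGMA r:{k..N}. F r). shift_term t z f) =
    (\<Prod>i = k..t - 1. of_bool (F i = {1..m i})) *
    (\<Prod>i = t..N. \<Prod>f\<in>{1..m i} - F i. 1 / (of_real L * (vs i f - z) * (vs i f - z + of_real (1 / L))))"
proof -
  have "indices - (SIGMA r:{k..N}. F r) = (SIGMA r:{k..N}. {1..m r} - F r)" by (auto simp: indices_def)
  then have "(\<Prod>f\<in>indices - (SIGMA r:{k..N}. F r). shift_term t z f) = (\<Prod>i = k..N. \<Prod>n\<in>{1..m i} - F i. shift_term t z (i, n))"
    by (simp add: prod.Sigma)
  \<comment> \<open>For \<open>t = k\<close> the first range is empty because \<open>k\<close> is at
    least 1, which rules out truncated subtraction; for \<open>t = Suc N\<close> the second range is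
    empty.\<close>
  also have "\<dots> = (\<Prod>i\<in>{k..t - 1} \<union> {t..N}. \<Prod>n\<in>{1..m i} - F i. shift_term t z (i, n))"
    using t by (intro prod.cong) auto
  also have "\<dots> = (\<Prod>i = k..t - 1. \<Prod>n\<in>{1..m i} - F i. shift_term t z (i, n)) * (\<Prod>i = t..N. \<Prod>n\<in>{1..m i} - F i. shift_term t z (i, n))"
    using t k_pos by (intro prod.union_disjoint) auto
  also have "(\<Prod>i = k..t - 1. \<Prod>n\<in>{1..m i} - F i. shift_term t z (i, n)) = (\<Prod>i = k..t - 1. of_bool (F i = {1..m i}))"
  proof (intro prod.cong refl)
    fix i assume i: "i \<in> {k..t - 1}"
    then have it: "i < t" and sub: "F i \<subseteq> {1..m i}" using F t k_pos by (auto simp: PiE_iff)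
    show "(\<Prod>n\<in>{1..m i} - F i. shift_term t z (i, n)) = of_bool (F i = {1..m i})"
    proof (cases "F i = {1..m i}")
      case False
      then obtain n where "n \<in> {1..m i} - F i" using sub by blast
      then have "(\<Prod>n\<in>{1..m i} - F i. shift_term t z (i, n)) = 0"
        using it by (intro prod_zero bexI[of _ n]) (auto simp: shift_term_def)
      then show ?thesis using False by simp
    qed simp
  qed
  also have "(\<Prod>i = t..N. \<Prod>n\<in>{1..m i} - F i. shift_term t z (i, n)) =
      (\<Prod>i = t..N. \<Prod>f\<in>{1..m i} - F i. 1 / (of_real L * (vs i f - z) * (vs i f - z + of_real (1 / L))))"
    by (intro prod.cong refl) (auto simp: shift_term_def)
  finally show ?thesis .
qed

lemma term_integral:
  assumes F: "F \<in> (\<Pi>\<^sub>E r\<in>{k..N}. Pow {1..m r})" and t: "t \<in> {k..Suc N}"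
  shows "(\<Prod>i = k..t - 1. of_bool (F i = {1..m i})) *
      contour_integral \<gamma> (\<lambda>z. \<Phi>t t z / (2 * of_real pi * \<i> * S_scaled \<theta> M N L v z) *
        (\<Prod>i = t..N. \<Prod>f\<in>{1..m i} - F i. 1 / (of_real L * (vs i f - z) * (vs i f - z + of_real (1 / L)))) *
        cumulant_G \<theta> w M N k L vs (\<lambda>l. obs t l (of_real L * z)) F) =
    (\<Sum>l\<in>X. contour_integral \<gamma> (\<lambda>z. \<Phi>t t z * inv_S z * obs t l (of_real L * z) *
      ((\<Prod>f\<in>indices - (SIGMA r:{k..N}. F r). shift_term t z f) * cumulant_density l (SIGMA r:{k..N}. F r))))"
proof -
  define b :: complex where "b = (\<Prod>i = k..t - 1. of_bool (F i = {1..m i}))"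
  let ?g = "\<lambda>z. \<Prod>i = t..N. \<Prod>f\<in>{1..m i} - F i. 1 / (of_real L * (vs i f - z) * (vs i f - z + of_real (1 / L)))"
  let ?S = "SIGMA r:{k..N}. F r"
  have cG: "cumulant_G \<theta> w M N k L vs \<xi> F = (\<Sum>l\<in>X. \<xi> l * cumulant_density l ?S)" for \<xi>
    using F by (intro cumulant_G_eq) (auto simp: PiE_iff)
  \<comment> \<open>A factor 0 or 1 passes through \<open>contour_integral\<close> without knowing
    that the integrand is integrable.\<close>
  have b01: "b = 0 \<or> b = 1"
    unfolding b_def by (cases "\<forall>i\<in>{k..t - 1}. F i = {1..m i}") (auto intro!: prod_zero)
  have "b * contour_integral \<gamma> f = contour_integral \<gamma> (\<lambda>z. b * f z)" for f
    using b01 by auto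
  then have "b * contour_integral \<gamma> (\<lambda>z. \<Phi>t t z / (2 * of_real pi * \<i> * S_scaled \<theta> M N L v z) * ?g z *
        cumulant_G \<theta> w M N k L vs (\<lambda>l. obs t l (of_real L * z)) F) =
      contour_integral \<gamma> (\<lambda>z. b * (\<Phi>t t z / (2 * of_real pi * \<i> * S_scaled \<theta> M N L v z) * ?g z *
        cumulant_G \<theta> w M N k L vs (\<lambda>l. obs t l (of_real L * z)) F))" .
  also have "\<dots> = contour_integral \<gamma> (\<lambda>z. \<Sum>l\<in>X. \<Phi>t t z * inv_S z * obs t l (of_real L * z) *
      ((\<Prod>f\<in>indices - ?S. shift_term t z f) * cumulant_density l ?S))"
    unfolding \<Phi>t_over_S cG shift_term_prod[OF F t] b_def[symmetric] sum_distrib_left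
    by (simp only: ac_simps)
  also have "\<dots> = (\<Sum>l\<in>X. contour_integral \<gamma> (\<lambda>z. \<Phi>t t z * inv_S z * obs t l (of_real L * z) *
      ((\<Prod>f\<in>indices - ?S. shift_term t z f) * cumulant_density l ?S)))"
    by (intro contour_integral_sum finite_X_set term_integrable t holomorphic_intros shift_term_holomorphic) auto
  finally show ?thesis unfolding b_def .
qed

lemma bij_betw_Pow_indices:
  "bij_betw (\<lambda>F. SIGMA r:{k..N}. F r) (\<Pi>\<^sub>E r\<in>{k..N}. Pow {1..m r}) (Pow indices)"
proof (rule bij_betw_byWitness[where f' = "\<lambda>S. \<lambda>r\<in>{k..N}. {n. (r, n) \<in> S}"])
  show "\<forall>F\<in>\<Pi>\<^sub>E r\<in>{k..N}. Pow {1..m r}. (\<lambda>r\<in>{k..N}. {n. (r, n) \<in> (SIGMA r:{k..N}. F r)}) = F"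
    by (auto simp: PiE_iff extensional_def fun_eq_iff)
  show "\<forall>S\<in>Pow indices. (SIGMA r:{k..N}. (\<lambda>r\<in>{k..N}. {n. (r, n) \<in> S}) r) = S"
    by (auto simp: indices_def)
  show "(\<lambda>F. SIGMA r:{k..N}. F r) ` (\<Pi>\<^sub>E r\<in>{k..N}. Pow {1..m r}) \<subseteq> Pow indices"
    by (auto simp: indices_def PiE_iff)
  show "(\<lambda>S. \<lambda>r\<in>{k..N}. {n. (r, n) \<in> S}) ` Pow indices \<subseteq> (\<Pi>\<^sub>E r\<in>{k..N}. Pow {1..m r})"
    by (auto simp: indices_def PiE_iff)
qed

text \<open>The index \<open>t\<close> unifies the three kinds of terms. Each integrand is
  integrable by itself, so the finite sums can be moved under one integral, where the sum over
  \<open>F\<close> becomes \<open>total_coeff\<close>.\<close>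

lemma loop_equation:
  "(\<Sum>F\<in>(\<Pi>\<^sub>E r\<in>{k..N}. Pow {1..m r}). \<Sum>t\<in>{k..Suc N}. (\<Prod>i = k..t - 1. of_bool (F i = {1..m i})) *
      contour_integral \<gamma> (\<lambda>z. \<Phi>t t z / (2 * of_real pi * \<i> * S_scaled \<theta> M N L v z) *
        (\<Prod>i = t..N. \<Prod>f\<in>{1..m i} - F i. 1 / (of_real L * (vs i f - z) * (vs i f - z + of_real (1 / L)))) *
        cumulant_G \<theta> w M N k L vs (\<lambda>l. obs t l (of_real L * z)) F)) = 0" (is "?lhs = 0")
proof -
  let ?T = "\<lambda>F t l z. \<Phi>t t z * inv_S z * obs t l (of_real L * z) * ((\<Prod>f\<in>indices - F. shift_term t z f) * cumulant_density l F)"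
  have int: "?T F t l contour_integrable_on \<gamma>" if "l \<in> X" "t \<in> {k..Suc N}" for F t l
    using that by (intro term_integrable holomorphic_intros shift_term_holomorphic) auto
  have "?lhs = (\<Sum>F\<in>(\<Pi>\<^sub>E r\<in>{k..N}. Pow {1..m r}). \<Sum>t\<in>{k..Suc N}. \<Sum>l\<in>X.
      contour_integral \<gamma> (?T (SIGMA r:{k..N}. F r) t l))"
    by (intro sum.cong refl term_integral)
  also have "\<dots> = (\<Sum>F\<in>Pow indices. \<Sum>t\<in>{k..Suc N}. \<Sum>l\<in>X. contour_integral \<gamma> (?T F t l))"
    by (rule sum.reindex_bij_betw[OF bij_betw_Pow_indices])
  also have "\<dots> = contour_integral \<gamma> (\<lambda>z. \<Sum>F\<in>Pow indices. \<Sum>t\<in>{k..Suc N}. \<Sum>l\<in>X. ?T F t l z)"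
  proof (rule contour_integral_unique[symmetric])
    show "((\<lambda>z. \<Sum>F\<in>Pow indices. \<Sum>t\<in>{k..Suc N}. \<Sum>l\<in>X. ?T F t l z) has_contour_integral
        (\<Sum>F\<in>Pow indices. \<Sum>t\<in>{k..Suc N}. \<Sum>l\<in>X. contour_integral \<gamma> (?T F t l))) \<gamma>"
      by (intro has_contour_integral_sum has_contour_integral_integral int finite_X_set)
        (simp_all add: finite_indices)
  qed
  also have "(\<lambda>z. \<Sum>F\<in>Pow indices. \<Sum>t\<in>{k..Suc N}. \<Sum>l\<in>X. ?T F t l z) =
      (\<lambda>z. \<Sum>l\<in>X. \<Sum>t\<in>{k..Suc N}. \<Phi>t t z * inv_S z * obs t l (of_real L * z) * total_coeff t l z)"
  proof
    fix z
    have "(\<Sum>F\<in>Pow indices. \<Sum>t\<in>{k..Suc N}. \<Sum>l\<in>X. ?T F t l z) = (\<Sum>l\<in>X. \<Sum>F\<in>Pow indices. \<Sum>t\<in>{k..Suc N}. ?T F t l z)"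
      by (subst sum.swap[of _ X], intro sum.cong refl sum.swap)
    also have "\<dots> = (\<Sum>l\<in>X. \<Sum>t\<in>{k..Suc N}. \<Sum>F\<in>Pow indices. ?T F t l z)"
      by (intro sum.cong refl sum.swap)
    finally show "(\<Sum>F\<in>Pow indices. \<Sum>t\<in>{k..Suc N}. \<Sum>l\<in>X. ?T F t l z) =
        (\<Sum>l\<in>X. \<Sum>t\<in>{k..Suc N}. \<Phi>t t z * inv_S z * obs t l (of_real L * z) * total_coeff t l z)"
      by (simp only: total_coeff_def sum_distrib_left)
  qed
  finally show ?thesis using total_integral by simp
qed

end

theorem lemma3p5:
  fixes \<theta> :: real and N k M :: nat and w :: "real \<Rightarrow> real"
    and \<M> :: "complex set" and \<Phi>p \<Phi>m :: "complex \<Rightarrow> complex"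
    and L :: real and m :: "nat \<Rightarrow> nat" and vs :: "nat \<Rightarrow> nat \<Rightarrow> complex"
    and \<gamma> :: "real \<Rightarrow> complex" and v :: complex
  assumes theta_pos: "\<theta> > 0"
    and k_range: "1 \<le> k" "k \<le> N"
    and w_pos: "\<And>x. x \<in> {- real N * \<theta> .. real M - \<theta>} \<Longrightarrow> w x > 0"
    and domain_open: "open \<M>"
    and domain_interval: "complex_of_real ` {- real N * \<theta> .. real M + 1 - \<theta>} \<subseteq> \<M>"
    and holo_plus: "\<Phi>p holomorphic_on \<M>"
    and holo_minus: "\<Phi>m holomorphic_on \<M>"
    and ratio: "\<And>x. x \<in> {- real N * \<theta> + 1 .. real M - \<theta>} \<Longrightarrow>
          complex_of_real (w x / w (x - 1)) = \<Phi>p (of_real x) / \<Phi>m (of_real x)"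
    and L_pos: "L > 0"
    and vs_domain: "\<And>j i. j \<in> {k..N} \<Longrightarrow> i \<in> {1..m j} \<Longrightarrow>
          of_real L * vs j i \<in> \<M> - complex_of_real ` {- real N * \<theta> .. real M - \<theta>}"
    and contour: "pos_simple_contour \<gamma>"
    and contour_domain: "\<And>z. z \<in> path_image \<gamma> \<union> inside (path_image \<gamma>) \<Longrightarrow> of_real L * z \<in> \<M>"
    and contour_encloses:
      "complex_of_real ` {- \<theta> * real N / L .. (real M - \<theta>) / L} \<subseteq> inside (path_image \<gamma>)"
    and contour_excludes: "\<And>j i. j \<in> {k..N} \<Longrightarrow> i \<in> {1..m j} \<Longrightarrow>
          vs j i \<in> outside (path_image \<gamma>) \<and> vs j i + of_real (1 / L) \<in> outside (path_image \<gamma>)"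
    and v_outside: "v \<in> outside (path_image \<gamma>)"
  shows
    "0 = (\<Sum>F\<in>(\<Pi>\<^sub>E r\<in>{k..N}. Pow {1..m r}).
        (\<Prod>i = k..N. of_bool (F i = {1..m i})) *
          contour_integral \<gamma> (\<lambda>z.
            \<Phi>m (of_real L * z) / (2 * of_real pi * \<i> * S_scaled \<theta> M N L v z) *
            cumulant_G \<theta> w M N k L vs
              (\<lambda>l. \<Prod>p = 1..N. (of_real L * z - of_real (l N p) - of_real \<theta>) /
                               (of_real L * z - of_real (l N p))) F)
      + contour_integral \<gamma> (\<lambda>z.
            \<Phi>p (of_real L * z) / (2 * of_real pi * \<i> * S_scaled \<theta> M N L v z) *
            (\<Prod>i = k..N. \<Prod>f\<in>{1..m i} - F i.
               1 / (of_real L * (vs i f - z) * (vs i f - z + of_real (1 / L)))) *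
            cumulant_G \<theta> w M N k L vs
              (\<lambda>l. \<Prod>p = 1..k. (of_real L * z - of_real (l k p) + of_real \<theta> - 1) /
                               (of_real L * z - of_real (l k p) - 1)) F)
      + (\<Sum>j = k + 1..N. (\<Prod>i = k..j - 1. of_bool (F i = {1..m i})) *
          contour_integral \<gamma> (\<lambda>z.
            \<Phi>p (of_real L * z) / (2 * of_real pi * \<i> * S_scaled \<theta> M N L v z) *
            (\<Prod>i = j..N. \<Prod>f\<in>{1..m i} - F i.
               1 / (of_real L * (vs i f - z) * (vs i f - z + of_real (1 / L)))) *
            cumulant_G \<theta> w M N k L vs (Pi_obs \<theta> j (of_real L * z)) F)))"
proof -
  interpret loop_setting \<theta> N k M w \<M> \<Phi>p \<Phi>m L m vs \<gamma> v
  proof unfold_locales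
    show "of_real L * vs j i \<notin> complex_of_real ` {- real N * \<theta> .. real M - \<theta>}"
      if "j \<in> {k..N}" "i \<in> {1..m j}" for j i
      using vs_domain[OF that] by blast
  qed (fact assms)+
  let ?T = "\<lambda>F t. (\<Prod>i = k..t - 1. of_bool (F i = {1..m i})) *
      contour_integral \<gamma> (\<lambda>z. \<Phi>t t z / (2 * of_real pi * \<i> * S_scaled \<theta> M N L v z) *
        (\<Prod>i = t..N. \<Prod>f\<in>{1..m i} - F i. 1 / (of_real L * (vs i f - z) * (vs i f - z + of_real (1 / L)))) *
        cumulant_G \<theta> w M N k L vs (\<lambda>l. obs t l (of_real L * z)) F)"
  \<comment> \<open>The index \<open>Suc N\<close> gives the term with \<open>\<Phi>m\<close>, the
    index \<open>k\<close> the term without indicators, and the indices between them the sum over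
    \<open>j\<close>.\<close>
  have split: "(\<Sum>t\<in>{k..Suc N}. f t) = f (Suc N) + f k + (\<Sum>t = k + 1..N. f t)" for f :: "nat \<Rightarrow> complex"
  proof -
    have e: "{k..Suc N} = insert (Suc N) (insert k {k + 1..N})" using k_range by auto
    show ?thesis unfolding e using k_range by (subst sum.insert; simp)
  qed
  have top: "\<Phi>t (Suc N) z = \<Phi>m (of_real L * z)" "obs (Suc N) l \<zeta> =
      (\<Prod>p = 1..N. (\<zeta> - of_real (l N p) - of_real \<theta>) / (\<zeta> - of_real (l N p)))" for z l \<zeta>
    by (simp_all add: \<Phi>t_def obs_def)
  have low: "\<Phi>t t z = \<Phi>p (of_real L * z)" if "t \<le> N" for t z
    using that by (simp add: \<Phi>t_def)
  have bot: "obs k l \<zeta> =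
      (\<Prod>p = 1..k. (\<zeta> - of_real (l k p) + of_real \<theta> - 1) / (\<zeta> - of_real (l k p) - 1))" for l \<zeta>
    using k_range by (simp add: obs_def)
  have mid: "obs t l \<zeta> = Pi_obs \<theta> t \<zeta> l" if "t \<in> {k + 1..N}" for t l \<zeta>
    using that by (simp add: obs_def)
  have empties: "{k..k - 1} = {}" "{Suc N..N} = {}" "Suc N - 1 = N" using k_range by auto
  have Tk: "?T F k = contour_integral \<gamma> (\<lambda>z.
            \<Phi>p (of_real L * z) / (2 * of_real pi * \<i> * S_scaled \<theta> M N L v z) *
            (\<Prod>i = k..N. \<Prod>f\<in>{1..m i} - F i.
               1 / (of_real L * (vs i f - z) * (vs i f - z + of_real (1 / L)))) *
            cumulant_G \<theta> w M N k L vs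
              (\<lambda>l. \<Prod>p = 1..k. (of_real L * z - of_real (l k p) + of_real \<theta> - 1) /
                               (of_real L * z - of_real (l k p) - 1)) F)" for F
    by (simp only: empties low[OF k_range(2)] bot prod.empty mult_1_left)
  have TN: "?T F (Suc N) = (\<Prod>i = k..N. of_bool (F i = {1..m i})) *
          contour_integral \<gamma> (\<lambda>z.
            \<Phi>m (of_real L * z) / (2 * of_real pi * \<i> * S_scaled \<theta> M N L v z) *
              cumulant_G \<theta> w M N k L vs
              (\<lambda>l. \<Prod>p = 1..N. (of_real L * z - of_real (l N p) - of_real \<theta>) /
                               (of_real L * z - of_real (l N p))) F)" for F
    by (simp only: empties top prod.empty mult_1_right)
  let ?R = "\<lambda>F t. (\<Prod>i = k..t - 1. of_bool (F i = {1..m i})) *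
          contour_integral \<gamma> (\<lambda>z.
            \<Phi>p (of_real L * z) / (2 * of_real pi * \<i> * S_scaled \<theta> M N L v z) *
            (\<Prod>i = t..N. \<Prod>f\<in>{1..m i} - F i.
               1 / (of_real L * (vs i f - z) * (vs i f - z + of_real (1 / L)))) *
            cumulant_G \<theta> w M N k L vs (Pi_obs \<theta> t (of_real L * z)) F)"
  have Tt: "?T F t = ?R F t"
    if t: "t \<in> {k + 1..N}" for F t
  proof -
    have "t \<le> N" using t by simp
    show ?thesis by (simp only: low[OF \<open>t \<le> N\<close>] mid[OF t])
  qed
  have mid_terms: "(\<Sum>t = k + 1..N. ?T F t) = (\<Sum>t = k + 1..N. ?R F t)" for F
    by (intro sum.cong refl Tt)
  show ?thesis
    using loop_equation unfolding split TN Tk mid_terms by (rule sym)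
qed

end
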